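(* There is an algorithm which, given a finite set $B$ of permutations, decides whether the permutation class $\mathrm{Av}(B)$ contains infinitely many simple permutations.
   Context: A permutation $\pi$ contains $\sigma$ if some subsequence of $\pi$ has the same relative order as $\sigma$. $\mathrm{Av}(B)$ is the set of permutations containing no element of $B$. An interval of a permutation is a set of contiguous positions whose values form a contiguous set; a permutation of length $n$ is simple if its only intervals have sizes $0,1,n$. *)

theory Defs
  imports Main "HOL-Library.Nat_Bijection"
begin

definition is_perm :: "nat list \<Rightarrow> bool" where
  "is_perm p \<longleftrightarrow> distinct p \<and> set p = {0..<length p}"

definition contains :: "nat list \<Rightarrow> nat list \<Rightarrow> bool" where
  "contains pi sigma \<longleftrightarrow>
     (\<exists>idx. length idx = length sigma \<and> sorted_wrt (<) idx \<and>
        (\<forall>i\<in>set idx. i < length pi) \<and>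
        (\<forall>i<length sigma. \<forall>j<length sigma.
            (pi ! (idx ! i) < pi ! (idx ! j)) = (sigma ! i < sigma ! j)))"

definition Av :: "nat list set \<Rightarrow> nat list set" where
  "Av B = {p. is_perm p \<and> (\<forall>b\<in>B. \<not> contains p b)}"

definition is_interval :: "nat list \<Rightarrow> nat \<Rightarrow> nat \<Rightarrow> bool" where
  "is_interval p i j \<longleftrightarrow> i \<le> j \<and> j \<le> length p \<and>
     (\<exists>a. (\<lambda>k. p ! k) ` {i..<j} = {a..<a + (j - i)})"

definition simple :: "nat list \<Rightarrow> bool" where
  "simple p \<longleftrightarrow> is_perm p \<and>
     (\<forall>i j. is_interval p i j \<longrightarrow> j - i = 0 \<or> j - i = 1 \<or> j - i = length p)"

datatype recf = Zero | Succ | Proj nat | Comp recf "recf list" | PrimRec recf recf | Minim recf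

inductive eval :: "recf \<Rightarrow> nat list \<Rightarrow> nat \<Rightarrow> bool" where
  zero: "eval Zero xs 0"
| succ: "eval Succ (x # xs) (Suc x)"
| proj: "i < length xs \<Longrightarrow> eval (Proj i) xs (xs ! i)"
| comp: "length ys = length gs \<Longrightarrow> (\<forall>k<length gs. eval (gs ! k) xs (ys ! k)) \<Longrightarrow>
         eval f ys z \<Longrightarrow> eval (Comp f gs) xs z"
| pr0: "eval g xs y \<Longrightarrow> eval (PrimRec g h) (0 # xs) y"
| prS: "eval (PrimRec g h) (n # xs) y \<Longrightarrow> eval h (n # y # xs) z \<Longrightarrow>
        eval (PrimRec g h) (Suc n # xs) z"
| mn: "eval f (n # xs) 0 \<Longrightarrow> (\<forall>m<n. \<exists>y. eval f (m # xs) (Suc y)) \<Longrightarrow>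
       eval (Minim f) xs n"

definition code_perms :: "nat list list \<Rightarrow> nat" where
  "code_perms bs = list_encode (map list_encode bs)"

end

(*
  The class has infinitely many simple members iff some word of a computable length K over a fixed
  finite alphabet describes a permutation avoiding B.  A word places points one after the other,
  the position of the j-th point relative to the i-th being determined by the letters i and j and
  by whether j = i + 1; the words describe pin sequences, parallel alternations and wedges with one
  extra point.

  Pumping: whether a word avoids B is recognised by a finite automaton whose states record the
  partial embeddings of the elements of B, so one avoiding word of length K yields arbitrarily long
  ones, and each of them contains a simple permutation that is shorter by at most 4.

  Unavoidability: in a simple permutation every pair of adjacent positions starts a pin sequence
  reaching the last position.  If these sequences are short, many have equal length and end in a
  common separating line; walking back along them, either the separated intervals are disjoint,
  which gives an alternation, or many share a point, which gives a common line one pin earlier.  By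
  Ramsey a long alternation is parallel or a wedge, and a short pin sequence leaving a long wedge
  has to jump far in a single step, and the jumping pin is the required extra point.
*)
theory Submission
  imports Defs "HOL-Library.Ramsey" "HOL-Library.Cardinality"
begin

text \<open>One length \<open>K\<close> serves both halves of the equivalence because they make
  different demands. From infinitely many simple members only one word of length exactly
  \<open>K\<close> has to be extracted, so the Ramsey bound behind the extraction stays outside the
  algorithm. The algorithm computes \<open>K\<close> from the number of automaton states and
  searches all words of that length; every quantifier is bounded and the program is primitive
  recursive. In the other direction the extracted points need not form a simple set: simplicity is
  regained from the shape of the word, and a bounded loss at its ends is harmless once words are
  arbitrarily long. The obstacle is that a finite automaton has to see the relative position of two
  points although coordinates depend on the whole word. Hence points are listed in order of
  placement, and a new point is located relative to each earlier one by the two letters alone, with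
  one exception: a pin separates its immediate predecessor from the rest. This is why adjacency is
  an argument of the rule and why states remember the entry sent to the last letter.\<close>

section \<open>Computable functions\<close>

text \<open>
  Arguments are environments, of which all sufficiently long prefixes must be accepted; binders then
  become shifts \<open>\<lambda>i. e (Suc i)\<close> and no arities have to be tracked.
\<close>

definition computable :: "((nat \<Rightarrow> nat) \<Rightarrow> nat) \<Rightarrow> bool" where
  "computable F \<longleftrightarrow> (\<exists>f N. \<forall>m\<ge>N. \<forall>e. eval f (map e [0..<m]) (F e))"

lemma computable_var: "computable (\<lambda>e. e i)"
  unfolding computable_def
proof (intro exI allI impI)
  fix m e assume "Suc i \<le> m"
  then show "eval (Proj i) (map e [0..<m]) (e i)"
    using eval.proj[of i "map e [0..<m]"] by simp
qed

text \<open>\<open>F\<close> reads only a prefix of some length \<open>N\<close>, so although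
  infinitely many functions are substituted, only \<open>N\<close> of their thresholds matter and a
  maximum exists.\<close>

lemma computable_subst:
  assumes F: "computable F" and G: "\<And>i. computable (G i)"
  shows "computable (\<lambda>e. F (\<lambda>i. G i e))"
proof -
  obtain f N where f: "\<And>m e. m \<ge> N \<Longrightarrow> eval f (map e [0..<m]) (F e)"
    using F unfolding computable_def by blast
  have "\<forall>i. \<exists>g M. \<forall>m\<ge>M. \<forall>e. eval g (map e [0..<m]) (G i e)"
    using G unfolding computable_def by blast
  then obtain g M where g: "\<And>i m e. m \<ge> M i \<Longrightarrow> eval (g i) (map e [0..<m]) (G i e)"
    by metis
  show ?thesis unfolding computable_def
  proof (intro exI allI impI)
    fix m e assume m: "Max (insert 0 (M ` {0..<N})) \<le> m"
    have M: "M i \<le> m" if "i < N" for i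
      using Max_ge[of "insert 0 (M ` {0..<N})" "M i"] that m by simp
    show "eval (Comp f (map g [0..<N])) (map e [0..<m]) (F (\<lambda>i. G i e))"
    proof (rule eval.comp)
      show "eval f (map (\<lambda>i. G i e) [0..<N]) (F (\<lambda>i. G i e))"
        by (rule f) simp
    qed (use M g in auto)
  qed
qed

lemma computable_rec_aux:
  assumes G: "computable G" and H: "computable (\<lambda>e. H (e 0) (e (Suc 0)) (\<lambda>i. e (Suc (Suc i))))"
  shows "computable (\<lambda>e. rec_nat (G (\<lambda>i. e (Suc i))) (\<lambda>k r. H k r (\<lambda>i. e (Suc i))) (e 0))"
proof -
  obtain g N where g: "\<And>m e. m \<ge> N \<Longrightarrow> eval g (map e [0..<m]) (G e)"
    using G unfolding computable_def by blast
  obtain h M where h: "\<And>m e. m \<ge> M \<Longrightarrow>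
      eval h (map e [0..<m]) (H (e 0) (e (Suc 0)) (\<lambda>i. e (Suc (Suc i))))"
    using H unfolding computable_def by blast
  have *: "eval (PrimRec g h) (k # map e [0..<m]) (rec_nat (G e) (\<lambda>k r. H k r e) k)"
    if "m \<ge> max N M" for m e k
  proof (induction k)
    case 0
    show ?case using g[of m e] that by (simp add: eval.pr0)
  next
    case (Suc k)
    let ?r = "rec_nat (G e) (\<lambda>k r. H k r e) k"
    let ?e = "case_nat k (case_nat ?r e)"
    have "eval h (map ?e [0..<Suc (Suc m)]) (H (?e 0) (?e (Suc 0)) (\<lambda>i. ?e (Suc (Suc i))))"
      by (rule h) (use that in simp)
    moreover have "map ?e [0..<Suc (Suc m)] = k # ?r # map e [0..<m]"
      by (simp add: map_upt_Suc del: upt_Suc)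
    ultimately show ?case using Suc by (simp add: eval.prS)
  qed
  show ?thesis unfolding computable_def
  proof (intro exI allI impI)
    fix m e assume "Suc (max N M) \<le> m"
    then obtain k where k: "m = Suc k" "k \<ge> max N M" by (cases m) auto
    show "eval (PrimRec g h) (map e [0..<m])
        (rec_nat (G (\<lambda>i. e (Suc i))) (\<lambda>k r. H k r (\<lambda>i. e (Suc i))) (e 0))"
      using *[OF k(2), of "e 0" "\<lambda>i. e (Suc i)"] unfolding k(1)
      by (simp add: map_upt_Suc del: upt_Suc)
  qed
qed

text \<open>The number of rounds is prepended to the environment, where
  \<open>computable_rec_aux\<close> expects it as entry 0.\<close>

lemma computable_rec:
  assumes B: "computable B" and G: "computable G"
    and H: "computable (\<lambda>e. H (e 0) (e (Suc 0)) (\<lambda>i. e (Suc (Suc i))))"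
  shows "computable (\<lambda>e. rec_nat (G e) (\<lambda>k r. H k r e) (B e))"
proof -
  have "computable (case i of 0 \<Rightarrow> B | Suc j \<Rightarrow> (\<lambda>e. e j))" for i
    using B by (cases i) (auto intro: computable_var)
  then show ?thesis
    using computable_subst[OF computable_rec_aux[OF G H],
        where G = "\<lambda>i. case i of 0 \<Rightarrow> B | Suc j \<Rightarrow> (\<lambda>e. e j)"] by simp
qed

lemma computable_shift: "computable F \<Longrightarrow> computable (\<lambda>e. F (\<lambda>i. e (Suc i)))"
  using computable_subst[of F "\<lambda>i e. e (Suc i)"] computable_var by simp

lemma computable_0: "computable (\<lambda>e. 0)"
  unfolding computable_def by (intro exI[of _ Zero]) (auto intro: eval.zero)

lemma computable_Suc_aux: "computable (\<lambda>e. Suc (e 0))"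
  unfolding computable_def
proof (intro exI allI impI)
  fix m :: nat and e :: "nat \<Rightarrow> nat" assume "1 \<le> m"
  then obtain k where "m = Suc k" by (cases m) auto
  then show "eval Succ (map e [0..<m]) (Suc (e 0))"
    by (simp add: map_upt_Suc eval.succ del: upt_Suc)
qed

lemma computable_Suc: "computable F \<Longrightarrow> computable (\<lambda>e. Suc (F e))"
  using computable_subst[OF computable_Suc_aux, of "\<lambda>i. F"] by simp

lemma computable_const: "computable (\<lambda>e. n)"
  by (induction n) (auto intro: computable_0 computable_Suc)

lemma computable_plus:
  assumes "computable F" "computable G" shows "computable (\<lambda>e. F e + G e)"
proof -
  have "rec_nat b (\<lambda>k r. Suc r) a = a + b" for a b by (induction a) auto
  then show ?thesis
    using computable_rec[OF assms, of "\<lambda>k r e. Suc r"] computable_var computable_Suc by simp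
qed

lemma computable_sum:
  assumes B: "computable B" and F: "computable (\<lambda>e. F (e 0) (\<lambda>i. e (Suc i)))"
  shows "computable (\<lambda>e. \<Sum>k<B e. F k e)"
proof -
  have *: "rec_nat 0 (\<lambda>k r. r + F k e) a = (\<Sum>k<a. F k e)" for a e by (induction a) auto
  have "computable (case i of 0 \<Rightarrow> (\<lambda>e. e 0) | Suc j \<Rightarrow> (\<lambda>e. e (Suc (Suc j))))" for i
    by (cases i) (auto intro: computable_var)
  then have "computable (\<lambda>e. F (e 0) (\<lambda>i. e (Suc (Suc i))))"
    using computable_subst[OF F,
        where G = "\<lambda>i. case i of 0 \<Rightarrow> (\<lambda>e. e 0) | Suc j \<Rightarrow> (\<lambda>e. e (Suc (Suc j)))"] by simp
  from computable_rec[OF B computable_0, of "\<lambda>k r e. r + F k e", OF computable_plus[OF computable_var this]]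
  show ?thesis by (simp add: *)
qed

lemma computable_mult:
  assumes "computable F" "computable G" shows "computable (\<lambda>e. F e * G e)"
  using computable_sum[OF assms(1), of "\<lambda>k e. G e", OF computable_shift[OF assms(2)]] by simp

lemma computable_pred:
  assumes "computable F" shows "computable (\<lambda>e. F e - 1)"
proof -
  have "rec_nat 0 (\<lambda>k r. k) a = a - 1" for a by (induction a) auto
  then show ?thesis
    using computable_rec[OF assms computable_0, of "\<lambda>k r e. k"] computable_var by simp
qed

lemma computable_minus:
  assumes "computable F" "computable G" shows "computable (\<lambda>e. F e - G e)"
proof -
  have "rec_nat b (\<lambda>k r. r - 1) a = b - a" for a b by (induction a) auto
  then show ?thesis
    using computable_rec[OF assms(2,1), of "\<lambda>k r e. r - 1"] computable_var computable_pred by simp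
qed

lemma computable_power:
  assumes "computable F" "computable G" shows "computable (\<lambda>e. F e ^ G e)"
proof -
  have *: "rec_nat 1 (\<lambda>k r. b * r) a = b ^ a" for a b :: nat by (induction a) auto
  show ?thesis
    using computable_rec[OF assms(2) computable_const[of 1], of "\<lambda>k r e. F e * r",
        OF computable_mult[OF computable_shift[OF computable_shift[OF assms(1)]] computable_var]]
    by (simp only: *)
qed

section \<open>Decidable predicates and bounded search\<close>

definition decidable :: "((nat \<Rightarrow> nat) \<Rightarrow> bool) \<Rightarrow> bool" where
  "decidable P \<longleftrightarrow> computable (\<lambda>e. of_bool (P e))"

lemma computable_of_bool: "decidable P \<Longrightarrow> computable (\<lambda>e. of_bool (P e))"
  unfolding decidable_def .

lemma decidable_pos: "computable F \<Longrightarrow> decidable (\<lambda>e. F e \<noteq> 0)"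
proof -
  assume F: "computable F"
  have "(of_bool (n \<noteq> 0) :: nat) = 1 - (1 - n)" for n :: nat by auto
  then show ?thesis unfolding decidable_def
    using computable_minus[OF computable_const[of 1] computable_minus[OF computable_const[of 1] F]]
    by (simp only:)
qed

lemma decidable_not:
  assumes "decidable P" shows "decidable (\<lambda>e. \<not> P e)"
proof -
  have "(of_bool (\<not> p) :: nat) = 1 - of_bool p" for p by auto
  then show ?thesis
    using computable_minus[OF computable_const[of 1] assms[unfolded decidable_def]]
    unfolding decidable_def by (simp only:)
qed

lemma decidable_conj:
  assumes "decidable P" "decidable Q" shows "decidable (\<lambda>e. P e \<and> Q e)"
  using computable_mult[OF assms[unfolded decidable_def]]
  unfolding decidable_def by (simp add: of_bool_conj)

lemma decidable_disj:
  assumes "decidable P" "decidable Q" shows "decidable (\<lambda>e. P e \<or> Q e)"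
  using decidable_not[OF decidable_conj[OF assms[THEN decidable_not]]] by (simp only: de_Morgan_conj not_not)

lemma decidable_imp:
  assumes "decidable P" "decidable Q" shows "decidable (\<lambda>e. P e \<longrightarrow> Q e)"
  using decidable_disj[OF decidable_not[OF assms(1)] assms(2)] by (simp only: imp_conv_disj)

lemma decidable_iff:
  assumes "decidable P" "decidable Q" shows "decidable (\<lambda>e. P e \<longleftrightarrow> Q e)"
  using decidable_conj[OF decidable_imp[OF assms] decidable_imp[OF assms(2,1)]]
  unfolding iff_conv_conj_imp .

lemma decidable_less:
  assumes "computable F" "computable G" shows "decidable (\<lambda>e. F e < G e)"
proof -
  have "b - a \<noteq> 0 \<longleftrightarrow> a < b" for a b :: nat by auto
  then show ?thesis using decidable_pos[OF computable_minus[OF assms(2,1)]] by (simp only:)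
qed

lemma decidable_eq:
  assumes "computable F" "computable G" shows "decidable (\<lambda>e. F e = G e)"
proof -
  have "\<not> a < b \<and> \<not> b < a \<longleftrightarrow> a = b" for a b :: nat by auto
  then show ?thesis
    using decidable_conj[OF decidable_not[OF decidable_less[OF assms]]
        decidable_not[OF decidable_less[OF assms(2,1)]]] by (simp only:)
qed

text \<open>Bounded search is a sum of truth values, which keeps every program total.\<close>

lemma decidable_ex:
  assumes B: "computable B" and P: "decidable (\<lambda>e. P (e 0) (\<lambda>i. e (Suc i)))"
  shows "decidable (\<lambda>e. \<exists>k<B e. P k e)"
proof -
  have "decidable (\<lambda>e. (\<Sum>k<B e. of_bool (P k e)) \<noteq> (0::nat))"
    by (intro decidable_pos computable_sum B computable_of_bool P)
  moreover have "((\<Sum>k<B e. of_bool (P k e)) \<noteq> (0::nat)) = (\<exists>k<B e. P k e)" for e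
    by auto
  ultimately show ?thesis by (simp only:)
qed

lemma decidable_all:
  assumes B: "computable B" and P: "decidable (\<lambda>e. P (e 0) (\<lambda>i. e (Suc i)))"
  shows "decidable (\<lambda>e. \<forall>k<B e. P k e)"
  using decidable_not[OF decidable_ex[OF B, of "\<lambda>k e. \<not> P k e", OF decidable_not[OF P]]]
  by (simp only: not_ex not_not de_Morgan_conj imp_conv_disj)

text \<open>An arbitrary relation on finitely many letters is computable as a lookup table; this is
  how the rules of the words enter the program.\<close>

lemma decidable_finite_table:
  assumes T: "finite T" and F: "computable F" "computable G" "computable H"
  shows "decidable (\<lambda>e. (F e, G e, H e) \<in> T)"
  using T
proof induction
  case empty
  show ?case unfolding decidable_def by (simp add: computable_0)
next
  case (insert t T)
  obtain x y z where t: "t = (x, y, z)" by (cases t)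
  have "decidable (\<lambda>e. (F e = x \<and> G e = y \<and> H e = z) \<or> (F e, G e, H e) \<in> T)"
    by (intro decidable_disj decidable_conj decidable_eq F computable_const insert.IH)
  then show ?case by (simp add: t)
qed

section \<open>Division, pairing and codes of lists\<close>

lemma computable_div:
  assumes "computable F" "computable G" shows "computable (\<lambda>e. F e div G e)"
proof -
  \<comment> \<open>The quotient counts the positive multiples of \<open>b\<close> up to
    \<open>a\<close>; the conjunct \<open>b \<noteq> 0\<close> yields the value 0 for division by
    zero.\<close>
  have *: "(\<Sum>k<a. of_bool (b \<noteq> 0 \<and> \<not> a < Suc k * b)) = a div b" for a b :: nat
  proof (cases "b = 0")
    case False
    have "k < a \<and> \<not> a < Suc k * b \<longleftrightarrow> k < a div b" for k
    proof
      assume "k < a \<and> \<not> a < Suc k * b"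
      then show "k < a div b" using False
        by (metis Suc_le_eq less_eq_div_iff_mult_less_eq neq0_conv not_less)
    next
      assume k: "k < a div b"
      then have "Suc k * b \<le> a" using False
        by (metis Suc_le_eq less_eq_div_iff_mult_less_eq neq0_conv)
      moreover have "k < a" using k div_le_dividend[of a b] by linarith
      ultimately show "k < a \<and> \<not> a < Suc k * b" by simp
    qed
    then have "{k \<in> {..<a}. \<not> a < Suc k * b} = {..<a div b}" by auto
    then show ?thesis using False by (simp add: sum_of_bool_eq Int_def)
  qed simp
  have "computable (\<lambda>e. \<Sum>k<F e. of_bool (G e \<noteq> 0 \<and> \<not> F e < Suc k * G e))"
    by (intro computable_sum computable_of_bool decidable_conj decidable_not decidable_less
        decidable_pos computable_mult computable_Suc computable_var assms
        assms[THEN computable_shift])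
  then show ?thesis by (simp only: *)
qed

lemma computable_mod:
  assumes "computable F" "computable G" shows "computable (\<lambda>e. F e mod G e)"
  using computable_minus[OF assms(1) computable_mult[OF computable_div[OF assms] assms(2)]]
  by (simp add: minus_div_mult_eq_mod)

lemma computable_prod_decode:
  assumes "computable F"
  shows "computable (\<lambda>e. fst (prod_decode (F e)))" "computable (\<lambda>e. snd (prod_decode (F e)))"
proof -
  \<comment> \<open>Doubling the pairing equation removes the division inside
    \<open>triangle\<close>; the inverse is then found by summing over all pairs up to
    \<open>n\<close>.\<close>
  have eq: "prod_encode (a, b) = n \<longleftrightarrow> (a + b) * Suc (a + b) + 2 * a = 2 * n" for a b n
  proof -
    have "2 * triangle (a + b) = (a + b) * Suc (a + b)" by (simp add: triangle_def)
    then show ?thesis unfolding prod_encode_def by auto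
  qed
  have bound: "fst (prod_decode n) < Suc n" "snd (prod_decode n) < Suc n" for n
    using le_prod_encode_1[of "fst (prod_decode n)" "snd (prod_decode n)"]
      le_prod_encode_2[of "snd (prod_decode n)" "fst (prod_decode n)"] by auto
  have *: "(\<Sum>a<Suc n. \<Sum>b<Suc n.
        of_bool ((a + b) * Suc (a + b) + 2 * a = 2 * n) * h a b)
      = h (fst (prod_decode n)) (snd (prod_decode n))" for h :: "nat \<Rightarrow> nat \<Rightarrow> nat" and n
  proof -
    let ?x = "fst (prod_decode n)" and ?y = "snd (prod_decode n)"
    have delta: "of_bool ((a + b) * Suc (a + b) + 2 * a = 2 * n) * h a b
        = (if b = ?y then (if a = ?x then h a b else 0) else 0)" for a b
    proof (cases "prod_encode (a, b) = n")
      case True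
      then have "prod_decode n = (a, b)" by auto
      then show ?thesis using True eq[of a b n] by simp
    next
      case False
      then have "prod_decode n \<noteq> (a, b)" by (metis prod_decode_inverse)
      then show ?thesis using False eq[of a b n] by (auto simp: prod_eq_iff)
    qed
    have "(\<Sum>b<Suc n. if b = ?y then (if a = ?x then h a b else 0) else 0)
        = (if a = ?x then h a ?y else 0)" for a
      using bound(2)[of n] by (simp del: sum.lessThan_Suc)
    then show ?thesis unfolding delta using bound(1)[of n] by (simp del: sum.lessThan_Suc)
  qed
  note rules = computable_sum computable_of_bool decidable_eq computable_mult computable_plus
    computable_Suc computable_var computable_const assms
    assms[THEN computable_shift, THEN computable_shift] assms[THEN computable_shift]
  have "computable (\<lambda>e. \<Sum>a<Suc (F e). \<Sum>b<Suc (F e).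
        of_bool ((a + b) * Suc (a + b) + 2 * a = 2 * F e) * a)"
    by (intro rules)
  then show "computable (\<lambda>e. fst (prod_decode (F e)))"
    using *[where h = "\<lambda>a b. a"] by (simp only:)
  have "computable (\<lambda>e. \<Sum>a<Suc (F e). \<Sum>b<Suc (F e).
        of_bool ((a + b) * Suc (a + b) + 2 * a = 2 * F e) * b)"
    by (intro rules)
  then show "computable (\<lambda>e. snd (prod_decode (F e)))"
    by (simp only: *[where h = "\<lambda>a b. b"])
qed

text \<open>\<open>list_encode\<close> sends a cons to the successor of the pair code of head and
  tail, so subtracting one and taking the second component gives the tail. The empty list, coded by
  0, is a fixed point; hence a nonzero result is the test that position \<open>t\<close>
  exists.\<close>

definition code_drop :: "nat \<Rightarrow> nat \<Rightarrow> nat" where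
  "code_drop t c = rec_nat c (\<lambda>k r. snd (prod_decode (r - 1))) t"

definition code_nth :: "nat \<Rightarrow> nat \<Rightarrow> nat" where
  "code_nth c t = fst (prod_decode (code_drop t c - 1))"

lemma code_drop_list_encode: "code_drop t (list_encode xs) = list_encode (drop t xs)"
proof (induction t)
  case (Suc t)
  have "prod_encode (0, 0) = 0" by (simp add: prod_encode_def)
  then have zero: "prod_decode 0 = (0, 0)" by (metis prod_encode_inverse)
  have "snd (prod_decode (list_encode ys - 1)) = list_encode (tl ys)" for ys
    by (cases ys) (simp_all add: zero)
  then show ?case using Suc by (simp add: code_drop_def drop_Suc tl_drop)
qed (simp add: code_drop_def)

lemma code_drop_pos: "code_drop t (list_encode xs) \<noteq> 0 \<longleftrightarrow> t < length xs"
  unfolding code_drop_list_encode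
  by (cases "t < length xs") (auto simp: Cons_nth_drop_Suc[symmetric])

lemma code_nth_list_encode: "t < length xs \<Longrightarrow> code_nth (list_encode xs) t = xs ! t"
  unfolding code_nth_def code_drop_list_encode by (simp add: Cons_nth_drop_Suc[symmetric])

lemma computable_code_drop:
  "computable F \<Longrightarrow> computable G \<Longrightarrow> computable (\<lambda>e. code_drop (F e) (G e))"
  unfolding code_drop_def
  by (intro computable_rec computable_prod_decode computable_minus computable_var computable_const)

lemma computable_code_nth:
  "computable F \<Longrightarrow> computable G \<Longrightarrow> computable (\<lambda>e. code_nth (F e) (G e))"
  unfolding code_nth_def
  by (intro computable_code_drop computable_prod_decode computable_minus computable_const)

text \<open>Words and candidate embeddings are searched as numbers in base \<open>g\<close>, which
  turns the quantifiers over them into bounded ones.\<close>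

definition digit :: "nat \<Rightarrow> nat \<Rightarrow> nat \<Rightarrow> nat" where
  "digit g w i = w div g ^ i mod g"

lemma computable_digit:
  "computable F \<Longrightarrow> computable G \<Longrightarrow> computable H \<Longrightarrow> computable (\<lambda>e. digit (F e) (G e) (H e))"
  unfolding digit_def by (intro computable_mod computable_div computable_power)

lemma digit_less: "0 < g \<Longrightarrow> digit g w i < g"
  by (simp add: digit_def)

lemma ex_digits:
  assumes "\<And>i. i < n \<Longrightarrow> h i < g"
  shows "\<exists>w<g ^ n. \<forall>i<n. digit g w i = h i"
  using assms
proof (induction n arbitrary: h)
  case (Suc n)
  obtain w where w: "w < g ^ n" "\<forall>i<n. digit g w i = h (Suc i)"
    using Suc.IH[of "\<lambda>i. h (Suc i)"] Suc.prems by auto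
  have h0: "h 0 < g" using Suc.prems by simp
  let ?w = "h 0 + g * w"
  have "?w < g * Suc w" using h0 by simp
  also have "\<dots> \<le> g * g ^ n" using w(1) by (intro mult_le_mono2) simp
  finally have "?w < g ^ Suc n" by simp
  moreover have "digit g ?w i = h i" if "i < Suc n" for i
  proof (cases i)
    case 0
    then show ?thesis using h0 by (simp add: digit_def)
  next
    case (Suc k)
    have "?w div g ^ i = w div g ^ k"
      unfolding Suc power_Suc div_mult2_eq using h0 by simp
    then show ?thesis using w(2) Suc that by (simp add: digit_def)
  qed
  ultimately show ?case by blast
qed simp

section \<open>Words, embeddings and pumping\<close>

text \<open>
  \<open>R x y adj a\<close> says that a later point with letter \<open>y\<close> is above (\<open>a = True\<close>) or right of
  (\<open>a = False\<close>) an earlier one with letter \<open>x\<close>; \<open>adj\<close> tells whether the two are consecutive.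
\<close>

type_synonym 'l rule = "'l \<Rightarrow> 'l \<Rightarrow> bool \<Rightarrow> bool \<Rightarrow> bool"

definition agrees :: "'l rule \<Rightarrow> nat list \<Rightarrow> nat \<Rightarrow> nat \<Rightarrow> 'l \<Rightarrow> 'l \<Rightarrow> bool \<Rightarrow> bool" where
  "agrees R b i j x y adj \<longleftrightarrow> (R x y adj False \<longleftrightarrow> i < j) \<and> (R x y adj True \<longleftrightarrow> b ! i < b ! j)"

text \<open>A word lists points in order of placement, not by position, so the entries of
  \<open>b\<close> may occur in it in any order; each pair is compared in the direction in which it
  occurs in the word.\<close>

definition embedding :: "'l rule \<Rightarrow> nat list \<Rightarrow> 'l list \<Rightarrow> nat set \<Rightarrow> (nat \<Rightarrow> nat) \<Rightarrow> bool" where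
  "embedding R b w D f \<longleftrightarrow> (\<forall>i\<in>D. f i < length w) \<and> inj_on f D \<and>
     (\<forall>i\<in>D. \<forall>j\<in>D. f i < f j \<longrightarrow> agrees R b i j (w ! f i) (w ! f j) (f j = Suc (f i)))"

definition embeds :: "'l rule \<Rightarrow> nat list \<Rightarrow> 'l list \<Rightarrow> bool" where
  "embeds R b w \<longleftrightarrow> (\<exists>f. embedding R b w {..<length b} f)"

definition valid_word :: "('l \<Rightarrow> bool) \<Rightarrow> ('l \<Rightarrow> 'l \<Rightarrow> bool) \<Rightarrow> 'l list \<Rightarrow> bool" where
  "valid_word Init Next w \<longleftrightarrow> (w \<noteq> [] \<longrightarrow> Init (hd w)) \<and> successively Next w"

text \<open>
  A state holds an element \<open>b\<close> of the basis, the letters to which some of its entries have been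
  sent, and the set of entries (at most one) sent to the last letter read.
\<close>

type_synonym 'l state = "nat list \<times> (nat \<Rightarrow> 'l option) \<times> nat set"

definition step :: "'l rule \<Rightarrow> 'l state set \<Rightarrow> 'l \<Rightarrow> 'l state set" where
  "step R A c = {(b, h, {}) | b h l. (b, h, l) \<in> A} \<union>
     {(b, h(i := Some c), {i}) | b h l i. (b, h, l) \<in> A \<and> i < length b \<and> h i = None \<and>
        (\<forall>j x. h j = Some x \<longrightarrow> agrees R b j i x c (j \<in> l))}"

definition states :: "'l rule \<Rightarrow> nat list list \<Rightarrow> 'l list \<Rightarrow> 'l state set" where
  "states R bs w = foldl (step R) ((\<lambda>b. (b, Map.empty, {})) ` set bs) w"

section \<open>The automaton of partial embeddings\<close>

lemma embedding_snoc_old: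
  "embedding R b w D f \<Longrightarrow> embedding R b (w @ [c]) D f"
  unfolding embedding_def by (auto simp: nth_append)

lemma embedding_snoc_avoid:
  "embedding R b (w @ [c]) D f \<Longrightarrow> \<forall>i\<in>D. f i \<noteq> length w \<Longrightarrow> embedding R b w D f"
  unfolding embedding_def by (auto simp: nth_append less_Suc_eq)

lemma embedding_snoc_new:
  assumes "embedding R b w D f" "i \<notin> D"
    and "\<forall>j\<in>D. agrees R b j i (w ! f j) c (Suc (f j) = length w)"
  shows "embedding R b (w @ [c]) (insert i D) (f(i := length w))"
  using assms unfolding embedding_def inj_on_def by (auto simp: nth_append eq_commute[of "length w"])

lemma embedding_subset:
  "embedding R b w D f \<Longrightarrow> D' \<subseteq> D \<Longrightarrow> embedding R b w D' f"
  unfolding embedding_def by (meson inj_on_subset subset_iff)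

text \<open>A state forgets the map \<open>f\<close>. This is harmless: for the relations with the
  next point, \<open>agrees\<close> asks only for the letters already assigned and for which entry,
  if any, sits immediately before.\<close>

lemma states_iff:
  "(b, h, l) \<in> states R bs w \<longleftrightarrow> b \<in> set bs \<and> dom h \<subseteq> {..<length b} \<and>
     (\<exists>f. embedding R b w (dom h) f \<and> (\<forall>i\<in>dom h. h i = Some (w ! f i)) \<and>
        l = {i \<in> dom h. Suc (f i) = length w})"
proof (induction w arbitrary: b h l rule: rev_induct)
  case Nil
  have "h = Map.empty" if "dom h \<subseteq> {..<length b}" "embedding R b [] (dom h) f" for f
    using that unfolding embedding_def by auto
  then show ?case by (auto simp: states_def embedding_def)
next
  case (snoc c w)
  have st: "states R bs (w @ [c]) = step R (states R bs w) c" by (simp add: states_def)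
  show ?case
  proof
    assume "(b, h, l) \<in> states R bs (w @ [c])"
    then consider l' where "l = {}" "(b, h, l') \<in> states R bs w"
      | h' l' i where "h = h'(i := Some c)" "l = {i}" "(b, h', l') \<in> states R bs w"
          "i < length b" "h' i = None" "\<forall>j x. h' j = Some x \<longrightarrow> agrees R b j i x c (j \<in> l')"
      unfolding st step_def by blast
    then show "b \<in> set bs \<and> dom h \<subseteq> {..<length b} \<and>
     (\<exists>f. embedding R b (w @ [c]) (dom h) f \<and> (\<forall>i\<in>dom h. h i = Some ((w @ [c]) ! f i)) \<and>
        l = {i \<in> dom h. Suc (f i) = length (w @ [c])})"
    proof cases
      case 1
      from 1(2) obtain f where f: "b \<in> set bs" "dom h \<subseteq> {..<length b}" "embedding R b w (dom h) f"
          "\<forall>i\<in>dom h. h i = Some (w ! f i)"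
        unfolding snoc.IH by blast
      have lt: "f i < length w" if "i \<in> dom h" for i
        using f(3) that unfolding embedding_def by blast
      have "{i \<in> dom h. Suc (f i) = length (w @ [c])} = {}"
        using lt[THEN less_imp_neq] by (simp only: length_append_singleton nat.inject) blast
      moreover have "h i = Some ((w @ [c]) ! f i)" if "i \<in> dom h" for i
        using lt[OF that] f(4) that by (simp add: nth_append)
      ultimately show ?thesis using f(1,2) embedding_snoc_old[OF f(3)] 1(1) by blast
    next
      case 2
      from 2(3) obtain f where f: "b \<in> set bs" "dom h' \<subseteq> {..<length b}" "embedding R b w (dom h') f"
          "\<forall>i\<in>dom h'. h' i = Some (w ! f i)" "l' = {i \<in> dom h'. Suc (f i) = length w}"
        unfolding snoc.IH by blast
      have lt: "f j < length w" if "j \<in> dom h'" for j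
        using f(3) that unfolding embedding_def by blast
      have new: "agrees R b j i (w ! f j) c (Suc (f j) = length w)" if "j \<in> dom h'" for j
      proof -
        have "h' j = Some (w ! f j)" "j \<in> l' \<longleftrightarrow> Suc (f j) = length w" using f(4,5) that by blast+
        then show ?thesis using 2(6)[rule_format, of j "w ! f j"] by simp
      qed
      have i: "i \<notin> dom h'" using 2(5) by (simp add: domIff)
      have dom: "dom h = insert i (dom h')" unfolding 2(1) by simp
      have "embedding R b (w @ [c]) (dom h) (f(i := length w))"
        unfolding dom using new by (intro embedding_snoc_new f(3) i) blast
      moreover have "h j = Some ((w @ [c]) ! (f(i := length w)) j)" if "j \<in> dom h" for j
      proof (cases "j = i")
        case False
        then have "j \<in> dom h'" using that dom by blast
        then show ?thesis using f(4) lt[of j] False 2(1) by (simp add: nth_append)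
      qed (simp add: 2(1))
      moreover have "l = {j \<in> dom h. Suc ((f(i := length w)) j) = length (w @ [c])}"
        using lt[THEN less_imp_neq] i unfolding dom 2(2) by (simp only: length_append_singleton nat.inject fun_upd_apply) force
      ultimately show ?thesis using f(1,2) 2(4) unfolding dom by blast
    qed
  next
    assume "b \<in> set bs \<and> dom h \<subseteq> {..<length b} \<and>
     (\<exists>f. embedding R b (w @ [c]) (dom h) f \<and> (\<forall>i\<in>dom h. h i = Some ((w @ [c]) ! f i)) \<and>
        l = {i \<in> dom h. Suc (f i) = length (w @ [c])})"
    then obtain f where f: "b \<in> set bs" "dom h \<subseteq> {..<length b}" "embedding R b (w @ [c]) (dom h) f"
        "\<forall>i\<in>dom h. h i = Some ((w @ [c]) ! f i)" "l = {i \<in> dom h. f i = length w}"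
      by auto
    have lt: "f i < Suc (length w)" if "i \<in> dom h" for i
      using f(3) that unfolding embedding_def by simp
    have old: "h i = Some (w ! f i)" if "i \<in> dom h" "f i \<noteq> length w" for i
      using f(4) that lt[of i] by (auto simp: nth_append less_Suc_eq)
    show "(b, h, l) \<in> states R bs (w @ [c])"
    proof (cases "l = {}")
      case True
      then have ne: "\<forall>i\<in>dom h. f i \<noteq> length w" using f(5) by auto
      have "embedding R b w (dom h) f" using embedding_snoc_avoid[OF f(3) ne] .
      moreover have "\<forall>i\<in>dom h. h i = Some (w ! f i)" using old ne by blast
      ultimately have "(b, h, {i \<in> dom h. Suc (f i) = length w}) \<in> states R bs w"
        unfolding snoc.IH using f(1,2) by blast
      then show ?thesis unfolding st step_def using True by blast
    next
      case False
      then obtain i where i: "i \<in> dom h" "f i = length w" using f(5) by auto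
      have inj: "inj_on f (dom h)" using f(3) by (simp add: embedding_def)
      have uniq: "j = i" if "j \<in> dom h" "f j = length w" for j
        using inj_onD[OF inj, of j i] i that by simp
      have l: "l = {i}" unfolding f(5) using i uniq by blast
      \<comment> \<open>By injectivity \<open>i\<close> is the only entry on the new letter, so
        withdrawing it gives the state reached before that letter was read.\<close>
      let ?h = "h(i := None)"
      have dom: "dom ?h = dom h - {i}" by simp
      have ne: "\<forall>j\<in>dom ?h. f j \<noteq> length w"
        unfolding dom using uniq by blast
      have emb: "embedding R b w (dom ?h) f"
        by (rule embedding_snoc_avoid[OF embedding_subset[OF f(3)] ne]) auto
      moreover have h: "?h j = Some (w ! f j)" if "j \<in> dom ?h" for j
        using old[of j] ne that by (simp add: dom)
      ultimately have "(b, ?h, {j \<in> dom ?h. Suc (f j) = length w}) \<in> states R bs w"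
        unfolding snoc.IH using f(1,2) dom by blast
      moreover have "\<forall>j x. ?h j = Some x \<longrightarrow>
          agrees R b j i x c (j \<in> {j \<in> dom ?h. Suc (f j) = length w})"
      proof (intro allI impI)
        fix j x assume j: "?h j = Some x"
        then have jd: "j \<in> dom ?h" by blast
        have fj: "f j < length w" using emb jd unfolding embedding_def by blast
        have x: "x = w ! f j" using h[OF jd] j by simp
        have "agrees R b j i ((w @ [c]) ! f j) ((w @ [c]) ! f i) (f i = Suc (f j))"
          using f(3) i jd fj unfolding embedding_def dom by (metis DiffD1)
        then show "agrees R b j i x c (j \<in> {j \<in> dom ?h. Suc (f j) = length w})"
          using fj x jd i(2) by (simp add: nth_append eq_commute[of "length w"])
      qed
      moreover have "h i = Some c" using i f(4) by simp
      then have "h = ?h(i := Some c)" by (simp add: fun_eq_iff)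
      moreover have "i < length b" "?h i = None" using f(2) i by auto
      ultimately show ?thesis unfolding st step_def l by blast
    qed
  qed
qed

lemma embeds_iff_states:
  "(\<exists>b\<in>set bs. embeds R b w) \<longleftrightarrow> (\<exists>b h l. (b, h, l) \<in> states R bs w \<and> dom h = {..<length b})"
proof
  assume "\<exists>b\<in>set bs. embeds R b w"
  then obtain b f where f: "b \<in> set bs" "embedding R b w {..<length b} f"
    unfolding embeds_def by blast
  let ?h = "\<lambda>i. if i < length b then Some (w ! f i) else None"
  have dom: "dom ?h = {..<length b}" by (auto split: if_splits)
  have "(b, ?h, {i \<in> dom ?h. Suc (f i) = length w}) \<in> states R bs w"
    unfolding states_iff using f by (intro conjI exI[of _ f]) (auto simp: dom)
  then show "\<exists>b h l. (b, h, l) \<in> states R bs w \<and> dom h = {..<length b}" using dom by blast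
next
  assume "\<exists>b h l. (b, h, l) \<in> states R bs w \<and> dom h = {..<length b}"
  then show "\<exists>b\<in>set bs. embeds R b w" unfolding states_iff embeds_def by metis
qed

section \<open>Counting states and pumping\<close>

lemma length_le_list_encode: "length xs \<le> list_encode xs"
proof (induction xs)
  case (Cons x xs)
  then show ?case using le_prod_encode_2[of "list_encode xs" x] by simp
qed simp

lemma member_le_list_encode: "x \<in> set xs \<Longrightarrow> x \<le> list_encode xs"
proof (induction xs)
  case (Cons y xs)
  then show ?case
    using le_prod_encode_1[of y "list_encode xs"] le_prod_encode_2[of "list_encode xs" y] by auto
qed simp

text \<open>The code itself bounds the number of basis elements and their lengths, so it can serve
  as the range of every quantifier over them and as the parameter of the pumping length.\<close>

lemma length_le_code_perms:
  "length bs \<le> code_perms bs" "b \<in> set bs \<Longrightarrow> length b \<le> code_perms bs"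
proof -
  show "length bs \<le> code_perms bs"
    using length_le_list_encode[of "map list_encode bs"] by (simp add: code_perms_def)
  show "b \<in> set bs \<Longrightarrow> length b \<le> code_perms bs"
    using length_le_list_encode[of b] member_le_list_encode[of "list_encode b" "map list_encode bs"]
    by (simp add: code_perms_def)
qed

lemma card_partial_maps:
  "finite {h :: nat \<Rightarrow> 'l::finite option. dom h \<subseteq> {..<c}}"
  "card {h :: nat \<Rightarrow> 'l::finite option. dom h \<subseteq> {..<c}} \<le> Suc (CARD('l)) ^ c"
proof -
  let ?H = "{h :: nat \<Rightarrow> 'l option. dom h \<subseteq> {..<c}}"
  let ?P = "{..<c} \<rightarrow>\<^sub>E (UNIV :: 'l option set)"
  have inj: "inj_on (\<lambda>h. restrict h {..<c}) ?H"
  proof (rule inj_onI)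
    fix h h' :: "nat \<Rightarrow> 'l option"
    assume *: "h \<in> ?H" "h' \<in> ?H" "restrict h {..<c} = restrict h' {..<c}"
    show "h = h'"
    proof
      fix i show "h i = h' i"
      proof (cases "i < c")
        case True
        then show ?thesis using *(3) by (metis lessThan_iff restrict_apply')
      next
        case False
        then have "i \<notin> dom h" "i \<notin> dom h'" using * by auto
        then show ?thesis by (simp add: domIff)
      qed
    qed
  qed
  have sub: "(\<lambda>h. restrict h {..<c}) ` ?H \<subseteq> ?P" by auto
  have fin: "finite ?P" by (intro finite_PiE) auto
  have card: "card ?P = Suc (CARD('l)) ^ c" by (simp add: card_PiE)
  show "finite ?H" using inj sub fin by (meson finite_subset inj_on_finite)
  show "card ?H \<le> Suc (CARD('l)) ^ c" using card_inj_on_le[OF inj sub fin] card by simp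
qed

text \<open>The factors count the choices of \<open>b\<close>, the partial assignments of letters to
  at most \<open>c\<close> entries, and the sets of entries on the last letter.\<close>

definition state_bound :: "nat \<Rightarrow> nat \<Rightarrow> nat" where
  "state_bound g c = c * (Suc g ^ c * 2 ^ c)"

text \<open>One more than the number of pairs of a set of states and a last letter, as the
  pigeonhole principle requires for the subset construction.\<close>

definition pumping_length :: "nat \<Rightarrow> nat \<Rightarrow> nat" where
  "pumping_length g c = Suc (2 ^ state_bound g c * g)"

lemma decidable_const: "decidable (\<lambda>e. b)"
  unfolding decidable_def by (rule computable_const)

lemma computable_pumping_length:
  "computable F \<Longrightarrow> computable (\<lambda>e. pumping_length g (F e))"
  unfolding pumping_length_def state_bound_def
  by (intro computable_Suc computable_mult computable_power computable_const)

lemma states_universe: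
  fixes R :: "'l::finite rule"
  obtains U :: "'l state set" where "finite U" "card U \<le> state_bound CARD('l) (code_perms bs)"
    "\<And>w. states R bs w \<subseteq> U"
proof
  let ?c = "code_perms bs"
  let ?U = "set bs \<times> {h :: nat \<Rightarrow> 'l option. dom h \<subseteq> {..<?c}} \<times> Pow {..<?c}"
  show "finite ?U" using card_partial_maps(1) by auto
  have "card (set bs) \<le> ?c" using card_length[of bs] length_le_code_perms(1)[of bs] by simp
  then show "card ?U \<le> state_bound CARD('l) ?c"
    unfolding card_cartesian_product state_bound_def
    by (intro mult_le_mono card_partial_maps(2)) (auto simp: card_Pow)
  show "states R bs w \<subseteq> ?U" for w
  proof
    fix s assume "s \<in> states R bs w"
    moreover obtain b h l where s: "s = (b, h, l)" by (cases s)
    ultimately have *: "b \<in> set bs" "dom h \<subseteq> {..<length b}" "l \<subseteq> dom h"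
      unfolding s states_iff by auto
    have "{..<length b} \<subseteq> {..<?c}" using length_le_code_perms(2)[OF *(1)] by auto
    then show "s \<in> ?U" using * unfolding s by (simp add: subset_trans)
  qed
qed

lemma pump:
  fixes R :: "'l::finite rule"
  assumes w: "valid_word Init Next w" "\<not> (\<exists>b\<in>set bs. embeds R b w)"
    and len: "pumping_length CARD('l) (code_perms bs) \<le> length w"
  obtains w' where "length w < length w'" "valid_word Init Next w'"
    "\<not> (\<exists>b\<in>set bs. embeds R b w')"
proof -
  let ?K = "pumping_length CARD('l) (code_perms bs)"
  obtain U where U: "finite U" "card U \<le> state_bound CARD('l) (code_perms bs)"
      "\<And>w. states R bs w \<subseteq> U" using states_universe[of bs R] by blast
  \<comment> \<open>The last letter is recorded beside the states so that \<open>Next\<close> still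
    holds at the splice, where the remainder after position \<open>i\<close> is attached to the
    longer prefix ending at \<open>j\<close>.\<close>
  let ?F = "\<lambda>i. (states R bs (take (Suc i) w), w ! i)"
  have "?F ` {..<?K} \<subseteq> Pow U \<times> UNIV" using U(3) by blast
  then have "card (?F ` {..<?K}) \<le> card (Pow U \<times> (UNIV :: 'l set))"
    using U(1) by (intro card_mono) simp_all
  also have "\<dots> \<le> 2 ^ state_bound CARD('l) (code_perms bs) * CARD('l)"
    unfolding card_cartesian_product card_Pow[OF U(1)]
    by (intro mult_le_mono1 power_increasing U(2)) simp
  also have "\<dots> < card {..<?K}" by (simp add: pumping_length_def)
  finally have "\<not> inj_on ?F {..<?K}" by (rule pigeonhole)
  then obtain i j where "i \<noteq> j" "i < ?K" "j < ?K" "?F i = ?F j" unfolding inj_on_def by blast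
  then obtain i j where ij: "i < j" "j < ?K" "?F i = ?F j"
    by (cases i j rule: linorder_cases) (metis, simp, metis)
  let ?x = "take (Suc i) w" and ?y = "take (Suc j) w" and ?z = "drop (Suc i) w"
  have j: "j < length w" using ij(2) len by simp
  have st: "states R bs (u @ v) = foldl (step R) (states R bs u) v" for u v :: "'l list"
    by (simp add: states_def)
  have "states R bs (?y @ ?z) = states R bs (?x @ ?z)"
    unfolding st using ij(3) by simp
  then have "\<not> (\<exists>b\<in>set bs. embeds R b (?y @ ?z))"
    using w(2) unfolding embeds_iff_states by simp
  moreover have "valid_word Init Next (?y @ ?z)"
  proof -
    have "last ?x = last ?y" using ij j by (simp add: take_Suc_conv_app_nth)
    moreover have "successively Next (?x @ ?z)" "successively Next (?y @ drop (Suc j) w)"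
      using w(1) by (simp_all add: valid_word_def)
    ultimately have "successively Next (?y @ ?z)"
      unfolding successively_append_iff using j by auto
    moreover have "hd (?y @ ?z) = hd w" "w \<noteq> []" using j by (cases w; simp)+
    ultimately show ?thesis using w(1) by (simp add: valid_word_def)
  qed
  moreover have "length w < length (?y @ ?z)" using ij(1) j by simp
  ultimately show ?thesis using that by blast
qed

lemma pump_unbounded:
  fixes R :: "'l::finite rule"
  assumes w: "valid_word Init Next w" "\<not> (\<exists>b\<in>set bs. embeds R b w)"
    and len: "pumping_length CARD('l) (code_perms bs) \<le> length w"
  shows "\<exists>w'. n \<le> length w' \<and> valid_word Init Next w' \<and> \<not> (\<exists>b\<in>set bs. embeds R b w')"
proof -
  have "\<exists>w'. n + length w \<le> length w' \<and> valid_word Init Next w' \<and> \<not> (\<exists>b\<in>set bs. embeds R b w')"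
  proof (induction n)
    case 0
    then show ?case using w by auto
  next
    case (Suc n)
    then obtain w' where w': "n + length w \<le> length w'" "valid_word Init Next w'"
        "\<not> (\<exists>b\<in>set bs. embeds R b w')" by blast
    then have "pumping_length CARD('l) (code_perms bs) \<le> length w'" using len by simp
    then obtain w'' where "length w' < length w''" "valid_word Init Next w''"
        "\<not> (\<exists>b\<in>set bs. embeds R b w'')" using w' pump by metis
    then show ?case using w'(1) by (intro exI[of _ w'']) auto
  qed
  then show ?thesis by (meson add_leD1)
qed

section \<open>Arithmetisation of the search for an avoiding word\<close>

lemma embeds_digits:
  assumes "length w = K"
  shows "embeds R b w \<longleftrightarrow> (\<exists>f<K ^ length b. \<forall>i<length b. \<forall>j<length b.
     (i \<noteq> j \<longrightarrow> digit K f i \<noteq> digit K f j) \<and>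
     (digit K f i < digit K f j \<longrightarrow>
       agrees R b i j (w ! digit K f i) (w ! digit K f j) (digit K f j = Suc (digit K f i))))"
    (is "_ \<longleftrightarrow> (\<exists>f<K ^ length b. ?P (digit K f))")
proof
  assume "embeds R b w"
  then obtain h where h: "\<forall>i<length b. h i < K" "?P h"
    unfolding embeds_def embedding_def inj_on_def assms by (metis lessThan_iff)
  obtain f where f: "f < K ^ length b" "\<forall>i<length b. digit K f i = h i"
    using ex_digits h(1) by blast
  show "\<exists>f<K ^ length b. ?P (digit K f)" using f h(2) by (intro exI[of _ f]) auto
next
  assume "\<exists>f<K ^ length b. ?P (digit K f)"
  then obtain f where f: "f < K ^ length b" "?P (digit K f)" by blast
  have "digit K f i < K" if "i < length b" for i
    using f(1) that by (intro digit_less) (cases K; auto simp: power_0_left split: if_splits)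
  then show "embeds R b w" unfolding embeds_def embedding_def inj_on_def using f(2) assms
    by (intro exI[of _ "digit K f"]) auto
qed

lemma ex_word_digits:
  fixes dl :: "nat \<Rightarrow> 'l"
  assumes dl: "dl ` {..<g} = UNIV"
  shows "(\<exists>w. length w = K \<and> P w) \<longleftrightarrow> (\<exists>u<g ^ K. P (map (\<lambda>i. dl (digit g u i)) [0..<K]))"
proof
  assume "\<exists>w. length w = K \<and> P w"
  then obtain w where w: "length w = K" "P w" by blast
  have "\<forall>i. \<exists>x<g. dl x = w ! i" using dl by (metis UNIV_I imageE lessThan_iff)
  then obtain h where h: "\<And>i. h i < g" "\<And>i. dl (h i) = w ! i" by metis
  obtain u where u: "u < g ^ K" "\<forall>i<K. digit g u i = h i" using ex_digits h(1) by blast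
  have "map (\<lambda>i. dl (digit g u i)) [0..<K] = w"
    using u h w by (intro nth_equalityI) auto
  then show "\<exists>u<g ^ K. P (map (\<lambda>i. dl (digit g u i)) [0..<K])" using u(1) w(2) by auto
next
  assume "\<exists>u<g ^ K. P (map (\<lambda>i. dl (digit g u i)) [0..<K])"
  then obtain u where "P (map (\<lambda>i. dl (digit g u i)) [0..<K])" by blast
  moreover have "length (map (\<lambda>i. dl (digit g u i)) [0..<K]) = K" by simp
  ultimately show "\<exists>w. length w = K \<and> P w" by blast
qed

lemma valid_word_nth:
  "valid_word Init Next w \<longleftrightarrow> (0 < length w \<longrightarrow> Init (w ! 0)) \<and>
     (\<forall>i<length w. Suc i < length w \<longrightarrow> Next (w ! i) (w ! Suc i))"
  unfolding valid_word_def successively_conv_nth by (auto simp: hd_conv_nth)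

text \<open>The guards make the set of accepted triples finite, hence a table, whatever
  \<open>Q\<close> is.\<close>

definition letter_test :: "nat \<Rightarrow> (nat \<Rightarrow> nat \<Rightarrow> bool \<Rightarrow> bool) \<Rightarrow> nat \<Rightarrow> nat \<Rightarrow> bool \<Rightarrow> bool" where
  "letter_test g Q x y p \<longleftrightarrow> x < g \<and> y < g \<and> Q x y p"

lemma decidable_letter_test:
  assumes "computable X" "computable Y" "decidable P"
  shows "decidable (\<lambda>e. letter_test g Q (X e) (Y e) (P e))"
proof -
  let ?T = "{t \<in> {..<g} \<times> {..<g} \<times> {..<2::nat}. Q (fst t) (fst (snd t)) (snd (snd t) = 1)}"
  have "finite ?T" by simp
  then have "decidable (\<lambda>e. (X e, Y e, of_bool (P e)) \<in> ?T)"
    by (intro decidable_finite_table assms computable_of_bool)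
  moreover have "(x, y, of_bool p) \<in> ?T \<longleftrightarrow> letter_test g Q x y p" for x y p
    by (cases p) (auto simp: letter_test_def)
  ultimately show ?thesis by (simp only:)
qed

text \<open>The digit form of \<open>embeds\<close>, written only with connectives for which
  decidability is available: \<open>code_drop i b \<noteq> 0\<close> expresses
  \<open>i < length b\<close>, and \<open>c\<close> bounds the indices.\<close>

definition embedding_code ::
  "'l rule \<Rightarrow> (nat \<Rightarrow> 'l) \<Rightarrow> nat \<Rightarrow> nat \<Rightarrow> nat \<Rightarrow> nat \<Rightarrow> nat \<Rightarrow> nat \<Rightarrow> bool" where
  "embedding_code R dl g K c u b f \<longleftrightarrow> (\<forall>i<c. code_drop i b \<noteq> 0 \<longrightarrow>
        (\<forall>j<c. code_drop j b \<noteq> 0 \<longrightarrow>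
          (\<not> i = j \<longrightarrow> \<not> digit K f i = digit K f j) \<and>
          (digit K f i < digit K f j \<longrightarrow>
             (letter_test g (\<lambda>x y p. R (dl x) (dl y) p False)
               (digit g u (digit K f i)) (digit g u (digit K f j))
               (digit K f j = Suc (digit K f i)) \<longleftrightarrow> i < j) \<and>
             (letter_test g (\<lambda>x y p. R (dl x) (dl y) p True)
               (digit g u (digit K f i)) (digit g u (digit K f j))
               (digit K f j = Suc (digit K f i)) \<longleftrightarrow>
              code_nth b i < code_nth b j))))"

definition word_avoids_code ::
  "('l \<Rightarrow> bool) \<Rightarrow> ('l \<Rightarrow> 'l \<Rightarrow> bool) \<Rightarrow> 'l rule \<Rightarrow> (nat \<Rightarrow> 'l) \<Rightarrow> nat \<Rightarrow> nat \<Rightarrow> nat \<Rightarrow> nat \<Rightarrow> bool" where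
  "word_avoids_code Init Next R dl g K c u \<longleftrightarrow>
    letter_test g (\<lambda>x y p. Init (dl x)) (digit g u 0) 0 True \<and>
    (\<forall>i<K. Suc i < K \<longrightarrow>
       letter_test g (\<lambda>x y p. Next (dl x) (dl y)) (digit g u i) (digit g u (Suc i)) True) \<and>
    (\<forall>t<c. code_drop t c \<noteq> 0 \<longrightarrow> \<not> (\<exists>f<K ^ c. embedding_code R dl g K c u (code_nth c t) f))"

text \<open>\<open>P\<close> looks only at the first \<open>n\<close> digits, so the exponent can be
  raised to a bound \<open>c\<close> common to all basis elements.\<close>

lemma ex_power_bound_digits:
  assumes "n \<le> c" "0 < K"
    and P: "\<And>h h'. (\<And>i. i < n \<Longrightarrow> h i = h' i) \<Longrightarrow> P h \<longleftrightarrow> P h'"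
  shows "(\<exists>f<K ^ c. P (digit K f)) \<longleftrightarrow> (\<exists>f<K ^ n. P (digit K f))"
proof
  assume "\<exists>f<K ^ c. P (digit K f)"
  then obtain f where f: "P (digit K f)" by blast
  obtain f' where "f' < K ^ n" "\<forall>i<n. digit K f' i = digit K f i"
    using ex_digits[of n "digit K f" K] digit_less[OF assms(2)] by blast
  then show "\<exists>f<K ^ n. P (digit K f)" using f P by blast
next
  assume "\<exists>f<K ^ n. P (digit K f)"
  moreover have "K ^ n \<le> K ^ c" using assms by (intro power_increasing) auto
  ultimately show "\<exists>f<K ^ c. P (digit K f)" by (meson less_le_trans)
qed

lemma word_avoids_code_iff:
  assumes g: "0 < g" and K: "0 < K"
  shows "word_avoids_code Init Next R dl g K (code_perms bs) u \<longleftrightarrow>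
    valid_word Init Next (map (\<lambda>i. dl (digit g u i)) [0..<K]) \<and>
    \<not> (\<exists>b\<in>set bs. embeds R b (map (\<lambda>i. dl (digit g u i)) [0..<K]))"
proof -
  let ?w = "map (\<lambda>i. dl (digit g u i)) [0..<K]"
  let ?c = "code_perms bs"
  have drop: "code_drop t ?c \<noteq> 0 \<longleftrightarrow> t < length bs" for t
    unfolding code_perms_def code_drop_pos by simp
  have nth: "code_nth ?c t = list_encode (bs ! t)" if "t < length bs" for t
    unfolding code_perms_def using that by (simp add: code_nth_list_encode)
  have dK: "digit K f i < K" "digit g f i < g" for f i using digit_less K g by auto
  let ?Q = "\<lambda>b h. \<forall>i<length b. \<forall>j<length b.
     (i \<noteq> j \<longrightarrow> h i \<noteq> h j) \<and>
     (h i < h j \<longrightarrow> agrees R b i j (dl (digit g u (h i))) (dl (digit g u (h j))) (h j = Suc (h i)))"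
  have emb: "embeds R b ?w \<longleftrightarrow> (\<exists>f<K ^ ?c. ?Q b (digit K f))" if "b \<in> set bs" for b
  proof -
    have "embeds R b ?w \<longleftrightarrow> (\<exists>f<K ^ length b. ?Q b (digit K f))"
      using embeds_digits[of ?w K R b] dK by simp
    also have "\<dots> \<longleftrightarrow> (\<exists>f<K ^ ?c. ?Q b (digit K f))"
      by (rule ex_power_bound_digits[symmetric, OF length_le_code_perms(2)[OF that] K]) auto
    finally show ?thesis .
  qed
  have nths: "(\<forall>t<length bs. \<not> P (bs ! t)) \<longleftrightarrow> \<not> (\<exists>b\<in>set bs. P b)" for P
    using all_set_conv_all_nth[of bs "\<lambda>b. \<not> P b"] by simp
  have inner: "embedding_code R dl g K ?c u (code_nth ?c t) f
      \<longleftrightarrow> ?Q (bs ! t) (digit K f)" (is "?L \<longleftrightarrow> _") if t: "t < length bs" for t f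
  proof -
    have len: "length (bs ! t) \<le> ?c" using t by (simp add: length_le_code_perms)
    have "?L \<longleftrightarrow> (\<forall>i<?c. i < length (bs ! t) \<longrightarrow> (\<forall>j<?c. j < length (bs ! t) \<longrightarrow>
          (i \<noteq> j \<longrightarrow> digit K f i \<noteq> digit K f j) \<and>
          (digit K f i < digit K f j \<longrightarrow> agrees R (bs ! t) i j (dl (digit g u (digit K f i)))
             (dl (digit g u (digit K f j))) (digit K f j = Suc (digit K f i)))))"
      unfolding embedding_code_def nth[OF t] code_drop_pos agrees_def letter_test_def using dK by (auto simp: code_nth_list_encode)
    also have "\<dots> \<longleftrightarrow> ?Q (bs ! t) (digit K f)" using len by (meson less_le_trans)
    finally show ?thesis .
  qed
  have "word_avoids_code Init Next R dl g K ?c u \<longleftrightarrow> valid_word Init Next ?w \<and>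
      (\<forall>t<?c. t < length bs \<longrightarrow> \<not> (\<exists>f<K ^ ?c. ?Q (bs ! t) (digit K f)))"
    unfolding word_avoids_code_def valid_word_nth drop
    using inner dK g K by (simp add: letter_test_def cong: imp_cong conj_cong)
  also have "(\<forall>t<?c. t < length bs \<longrightarrow> \<not> (\<exists>f<K ^ ?c. ?Q (bs ! t) (digit K f))) \<longleftrightarrow>
      (\<forall>t<length bs. \<not> (\<exists>f<K ^ ?c. ?Q (bs ! t) (digit K f)))"
    using length_le_code_perms(1)[of bs] by (meson less_le_trans)
  also have "\<dots> \<longleftrightarrow> \<not> (\<exists>b\<in>set bs. \<exists>f<K ^ ?c. ?Q b (digit K f))"
    by (rule nths)
  also have "\<dots> \<longleftrightarrow> \<not> (\<exists>b\<in>set bs. embeds R b ?w)" using emb by (simp cong: bex_cong)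
  finally show ?thesis .
qed

lemma decidable_avoiding_word:
  "decidable (\<lambda>e. \<exists>u<g ^ pumping_length n (e 0).
     word_avoids_code Init Next R dl g (pumping_length n (e 0)) (e 0) u)"
  unfolding word_avoids_code_def embedding_code_def
  by (intro decidable_ex decidable_all decidable_conj decidable_imp decidable_not decidable_iff
      decidable_letter_test decidable_less decidable_eq decidable_pos computable_pumping_length
      computable_power computable_const computable_var computable_digit computable_Suc
      computable_code_drop computable_code_nth decidable_const)

text \<open>The program behind \<open>decidable\<close> is specified for long prefixes only; the
  single input is padded with zeros up to that length.\<close>

lemma decides_from_decidable:
  assumes "decidable (\<lambda>e. P (e 0))"
  shows "\<exists>f. \<forall>c. eval f [c] (of_bool (P c))"
proof -
  obtain f N where f: "\<And>m e. m \<ge> N \<Longrightarrow> eval f (map e [0..<m]) (of_bool (P (e 0)))"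
    using assms unfolding decidable_def computable_def by blast
  have "eval (Comp f (Proj 0 # replicate N Zero)) [c] (of_bool (P c))" for c
  proof (rule eval.comp)
    let ?ys = "map (\<lambda>i. if i = 0 then c else 0) [0..<Suc N]"
    show "length ?ys = length (Proj 0 # replicate N Zero)" by simp
    show "\<forall>k<length (Proj 0 # replicate N Zero). eval ((Proj 0 # replicate N Zero) ! k) [c] (?ys ! k)"
    proof (intro allI impI)
      fix k assume "k < length (Proj 0 # replicate N Zero)"
      then show "eval ((Proj 0 # replicate N Zero) ! k) [c] (?ys ! k)"
        using eval.proj[of 0 "[c]"] by (cases k) (auto simp: eval.zero simp del: upt_Suc)
    qed
    show "eval f ?ys (of_bool (P c))"
      using f[of "Suc N" "\<lambda>i. if i = 0 then c else 0"] by simp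
  qed
  then show ?thesis by blast
qed

section \<open>Letters and simple point sets\<close>

text \<open>The axis \<open>a\<close> is vertical for \<open>True\<close> and horizontal for
  \<open>False\<close>. Coordinates are integers so that reflections of the plane become
  negations.\<close>

definition cut :: "(bool \<Rightarrow> 'p \<Rightarrow> int) \<Rightarrow> bool \<Rightarrow> 'p \<Rightarrow> 'p set \<Rightarrow> bool" where
  "cut c a z P \<longleftrightarrow> (\<exists>u\<in>P. \<exists>v\<in>P. c a u < c a z \<and> c a z < c a v)"

text \<open>The sets \<open>I\<close> below are the intervals of the point set \<open>S\<close>.\<close>

definition prime_set :: "(bool \<Rightarrow> 'p \<Rightarrow> int) \<Rightarrow> 'p set \<Rightarrow> bool" where
  "prime_set c S \<longleftrightarrow> (\<forall>I\<subseteq>S. (\<forall>z\<in>S - I. \<forall>a. \<not> cut c a z I) \<longrightarrow> card I \<le> 1 \<or> I = S)"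

definition realizes :: "'l rule \<Rightarrow> (bool \<Rightarrow> 'p \<Rightarrow> int) \<Rightarrow> (nat \<Rightarrow> 'p) \<Rightarrow> 'l list \<Rightarrow> bool" where
  "realizes R c z w \<longleftrightarrow> (\<forall>i j a. i < j \<longrightarrow> j < length w \<longrightarrow>
     c a (z i) \<noteq> c a (z j) \<and> (c a (z i) < c a (z j) \<longleftrightarrow> R (w ! i) (w ! j) (j = Suc i) a))"

text \<open>
  \<open>Pin v s t\<close> is a pin that leaves the earlier points vertically iff \<open>v\<close>, in positive direction iff
  \<open>t\<close>, and separates its predecessor, itself placed with direction \<open>s\<close>, from the others; \<open>Org\<close>
  stands for all points before the first pin.  \<open>Par y\<close> is a point of the upper (\<open>y\<close>) or lower
  half of a parallel alternation.  \<open>WP k\<close> is the point added to a wedge opening to the right: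
  at the far right between the two arms, or, if \<open>k\<close>, above both arms and right of the apex only.
  \<open>W k f u\<close> is a point of the upper (\<open>u\<close>) or lower arm, \<open>f\<close> marking the apex.
\<close>

datatype base = Org | Pin bool bool bool | Par bool | WP bool | W bool bool bool

text \<open>The three flags of a letter choose one of the eight symmetries of the plane.\<close>

type_synonym letter = "(bool \<times> bool \<times> bool) \<times> base"

text \<open>Along its own axis a pin lies beyond everything before it; along the other axis it lies
  on side \<open>s\<close> of everything except a preceding pin, just short of which it stops.
  \<open>Org\<close> is exempt from being separated, so the first pin merely lies in the quadrant
  given by \<open>s\<close> and \<open>t\<close>.\<close>

fun base_rule :: "base rule" where
  "base_rule x (Pin v s t) adj a = (if a = v then t else s \<longleftrightarrow> \<not> (adj \<and> x \<noteq> Org))"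
| "base_rule x (Par y) adj a = (\<not> a \<or> y \<or> x \<noteq> Par True)"
| "base_rule (WP _) (W t f u) adj a = (if a then \<not> t \<and> u else t \<and> \<not> f)"
| "base_rule x (W t f u) adj a = (\<not> a \<or> u)"
| "base_rule x _ adj a = True"

fun base_init :: "base \<Rightarrow> bool" where
  "base_init Org = True"
| "base_init (Par y) = y"
| "base_init (WP t) = True"
| "base_init _ = False"

fun base_next :: "base \<Rightarrow> base \<Rightarrow> bool" where
  "base_next Org (Pin v s t) = True"
| "base_next (Pin v s t) (Pin v' s' t') = (v' = (\<not> v) \<and> s' = t)"
| "base_next (Par y) (Par y') = (y' = (\<not> y))"
| "base_next (WP t) (W t' f u) = (t' = t \<and> f)"
| "base_next (W t f u) (W t' f' u') = (t' = t \<and> \<not> f' \<and> u' = (\<not> u))"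
| "base_next _ _ = False"

fun letter_rule :: "letter rule" where
  "letter_rule (_, x) ((sw, px, py), y) adj a =
     (base_rule x y adj (a \<noteq> sw) \<longleftrightarrow> (if a \<noteq> sw then py else px))"

fun letter_init :: "letter \<Rightarrow> bool" where
  "letter_init (g, x) = base_init x"

fun letter_next :: "letter \<Rightarrow> letter \<Rightarrow> bool" where
  "letter_next (g, x) (h, y) = (g = h \<and> base_next x y)"

instance base :: finite
proof
  let ?U = "{Org} \<union> (\<lambda>(v, s, t). Pin v s t) ` UNIV \<union> range Par \<union> range WP \<union>
    (\<lambda>(v, s, t). W v s t) ` UNIV"
  have "x \<in> ?U" for x by (cases x) (auto simp: image_iff)
  then have "UNIV \<subseteq> ?U" by blast
  then show "finite (UNIV :: base set)" by (rule finite_subset) simp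
qed

definition sg :: "bool \<Rightarrow> int" where
  "sg s = (if s then 1 else - 1)"

section \<open>Simple alternations and wedges\<close>

lemma prime_setI:
  assumes fin: "finite S"
    and "\<And>I u v. \<lbrakk>I \<subseteq> S; u \<in> I; v \<in> I; u < v;
      \<And>a x y z. \<lbrakk>x \<in> I; y \<in> I; z \<in> S; c a x < c a z; c a z < c a y\<rbrakk> \<Longrightarrow> z \<in> I\<rbrakk> \<Longrightarrow> S \<subseteq> I"
  shows "prime_set c (S :: nat set)"
  unfolding prime_set_def
proof (intro allI impI)
  fix I assume I: "I \<subseteq> S" "\<forall>z\<in>S - I. \<forall>a. \<not> cut c a z I"
  show "card I \<le> 1 \<or> I = S"
  proof (rule disjCI)
    assume "I \<noteq> S"
    have closed: "z \<in> I" if "x \<in> I" "y \<in> I" "z \<in> S" "c a x < c a z" "c a z < c a y" for a x y z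
      using I(2) that unfolding cut_def by blast
    have "u = v" if "u \<in> I" "v \<in> I" for u v
      using assms(2)[OF I(1)] closed that \<open>I \<noteq> S\<close> I(1)
      by (metis linorder_neqE_nat subset_antisym)
    then show "card I \<le> 1"
      using card_le_Suc0_iff_eq[OF finite_subset[OF I(1) fin]] by simp
  qed
qed

text \<open>Two horizontal neighbours belong to different halves, and an interval meeting both
  halves contains the lowest upper and the highest lower point. As \<open>m\<close> is even, these
  are the leftmost and the rightmost point.\<close>

lemma prime_par:
  assumes m: "even m" "m \<le> n" "0 < m"
    and d: "\<And>j. d False j = int j" "\<And>j. d True j = (if even j then int (n + j) else int j)"
  shows "prime_set d {..<m}"
proof (rule prime_setI)
  fix I u v assume I: "I \<subseteq> {..<m}" and uv: "u \<in> I" "v \<in> I" "u < v"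
    and closed: "\<And>a x y z. \<lbrakk>x \<in> I; y \<in> I; z \<in> {..<m}; d a x < d a z; d a z < d a y\<rbrakk> \<Longrightarrow> z \<in> I"
  have between: "z \<in> I" if "x \<in> I" "y \<in> I" "x \<le> z" "z \<le> y" for x y z
    using closed[of x y z False] that I by (cases "z = x \<or> z = y") (auto simp: d)
  have "Suc u \<in> I" using between[of u v "Suc u"] uv by simp
  then obtain e p where ep: "e \<in> I" "p \<in> I" "even e" "odd p"
    using uv(1) by (cases "even u") auto
  have lt: "e < m" "p < m" using ep I by auto
  have "0 \<in> I"
  proof (cases "e = 0")
    case False
    then show ?thesis using closed[of p e 0 True] ep lt m by (simp add: d)
  qed (use ep in simp)
  moreover have "m - 1 \<in> I"
  proof (cases "p = m - 1")
    case False
    then show ?thesis using closed[of p e "m - 1" True] ep lt m by (simp add: d)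
  qed (use ep in simp)
  ultimately show "{..<m} \<subseteq> I" using between[of 0 "m - 1"] by auto
qed simp

text \<open>Two consecutive wedge points lie on opposite arms, so an interval with both contains
  every point of smaller absolute height, among them the added point 0. That point is rightmost, so
  everything further out follows.\<close>

lemma prime_wedge_middle:
  assumes n: "5 \<le> n"
    and d: "d False 0 = int n" "\<And>j. 0 < j \<Longrightarrow> d False j = int j"
      "d True 0 = 0" "\<And>j. 0 < j \<Longrightarrow> d True j = sg (even j = q) * int j"
  shows "prime_set d {..<n}"
proof (rule prime_setI)
  fix I u v assume I: "I \<subseteq> {..<n}" and uv: "u \<in> I" "v \<in> I" "u < v"
    and closed: "\<And>a x y z. \<lbrakk>x \<in> I; y \<in> I; z \<in> {..<n}; d a x < d a z; d a z < d a y\<rbrakk> \<Longrightarrow> z \<in> I"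
  have between: "z \<in> I" if "x \<in> I" "y \<in> I" "x \<le> z" "z \<le> y" "0 < x" for x y z
    using closed[of x y z False] that I by (cases "z = x \<or> z = y") (auto simp: d)
  have after: "z \<in> I" if "0 \<in> I" "x \<in> I" "x \<le> z" "z < n" "0 < x" for x z
    using closed[of x 0 z False] that I by (cases "z = x") (auto simp: d)
  have "\<exists>j>0. j \<in> I \<and> Suc j \<in> I"
  proof (cases "u = 0")
    case False
    then show ?thesis using between[of u v "Suc u"] uv by auto
  next
    case True
    show ?thesis
    proof (cases "Suc v < n")
      case True
      then show ?thesis using after[of v "Suc v"] uv \<open>u = 0\<close> by auto
    next
      case False
      then have v: "v = n - 1" using uv I by auto
      \<comment> \<open>If the interval starts from point 0 and the outermost point, the point
        \<open>n - 3\<close> on the same arm lies between their heights and makes a fresh start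
        possible.\<close>
      have "even (n - 3) = even v" using v n by auto
      then have "n - 3 \<in> I"
        using closed[of v 0 "n - 3" True] closed[of 0 v "n - 3" True] uv \<open>u = 0\<close> v n
        by (cases "even v = q") (auto simp: d sg_def)
      then show ?thesis using after[of "n - 3" "n - 2"] uv \<open>u = 0\<close> n
        by (intro exI[of _ "n - 3"]) (auto simp: numeral_3_eq_3 numeral_2_eq_2 Suc_diff_Suc)
    qed
  qed
  then obtain j where j: "0 < j" "j \<in> I" "Suc j \<in> I" by blast
  have jn: "Suc j < n" using j I by auto
  have dj: "d True j = int j \<and> d True (Suc j) = - int (Suc j) \<or>
      d True j = - int j \<and> d True (Suc j) = int (Suc j)"
    using d(4)[of j] d(4)[of "Suc j"] j by (auto simp: sg_def)
  have inner: "z \<in> I" if "z < n" "- int j < d True z" "d True z < int j" for z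
    using closed[of j "Suc j" z True] closed[of "Suc j" j z True] j that dj by auto
  have zero: "0 \<in> I" using inner[of 0] j jn by (simp add: d(3))
  have "z \<in> I" if "0 < z" "z < j" for z
    using inner[of z] d(4)[of z] that jn by (simp add: sg_def)
  then show "{..<n} \<subseteq> I" using after[OF zero j(2) _ _ j(1)] zero
    by (metis gr0I lessThan_iff not_le subsetI)
qed simp

text \<open>Point 0 is topmost, so with any other point it brings in \<open>m - 1\<close>, which by
  the parity condition ends the upper arm and is also rightmost; all of \<open>2, ..., m - 1\<close>
  follow. Two consecutive ones enclose the height of the apex 1, and the apex with any of them
  encloses point 0 horizontally.\<close>

lemma prime_wedge_corner:
  assumes m: "6 \<le> m" "m \<le> n" "even (m - 1) = q"
    and d: "d False 0 = 0" "d False (Suc 0) = - 1" "\<And>j. 1 < j \<Longrightarrow> d False j = int j"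
      "d True 0 = int n" "d True (Suc 0) = 0" "\<And>j. 1 < j \<Longrightarrow> d True j = sg (even j = q) * int j"
  shows "prime_set d {..<m}"
proof (rule prime_setI)
  fix I u v assume I: "I \<subseteq> {..<m}" and uv: "u \<in> I" "v \<in> I" "u < v"
    and closed: "\<And>a x y z. \<lbrakk>x \<in> I; y \<in> I; z \<in> {..<m}; d a x < d a z; d a z < d a y\<rbrakk> \<Longrightarrow> z \<in> I"
  have between: "z \<in> I" if "x \<in> I" "y \<in> I" "x \<le> z" "z \<le> y" "1 < x" for x y z
    using closed[of x y z False] that I by (cases "z = x \<or> z = y") (auto simp: d)
  have before: "z \<in> I" if "0 \<in> I" "x \<in> I" "z \<le> x" "1 < z" for x z
    using closed[of 0 x z False] that I by (cases "z = x") (auto simp: d)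
  have top: "m - 1 \<in> I" if x: "0 \<in> I" "x \<in> I" "0 < x" for x
  proof (cases "x = m - 1")
    case False
    then have "x < m - 1" using x I by auto
    moreover have "d True (m - 1) = int (m - 1)" using d(6)[of "m - 1"] m by (simp add: sg_def)
    moreover have "d True x \<le> int x" using d(6)[of x] d(5) x(3) by (cases "x = 1") (auto simp: sg_def)
    ultimately show ?thesis using closed[of x 0 "m - 1" True] x m by (simp add: d(4))
  qed (use x in simp)
  have up: "z \<in> I" if "0 \<in> I" "x \<in> I" "0 < x" "1 < z" "z < m" for x z
    using before[OF that(1) top[OF that(1-3)], of z] that by simp
  have all: "{..<m} \<subseteq> I" if "j \<in> I" "Suc j \<in> I" "1 < j" for j
  proof -
    have jn: "Suc j < m" using that I by auto
    have "d True j = int j \<and> d True (Suc j) = - int (Suc j) \<or>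
        d True j = - int j \<and> d True (Suc j) = int (Suc j)"
      using d(6)[of j] d(6)[of "Suc j"] that by (auto simp: sg_def)
    then have one: "Suc 0 \<in> I"
      using closed[of j "Suc j" "Suc 0" True] closed[of "Suc j" j "Suc 0" True] that jn d(5)
      by auto
    have zero: "0 \<in> I"
      using closed[of "Suc 0" j 0 False] that jn one d(1,2) d(3)[of j] by auto
    show ?thesis
    proof
      fix z assume "z \<in> {..<m}"
      moreover have "z = 0 \<or> z = Suc 0 \<or> 1 < z" by auto
      ultimately show "z \<in> I" using zero one up[OF zero that(1), of z] that(3) by auto
    qed
  qed
  have all0: "{..<m} \<subseteq> I" if "0 \<in> I" "x \<in> I" "0 < x" for x
    using all[of 2] up[OF that, of 2] up[OF that, of "Suc 2"] m by simp
  consider "u = 0" | "u = 1" | "1 < u" by linarith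
  then show "{..<m} \<subseteq> I"
  proof cases
    case 1
    then show ?thesis using all0 uv by auto
  next
    case 2
    then have "0 \<in> I" using closed[of "Suc 0" v 0 False] uv I m d(1,2) d(3)[of v] by auto
    then show ?thesis using all0 uv by auto
  next
    case 3
    then show ?thesis using between[of u v "Suc u"] uv all[of u] by auto
  qed
qed simp

section \<open>Simple sets inside pin sequences\<close>

locale pin_interval =
  fixes d :: "bool \<Rightarrow> nat \<Rightarrow> int" and v t :: "nat \<Rightarrow> bool" and lo hi :: nat and I :: "nat set"
  assumes outside: "\<lbrakk>lo \<le> i; i < j; j \<le> hi\<rbrakk> \<Longrightarrow> sg (t j) * d (v j) i < sg (t j) * d (v j) j"
    and separates: "\<lbrakk>lo \<le> i; i < j; Suc j \<le> hi\<rbrakk> \<Longrightarrow>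
        sg (t j) * d (v j) i < sg (t j) * d (v j) (Suc j) \<and>
        sg (t j) * d (v j) (Suc j) < sg (t j) * d (v j) j"
    and sub: "I \<subseteq> {lo..hi}"
    and closed: "\<lbrakk>x \<in> I; y \<in> I; z \<in> {lo..hi}; d a x < d a z; d a z < d a y\<rbrakk> \<Longrightarrow> z \<in> I"
begin

lemma closed_sg:
  "\<lbrakk>x \<in> I; y \<in> I; z \<in> {lo..hi}; sg s * d a x < sg s * d a z; sg s * d a z < sg s * d a y\<rbrakk> \<Longrightarrow> z \<in> I"
  using closed[of x y z a] closed[of y x z a] by (cases s) (auto simp: sg_def)

text \<open>Pin \<open>Suc j\<close> separates pin \<open>j\<close> from everything earlier, so an
  interval with two pins runs on to the end of the sequence.\<close>

lemma next_mem:
  assumes "i \<in> I" "j \<in> I" "i < j" "j < hi" shows "Suc j \<in> I"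
  using closed_sg[of i j "Suc j" "t j" "v j"] separates[of i j] assms sub by auto

lemma chain:
  assumes "i \<in> I" "j \<in> I" "i < j" "j \<le> k" "k \<le> hi" shows "k \<in> I"
  using assms(4,5)
proof (induction k rule: dec_induct)
  case (step k)
  then show ?case using next_mem[of i k] assms by auto
qed (use assms in simp)

text \<open>Along the axis of pin \<open>j\<close>, pin \<open>Suc j\<close> stops just short of it.
  Were pin \<open>Suc (Suc j)\<close> on the same side, it would enclose \<open>j\<close> together
  with \<open>Suc j\<close>; being on the opposite side, it encloses everything earlier
  instead.\<close>

lemma preceding:
  assumes j: "lo < j" "Suc j < hi" "v (Suc (Suc j)) = v j"
    and I: "Suc j \<in> I" "Suc (Suc j) \<in> I" "j \<notin> I"
  shows "t (Suc (Suc j)) \<noteq> t j" "lo \<le> r \<Longrightarrow> r < j \<Longrightarrow> r \<in> I"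
proof -
  have *: "sg (t (Suc (Suc j))) * d (v j) i < sg (t (Suc (Suc j))) * d (v j) (Suc (Suc j))"
    if "lo \<le> i" "i < Suc (Suc j)" for i
    using outside[of i "Suc (Suc j)"] that j by simp
  show ne: "t (Suc (Suc j)) \<noteq> t j"
  proof
    assume eq: "t (Suc (Suc j)) = t j"
    have "j \<in> I"
      using closed_sg[of "Suc j" "Suc (Suc j)" j "t j" "v j"] separates[of lo j] *[of j] I j eq by auto
    then show False using I(3) by simp
  qed
  assume r: "lo \<le> r" "r < j"
  have "sg (t j) * d (v j) (Suc (Suc j)) < sg (t j) * d (v j) r"
    using *[of r] r ne by (cases "t j") (auto simp: sg_def)
  then show "r \<in> I"
    using closed_sg[of "Suc (Suc j)" "Suc j" r "t j" "v j"] separates[of r j] I j r by auto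
qed

text \<open>If \<open>hi - 1\<close> is missing, \<open>chain\<close> leaves only \<open>i\<close>
  beside \<open>hi\<close> in the interval. A pin \<open>z\<close> further out than \<open>i\<close>
  in the direction of one of the last two pins would lie between \<open>i\<close> and
  \<open>hi\<close>.\<close>

lemma last_pair:
  assumes i: "lo \<le> i" "Suc i < hi" and I: "i \<in> I" "hi \<in> I" "hi - 1 \<notin> I"
    and z: "lo \<le> z" "Suc z < hi"
  shows "sg (t hi) * d (v hi) z \<le> sg (t hi) * d (v hi) i"
    "sg (t (hi - 1)) * d (v (hi - 1)) z \<le> sg (t (hi - 1)) * d (v (hi - 1)) i"
proof -
  have z_notin: "z \<notin> I" if "z \<noteq> i"
  proof
    assume "z \<in> I"
    then have "hi - 1 \<in> I"
      using chain[of z i "hi - 1"] chain[of i z "hi - 1"] i I z that by (cases "z < i") auto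
    then show False using I(3) by simp
  qed
  show "sg (t hi) * d (v hi) z \<le> sg (t hi) * d (v hi) i"
  proof (rule ccontr)
    assume "\<not> ?thesis"
    then show False
      using closed_sg[of i hi z "t hi" "v hi"] outside[of z hi] I z z_notin by (cases "z = i") auto
  qed
  show "sg (t (hi - 1)) * d (v (hi - 1)) z \<le> sg (t (hi - 1)) * d (v (hi - 1)) i"
  proof (rule ccontr)
    assume "\<not> ?thesis"
    then show False
      using closed_sg[of i hi z "t (hi - 1)" "v (hi - 1)"] separates[of z "hi - 1"] I z z_notin
      by (cases "z = i") auto
  qed
qed

end

lemma obtain_tail:
  fixes I :: "nat set"
  assumes "hi \<in> I"
  obtains j where "j \<le> hi" "{j..hi} \<subseteq> I" "j = 0 \<or> j - 1 \<notin> I"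
proof -
  let ?P = "\<lambda>j. {j..hi} \<subseteq> I"
  have P: "?P hi" using assms by simp
  define j where "j = (LEAST j. ?P j)"
  have j: "?P j" "j \<le> hi" unfolding j_def using P by (rule LeastI, rule Least_le[of ?P])
  have "j - 1 \<notin> I" if pos: "j \<noteq> 0"
  proof
    assume "j - 1 \<in> I"
    moreover have "{j - 1..hi} = insert (j - 1) {j..hi}" using j pos by auto
    ultimately have "?P (j - 1)" using j by simp
    then have "j \<le> j - 1" unfolding j_def by (rule Least_le)
    then show False using pos by simp
  qed
  then have "j = 0 \<or> j - 1 \<notin> I" by auto
  with j(2,1) show ?thesis by (rule that)
qed

text \<open>Along the axis of pin \<open>j\<close>, earlier points stay within distance
  \<open>2 * j\<close>, the pin itself is at \<open>2 * j + 2\<close>, and the next pin fits between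
  them at \<open>2 * j + 1\<close>.\<close>

definition pin_coord :: "(nat \<Rightarrow> bool) \<Rightarrow> (nat \<Rightarrow> bool) \<Rightarrow> bool \<Rightarrow> nat \<Rightarrow> int" where
  "pin_coord v t a j = (if j = 0 then 0 else if a = v j then sg (t j) * (2 * int j + 2)
     else sg (t (j - 1)) * (2 * int j - 1))"

lemma pin_coord_bound: "\<bar>pin_coord v t a j\<bar> \<le> 2 * int j + 2"
  by (auto simp: pin_coord_def sg_def)

lemma pin_coord_main: "0 < (j :: nat) \<Longrightarrow> sg (t j) * pin_coord v t (v j) j = 2 * int j + 2"
  by (auto simp: pin_coord_def sg_def)

lemma pin_coord_cross:
  "v (Suc j) = (\<not> v j) \<Longrightarrow> sg (t j) * pin_coord v t (v j) (Suc j) = 2 * int j + 1"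
  by (auto simp: pin_coord_def sg_def)

lemma sg_mult_le: "\<bar>x\<bar> \<le> y \<Longrightarrow> sg s * x \<le> y"
  by (auto simp: sg_def)

lemma pin_coord_outside:
  assumes "(i :: nat) < j" shows "sg (t j) * pin_coord v t (v j) i < sg (t j) * pin_coord v t (v j) j"
  using sg_mult_le[OF pin_coord_bound[of v t "v j" i], of "t j"] pin_coord_main[of j t v] assms by simp

lemma pin_coord_separates:
  assumes "v (Suc j) = (\<not> v j)"
  shows "(i :: nat) < j \<Longrightarrow> sg (t j) * pin_coord v t (v j) i < sg (t j) * pin_coord v t (v j) (Suc j)"
    "0 < j \<Longrightarrow> sg (t j) * pin_coord v t (v j) (Suc j) < sg (t j) * pin_coord v t (v j) j"
  using sg_mult_le[OF pin_coord_bound[of v t "v j" i], of "t j"] pin_coord_main[of j t v]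
    pin_coord_cross[of v j t, OF assms] by auto

lemma pin_intervalI:
  assumes "\<forall>j. v (Suc j) = (\<not> v j)" "I \<subseteq> {lo..hi}"
    "\<And>a x y z. \<lbrakk>x \<in> I; y \<in> I; z \<in> {lo..hi}; pin_coord v t a x < pin_coord v t a z;
       pin_coord v t a z < pin_coord v t a y\<rbrakk> \<Longrightarrow> z \<in> I"
  shows "pin_interval (pin_coord v t) v t lo hi I"
proof
  show "I \<subseteq> {lo..hi}" by (rule assms(2))
  fix i j :: nat assume ij: "i < j"
  show "sg (t j) * pin_coord v t (v j) i < sg (t j) * pin_coord v t (v j) j"
    by (rule pin_coord_outside[OF ij])
  show "sg (t j) * pin_coord v t (v j) i < sg (t j) * pin_coord v t (v j) (Suc j) \<and>
      sg (t j) * pin_coord v t (v j) (Suc j) < sg (t j) * pin_coord v t (v j) j"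
    using pin_coord_separates(1)[of v j i t, OF spec[OF assms(1)]]
      pin_coord_separates(2)[of v j t, OF spec[OF assms(1)]] ij by simp
qed (rule assms(3))

text \<open>Opposite pins \<open>p\<close> and \<open>q\<close> on one axis enclose the origin and
  the first pin. This rules out the two dangers: an interval of late pins that misses the start of
  the sequence, and a pair made of the last pin and one of the first two points. The index bounds
  keep \<open>p\<close> and \<open>q\<close> after the first pin and before the last two.\<close>

lemma prime_pins_turn:
  assumes v: "\<forall>j. v (Suc j) = (\<not> v j)"
    and pq: "2 \<le> p" "p < q" "Suc q < N" "v p = v q" "t p \<noteq> t q"
  shows "prime_set (pin_coord v t) {0..N}"
proof (rule prime_setI)
  let ?d = "pin_coord v t"
  fix I x y assume I: "I \<subseteq> {0..N}" and xy: "x \<in> I" "y \<in> I" "x < y"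
    and closed: "\<And>a x y z. \<lbrakk>x \<in> I; y \<in> I; z \<in> {0..N}; ?d a x < ?d a z; ?d a z < ?d a y\<rbrakk> \<Longrightarrow> z \<in> I"
  interpret pin_interval ?d v t 0 N I by (rule pin_intervalI[OF v I closed])
  have extreme: "\<exists>p'\<in>{p, q}. sg s * ?d (v p) r < sg s * ?d (v p) p'" if "r < 2" for r s
    using outside[of r p] outside[of r q] that pq by (cases "t p = s") auto
  have inner: "r \<in> I" if "r < 2" "p \<in> I" "q \<in> I" for r
    using closed_sg[of q p r "t p" "v p"] outside[of r p] outside[of r q] that pq
    by (cases "t p"; cases "t q") (auto simp: sg_def)
  have last: "N \<in> I" using chain[of x y N] xy I by auto
  obtain j where j: "j \<le> N" "{j..N} \<subseteq> I" "j = 0 \<or> j - 1 \<notin> I" by (rule obtain_tail[OF last])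
  have tail: "k \<in> I" if "j \<le> k" "k \<le> N" for k using j(2) that by auto
  have "j = 0"
  proof (rule ccontr)
    assume "j \<noteq> 0"
    then have notin: "j - 1 \<notin> I" using j by simp
    show False
    proof (cases "j = N")
      case True
      have "x \<noteq> N - 1" "x \<noteq> N" using notin True xy I by auto
      moreover have "y \<le> N" using xy(2) I by auto
      ultimately have x: "Suc x < N" using xy(3) by arith
      note ext = last_pair[of x, OF _ x xy(1) last notin[unfolded True]]
      show False
      proof (cases "x < 2")
        case True
        \<comment> \<open>Whichever of the last two axes carries \<open>p\<close> and
          \<open>q\<close>, one of them lies further out than \<open>x\<close> in the direction
          concerned.\<close>
        have "v p = v N \<or> v p = v (N - 1)" using spec[OF v, of "N - 1"] pq by (cases N) auto
        then show False
          using extreme[OF True, of "t N"] extreme[OF True, of "t (N - 1)"] ext[of p] ext[of q] pq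
          by fastforce
      next
        case False
        \<comment> \<open>Along the axis of its predecessor, \<open>x\<close> lies strictly between
          the origin and that predecessor, so it is extreme in neither direction.\<close>
        then obtain k where k: "x = Suc k" "0 < k" by (cases x) auto
        have "v k = v N \<or> v k = v (N - 1)" using spec[OF v, of "N - 1"] pq by (cases N) auto
        then show False
          using separates[of 0 k] ext[of 0] ext[of k] x k
          by (cases "t k"; cases "t N"; cases "t (N - 1)") (auto simp: sg_def)
      qed
    next
      case False
      show False
      proof (cases "j = 1")
        case True
        then show False using inner[of 0] notin tail[of p] tail[of q] pq by simp
      next
        case False
        then obtain k where k: "j = Suc k" "0 < k" using \<open>j \<noteq> 0\<close> by (cases j) auto
        have kN: "Suc k < N" using k j(1) \<open>j \<noteq> N\<close> by simp
        have mem: "Suc k \<in> I" "Suc (Suc k) \<in> I" using tail k kN by simp_all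
        have nk: "k \<notin> I" using notin k by simp
        show False
        proof (cases "k = 1")
          case True
          then show False using inner[of 1] nk tail[of p] tail[of q] k pq by simp
        next
          case False
          then have "0 \<in> I" "1 \<in> I"
            using preceding(2)[of k 0] preceding(2)[of k 1] mem nk kN k v by auto
          then show False using chain[of 0 1 k] nk k kN by auto
        qed
      qed
    qed
  qed
  then show "{0..N} \<subseteq> I" using j by simp
qed simp

text \<open>Without turns the pins form, up to symmetry, an increasing oscillation, which is simple
  by itself. The origin is left out because a staircase does not enclose it.\<close>

lemma prime_pins_stair:
  assumes v: "\<forall>j. v (Suc j) = (\<not> v j)" and len: "0 < lo" "lo + 5 \<le> hi"
    and t: "\<And>p q. \<lbrakk>lo \<le> p; p \<le> hi; lo \<le> q; q \<le> hi; v p = v q\<rbrakk> \<Longrightarrow> t p = t q"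
  shows "prime_set (pin_coord v t) {lo..hi}"
proof (rule prime_setI)
  let ?d = "pin_coord v t"
  fix I x y assume I: "I \<subseteq> {lo..hi}" and xy: "x \<in> I" "y \<in> I" "x < y"
    and closed: "\<And>a x y z. \<lbrakk>x \<in> I; y \<in> I; z \<in> {lo..hi}; ?d a x < ?d a z; ?d a z < ?d a y\<rbrakk> \<Longrightarrow> z \<in> I"
  interpret pin_interval ?d v t lo hi I by (rule pin_intervalI[OF v I closed])
  have last: "hi \<in> I" using chain[of x y hi] xy I by auto
  obtain j where j: "j \<le> hi" "{j..hi} \<subseteq> I" "j = 0 \<or> j - 1 \<notin> I" by (rule obtain_tail[OF last])
  have "j \<le> lo"
  proof (rule ccontr)
    assume "\<not> j \<le> lo"
    then have notin: "j - 1 \<notin> I" using j by simp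
    show False
    proof (cases "j = hi")
      case True
      have "x \<noteq> hi - 1" "x \<noteq> hi" using notin True xy I by auto
      moreover have "y \<le> hi" "lo \<le> x" using xy(1,2) I by auto
      ultimately have x: "Suc x < hi" "lo \<le> x" using xy(3) by arith+
      note ext = last_pair[of x, OF x(2,1) xy(1) last notin[unfolded True]]
      \<comment> \<open>In a pair of \<open>x\<close> and \<open>hi\<close>, pin
        \<open>hi - 2\<close> outdoes every earlier \<open>x\<close> along the last axis; if
        \<open>x\<close> is \<open>hi - 2\<close> itself, then \<open>hi - 3\<close> outdoes it
        along the other axis.\<close>
      obtain k where k: "hi = Suc (Suc (Suc k))" "lo < k" using len by (cases hi; cases "hi - 1"; cases "hi - 2") auto
      have vk: "v (Suc k) = v hi" "v k = v (hi - 1)" using v k by auto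
      have tk: "t (Suc k) = t hi" "t k = t (hi - 1)" using t vk k by auto
      show False
      proof (cases "x = Suc k")
        case False
        then show False using ext(1)[of "Suc k"] outside[of x "Suc k"] vk tk x k by auto
      next
        case True
        then show False using ext(2)[of k] separates[of lo k] vk tk k by auto
      qed
    next
      case False
      then obtain k where k: "j = Suc k" "lo \<le> k" "Suc k < hi" using \<open>\<not> j \<le> lo\<close> j(1) by (cases j) auto
      have mem: "Suc k \<in> I" "Suc (Suc k) \<in> I" using j(2) k by auto
      have nk: "k \<notin> I" using notin k by simp
      have vk: "v (Suc (Suc k)) = v k" using v by simp
      have tk: "t (Suc (Suc k)) = t k" by (rule t[OF _ _ _ _ vk]) (use k in auto)
      show False
      proof (cases "lo = k")
        case False
        then show False using preceding(1)[of k] k mem nk vk tk by auto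
      next
        case True
        then show False
          using closed_sg[of "Suc k" "Suc (Suc k)" k "t k" "v k"] pin_coord_separates(2)[of v k t, OF spec[OF v]]
            pin_coord_outside[of k "Suc (Suc k)" t v] vk tk mem nk k len by auto
      qed
    qed
  qed
  then show "{lo..hi} \<subseteq> I" using j by auto
qed simp

lemma realizes_pins:
  assumes v: "\<forall>j. v (Suc j) = (\<not> v j)" and w: "w ! 0 = Org"
    "\<And>j. Suc j < length w \<Longrightarrow> w ! Suc j = Pin (v (Suc j)) (t j) (t (Suc j))"
  shows "realizes base_rule (pin_coord v t) id w"
  unfolding realizes_def
proof (intro allI impI)
  fix i j' a assume ij: "i < j'" "j' < length w"
  then obtain j where j: "j' = Suc j" by (cases j') auto
  have wj: "w ! j' = Pin (v (Suc j)) (t j) (t (Suc j))" using w(2) ij j by simp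
  have wi: "w ! i = Org \<longleftrightarrow> i = 0" using w ij by (cases i) auto
  let ?d = "pin_coord v t"
  show "?d a (id i) \<noteq> ?d a (id j') \<and>
    (?d a (id i) < ?d a (id j')) = base_rule (w ! i) (w ! j') (j' = Suc i) a"
  proof (cases "a = v j'")
    case True
    then show ?thesis using pin_coord_outside[OF ij(1), of t v] wj j
      by (cases "t j'") (auto simp: sg_def)
  next
    case False
    then have a: "a = v j" using v j by auto
    have va: "v (Suc j) \<noteq> v j" using v by simp
    consider "i < j" | "i = j" "j = 0" | "i = j" "0 < j" using ij j by linarith
    then show ?thesis
    proof cases
      case 1
      then show ?thesis using pin_coord_separates(1)[of v j i t, OF spec[OF v]] a va wj j
        by (cases "t j") (auto simp: sg_def)
    next
      case 2
      then show ?thesis using a va wj j wi by (cases "t 0") (auto simp: sg_def pin_coord_def)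
    next
      case 3
      then show ?thesis using pin_coord_separates(2)[of v j t, OF spec[OF v]] a va wj j wi
        by (cases "t j") (auto simp: sg_def)
    qed
  qed
qed

section \<open>Simple sets described by valid words\<close>

lemma valid_base_nth:
  assumes "valid_word base_init base_next w" "Suc j < length w"
  shows "base_next (w ! j) (w ! Suc j)" "base_init (w ! 0)"
  using assms unfolding valid_word_nth by auto

lemma pins_form:
  assumes "valid_word base_init base_next w" "w ! 0 = Org"
  obtains v t where "\<forall>j. v (Suc j) = (\<not> v j)"
    "\<And>j. Suc j < length w \<Longrightarrow> w ! Suc j = Pin (v (Suc j)) (t j) (t (Suc j))"
proof -
  define v where "v j = ((case w ! 1 of Pin v s t \<Rightarrow> v | _ \<Rightarrow> True) = odd j)" for j :: nat
  \<comment> \<open>The value at 0 is the side on which the first pin leaves the origin, as though a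
    pin of that direction had come before.\<close>
  define t where "t j = (if j = 0 then (case w ! 1 of Pin v s t \<Rightarrow> s | _ \<Rightarrow> True)
    else (case w ! j of Pin v s t \<Rightarrow> t | _ \<Rightarrow> True))" for j :: nat
  have "w ! Suc j = Pin (v (Suc j)) (t j) (t (Suc j))" if "Suc j < length w" for j
    using that
  proof (induction j)
    case 0
    then have "base_next Org (w ! 1)" using valid_base_nth(1)[OF assms(1), of 0] assms(2) by simp
    then show ?case by (cases "w ! 1") (auto simp: v_def t_def)
  next
    case (Suc j)
    then have "base_next (Pin (v (Suc j)) (t j) (t (Suc j))) (w ! Suc (Suc j))"
      using valid_base_nth(1)[OF assms(1), of "Suc j"] by simp
    then show ?case by (cases "w ! Suc (Suc j)") (auto simp: v_def t_def[of "Suc (Suc j)"])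
  qed
  moreover have "\<forall>j. v (Suc j) = (\<not> v j)" by (auto simp: v_def)
  ultimately show ?thesis by (intro that)
qed

lemma par_form:
  assumes "valid_word base_init base_next w" "w ! 0 = Par True" "j < length w"
  shows "w ! j = Par (even j)"
  using assms(3)
proof (induction j)
  case (Suc j)
  then have "base_next (Par (even j)) (w ! Suc j)"
    using valid_base_nth(1)[OF assms(1), of j] by simp
  then show ?case by (cases "w ! Suc j") auto
qed (use assms in simp)

lemma wedge_form:
  assumes "valid_word base_init base_next w" "w ! 0 = WP k"
  obtains q where "\<And>j. Suc j < length w \<Longrightarrow> w ! Suc j = W k (j = 0) (even (Suc j) = q)"
proof -
  define q where "q = (case w ! 1 of W t f u \<Rightarrow> \<not> u | _ \<Rightarrow> True)"
  have "w ! Suc j = W k (j = 0) (even (Suc j) = q)" if "Suc j < length w" for j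
    using that
  proof (induction j)
    case 0
    then have "base_next (WP k) (w ! 1)" using valid_base_nth(1)[OF assms(1), of 0] assms(2) by simp
    then show ?case by (cases "w ! 1") (auto simp: q_def)
  next
    case (Suc j)
    then have "base_next (W k (j = 0) (even (Suc j) = q)) (w ! Suc (Suc j))"
      using valid_base_nth(1)[OF assms(1), of "Suc j"] by simp
    then show ?case by (cases "w ! Suc (Suc j)") auto
  qed
  then show ?thesis by (rule that)
qed

text \<open>The constants come from pin sequences without a turn among the indices
  \<open>2, ..., n - 3\<close>: these indices form the staircase, so four points are lost, and its
  five steps require length at least 10. The other cases lose at most one point.\<close>

lemma valid_base_prime:
  assumes w: "valid_word base_init base_next w" and len: "10 \<le> length w"
  shows "\<exists>d T. realizes base_rule d id w \<and> T \<subseteq> {..<length w} \<and> prime_set d T \<and> length w \<le> card T + 4"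
proof -
  let ?n = "length w"
  have "base_init (w ! 0)" using valid_base_nth(2)[OF w, of 0] len by simp
  then consider "w ! 0 = Org" | "w ! 0 = Par True" | k where "w ! 0 = WP k"
    by (cases "w ! 0") auto
  then show ?thesis
  proof cases
    case 1
    obtain v t where vt: "\<forall>j. v (Suc j) = (\<not> v j)"
      "\<And>j. Suc j < ?n \<Longrightarrow> w ! Suc j = Pin (v (Suc j)) (t j) (t (Suc j))"
      using pins_form[OF w 1] by blast
    have real: "realizes base_rule (pin_coord v t) id w" by (rule realizes_pins[OF vt(1) 1 vt(2)])
    show ?thesis
    proof (cases "\<exists>p q. 2 \<le> p \<and> p < q \<and> Suc q < ?n - 1 \<and> v p = v q \<and> t p \<noteq> t q")
      case True
      then obtain p q where pq: "2 \<le> p" "p < q" "Suc q < ?n - 1" "v p = v q" "t p \<noteq> t q" by blast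
      have "prime_set (pin_coord v t) {0..?n - 1}" by (rule prime_pins_turn[OF vt(1) pq])
      moreover have "{0..?n - 1} \<subseteq> {..<?n}" using len by auto
      ultimately show ?thesis using real by (intro exI[of _ "pin_coord v t"] exI[of _ "{0..?n - 1}"]) auto
    next
      case False
      have stair: "t p = t q" if pq: "2 \<le> p" "p \<le> ?n - 3" "2 \<le> q" "q \<le> ?n - 3" "v p = v q" for p q
      proof -
        have "Suc p < ?n - 1" "Suc q < ?n - 1" using pq len by auto
        then show ?thesis using False pq by (cases p q rule: linorder_cases) auto
      qed
      have "prime_set (pin_coord v t) {2..?n - 3}"
      proof (rule prime_pins_stair[where t = t, OF vt(1)])
        show "t p = t q" if "2 \<le> p" "p \<le> ?n - 3" "2 \<le> q" "q \<le> ?n - 3" "v p = v q" for p q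
          using that by (rule stair)
      qed (use len in simp_all)
      moreover have "{2..?n - 3} \<subseteq> {..<?n}" using len by auto
      ultimately show ?thesis using real len
        by (intro exI[of _ "pin_coord v t"] exI[of _ "{2..?n - 3}"]) simp_all
    qed
  next
    case 2
    define d where "d a j = (if a then if even j then int (?n + j) else int j else int j)" for a and j :: nat
    \<comment> \<open>A last point in the upper half is dropped, so that the rightmost point is the
      highest of the lower half.\<close>
    let ?m = "if even ?n then ?n else ?n - 1"
    have "realizes base_rule d id w"
      unfolding realizes_def by (auto simp: par_form[OF w 2] d_def)
    moreover have "prime_set d {..<?m}"
      by (rule prime_par[of _ ?n]) (use len in \<open>auto simp: d_def\<close>)
    ultimately show ?thesis by (intro exI[of _ d] exI[of _ "{..<?m}"]) auto
  next
    case 3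
    obtain q where q: "\<And>j. Suc j < ?n \<Longrightarrow> w ! Suc j = W k (j = 0) (even (Suc j) = q)"
      using wedge_form[OF w 3] by blast
    show ?thesis
    proof (cases k)
      case False
      define d where "d a j = (if a then sg (even j = q) * int j else if j = 0 then int ?n else int j)" for a and j :: nat
      have "realizes base_rule d id w"
        unfolding realizes_def
      proof (intro allI impI)
        fix i j' a assume ij: "i < j'" "j' < ?n"
        then obtain j where j: "j' = Suc j" by (cases j') auto
        show "d a (id i) \<noteq> d a (id j') \<and> (d a (id i) < d a (id j')) = base_rule (w ! i) (w ! j') (j' = Suc i) a"
          using q[of j] q[of "i - 1"] ij j 3 False
          by (cases i) (auto simp: d_def sg_def split: if_splits)
      qed
      moreover have "prime_set d {..<?n}"
        by (rule prime_wedge_middle[of _ _ q]) (use len in \<open>auto simp: d_def\<close>)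
      ultimately show ?thesis by (intro exI[of _ d] exI[of _ "{..<?n}"]) auto
    next
      case True
      define d where "d a j = (if a then if j = 0 then int ?n else if j = 1 then 0 else sg (even j = q) * int j
         else if j = 1 then - 1 else int j)" for a and j :: nat
      \<comment> \<open>A last point on the lower arm is dropped, so that the rightmost point ends
        the upper arm.\<close>
      let ?m = "if even (?n - 1) = q then ?n else ?n - 1"
      have "realizes base_rule d id w"
        unfolding realizes_def
      proof (intro allI impI)
        fix i j' a assume ij: "i < j'" "j' < ?n"
        then obtain j where j: "j' = Suc j" by (cases j') auto
        show "d a (id i) \<noteq> d a (id j') \<and> (d a (id i) < d a (id j')) = base_rule (w ! i) (w ! j') (j' = Suc i) a"
          using q[of j] q[of "i - 1"] ij j 3 True
          by (cases i) (auto simp: d_def sg_def split: if_splits)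
      qed
      moreover have "prime_set d {..<?m}"
        by (rule prime_wedge_corner[of _ ?n q]) (use len in \<open>auto simp: d_def\<close>)
      ultimately show ?thesis by (intro exI[of _ d] exI[of _ "{..<?m}"]) auto
    qed
  qed
qed

lemma letter_word_base:
  assumes "valid_word letter_init letter_next w"
  obtains g where "valid_word base_init base_next (map snd w)" "\<And>i. i < length w \<Longrightarrow> w ! i = (g, snd (w ! i))"
proof -
  have eq: "letter_next x y \<longleftrightarrow> fst x = fst y \<and> base_next (snd x) (snd y)" for x y
    by (cases x; cases y) simp
  have init: "letter_init x \<longleftrightarrow> base_init (snd x)" for x by (cases x) simp
  have "fst (w ! i) = fst (w ! 0)" if "i < length w" for i
    using that
  proof (induction i)
    case (Suc i)
    then have "letter_next (w ! i) (w ! Suc i)" using assms unfolding valid_word_nth by simp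
    then show ?case using Suc unfolding eq by simp
  qed simp
  then have "\<And>i. i < length w \<Longrightarrow> w ! i = (fst (w ! 0), snd (w ! i))" by (metis prod.collapse)
  moreover have "valid_word base_init base_next (map snd w)"
    using assms unfolding valid_word_nth eq init by auto
  ultimately show ?thesis by (rule that[rotated])
qed

lemma valid_letters_prime:
  assumes w: "valid_word letter_init letter_next w" and len: "10 \<le> length w"
  shows "\<exists>c T. realizes letter_rule c id w \<and> T \<subseteq> {..<length w} \<and> prime_set c T \<and> length w \<le> card T + 4"
proof -
  obtain g where g: "valid_word base_init base_next (map snd w)"
      "\<And>i. i < length w \<Longrightarrow> w ! i = (g, snd (w ! i))"
    using letter_word_base[OF w] by blast
  obtain sw px py where gg: "g = (sw, px, py)" by (cases g)
  obtain d T where d: "realizes base_rule d id (map snd w)" "T \<subseteq> {..<length w}" "prime_set d T"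
      "length w \<le> card T + 4"
    using valid_base_prime[OF g(1)] len by auto
  define c where "c a z = sg (if a \<noteq> sw then py else px) * d (a \<noteq> sw) z" for a z
  have "realizes letter_rule c id w"
    unfolding realizes_def
  proof (intro allI impI)
    fix i j a assume ij: "i < j" "j < length w"
    have wi: "w ! i = (g, snd (w ! i))" by (rule g(2)) (use ij in simp)
    have wj: "w ! j = (g, snd (w ! j))" by (rule g(2)) (use ij in simp)
    have "letter_rule (g, x) (g, y) adj a =
       (base_rule x y adj (a \<noteq> sw) \<longleftrightarrow> (if a \<noteq> sw then py else px))" for x y adj
      unfolding gg by simp
    note this[of "snd (w ! i)" "snd (w ! j)" "j = Suc i", folded wi wj]
    then have lr: "letter_rule (w ! i) (w ! j) (j = Suc i) a =
       (base_rule (snd (w ! i)) (snd (w ! j)) (j = Suc i) (a \<noteq> sw) \<longleftrightarrow> (if a \<noteq> sw then py else px))" .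
    have "d (a \<noteq> sw) i \<noteq> d (a \<noteq> sw) j \<and> (d (a \<noteq> sw) i < d (a \<noteq> sw) j \<longleftrightarrow>
        base_rule (snd (w ! i)) (snd (w ! j)) (j = Suc i) (a \<noteq> sw))"
      using d(1)[unfolded realizes_def, rule_format, of i j "a \<noteq> sw"] ij by simp
    then show "c a (id i) \<noteq> c a (id j) \<and> (c a (id i) < c a (id j)) =
        letter_rule (w ! i) (w ! j) (j = Suc i) a"
      unfolding lr c_def by (auto simp: sg_def)
  qed
  moreover have cut_iff: "cut c a z I = cut d (a \<noteq> sw) z I" for a z I
    unfolding cut_def c_def by (auto simp: sg_def)
  have "(\<forall>a. \<not> cut d a z I) = (\<forall>a. \<not> cut c a z I)" for z I
    unfolding cut_iff by (cases sw) (auto simp: all_bool_eq)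
  then have "prime_set c T" using d(3) unfolding prime_set_def by simp
  ultimately show ?thesis using d by blast
qed

section \<open>Pin sequences and alternations\<close>

text \<open>Proper pin sequences: cutting the first \<open>j\<close> entries but not the first
  \<open>j - 1\<close> forces a new entry to separate its predecessor from all others. The first two
  entries are arbitrary.\<close>

definition pinseq :: "(bool \<Rightarrow> 'p \<Rightarrow> int) \<Rightarrow> 'p list \<Rightarrow> bool" where
  "pinseq c q \<longleftrightarrow> 2 \<le> length q \<and> distinct q \<and> (\<forall>j. 2 \<le> j \<longrightarrow> j < length q \<longrightarrow>
     (\<exists>a. cut c a (q ! j) (set (take j q))) \<and> (\<forall>a. \<not> cut c a (q ! j) (set (take (j - 1) q))))"

definition splits :: "(bool \<Rightarrow> 'p \<Rightarrow> int) \<Rightarrow> bool \<Rightarrow> bool \<Rightarrow> 'p \<Rightarrow> 'p \<Rightarrow> 'p set \<Rightarrow> bool" where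
  "splits c a s z y P \<longleftrightarrow> (\<forall>x\<in>P. sg s * c a x < sg s * c a z) \<and> sg s * c a z < sg s * c a y"

lemma cut_mono: "cut c a z P \<Longrightarrow> P \<subseteq> Q \<Longrightarrow> cut c a z Q"
  unfolding cut_def by blast

lemma splits_imp_cut: "splits c a s z y P \<Longrightarrow> P \<noteq> {} \<Longrightarrow> cut c a z (insert y P)"
  unfolding splits_def cut_def sg_def by (cases s) force+

lemma splits_mono: "splits c a s z y P \<Longrightarrow> Q \<subseteq> P \<Longrightarrow> splits c a s z y Q"
  unfolding splits_def by blast

lemma not_cut_side:
  assumes "\<not> cut c a z P" "\<And>x. x \<in> P \<Longrightarrow> c a x \<noteq> c a z"
  shows "\<exists>s. \<forall>x\<in>P. sg s * c a x < sg s * c a z"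
proof (cases "\<exists>x\<in>P. c a x < c a z")
  case True
  then have "\<forall>x\<in>P. c a x < c a z" using assms unfolding cut_def by (meson linorder_neqE)
  then show ?thesis by (intro exI[of _ True]) (simp add: sg_def)
next
  case False
  then have "\<forall>x\<in>P. c a z < c a x" using assms(2) by (meson linorder_neqE)
  then show ?thesis by (intro exI[of _ False]) (simp add: sg_def)
qed

text \<open>All of \<open>P\<close> lies on one side of \<open>z\<close>, so the other side of the
  cut is held by \<open>y\<close> alone.\<close>

lemma cut_insert_splits:
  assumes "cut c a z (insert y P)" "\<not> cut c a z P" "\<And>x. x \<in> P \<Longrightarrow> c a x \<noteq> c a z"
  shows "\<exists>s. splits c a s z y P"
proof -
  obtain s where s: "\<forall>x\<in>P. sg s * c a x < sg s * c a z" using not_cut_side[OF assms(2,3)] by blast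
  have "sg s * c a z < sg s * c a y"
    using assms(1) s unfolding cut_def by (cases s) (force simp: sg_def)+
  then show ?thesis using s unfolding splits_def by blast
qed

section \<open>Pin sequences in simple point sets\<close>

locale prime_points =
  fixes c :: "bool \<Rightarrow> nat \<Rightarrow> int" and n :: nat
  assumes position: "c False i = int i"
    and inj: "\<lbrakk>i < n; j < n; c a i = c a j\<rbrakk> \<Longrightarrow> i = j"
    and prime: "prime_set c {..<n}"
begin

lemma distinct_coord: "\<lbrakk>P \<subseteq> {..<n}; z < n; z \<notin> P; x \<in> P\<rbrakk> \<Longrightarrow> c a x \<noteq> c a z"
  using inj[of x z a] by auto

text \<open>A longest such list exhausts the points, for otherwise primality supplies a further
  point cutting the set of its members.\<close>

lemma cut_order:
  assumes "u < n" "v < n" "u \<noteq> v"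
  shows "\<exists>P. distinct P \<and> set P = {..<n} \<and> 2 \<le> length P \<and> P ! 0 = u \<and> P ! 1 = v \<and>
    (\<forall>j. 2 \<le> j \<longrightarrow> j < length P \<longrightarrow> (\<exists>a. cut c a (P ! j) (set (take j P))))"
proof -
  let ?ok = "\<lambda>P. distinct P \<and> set P \<subseteq> {..<n} \<and> 2 \<le> length P \<and> P ! 0 = u \<and> P ! 1 = v \<and>
    (\<forall>j. 2 \<le> j \<longrightarrow> j < length P \<longrightarrow> (\<exists>a. cut c a (P ! j) (set (take j P))))"
  have start: "?ok [u, v]" using assms by simp
  have bound: "length P \<le> n" if "?ok P" for P
  proof -
    have "card (set P) \<le> card {..<n}" using that by (intro card_mono) auto
    then show ?thesis using that distinct_card[of P] by simp
  qed
  define M where "M = (GREATEST m. \<exists>P. ?ok P \<and> length P = m)"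
  have "\<exists>P. ?ok P \<and> length P = M" unfolding M_def
    by (rule GreatestI_nat[of _ "length [u, v]" n]) (use start bound in blast)+
  then obtain P where P: "?ok P" "length P = M" by blast
  have max: "length Q \<le> length P" if "?ok Q" for Q
    unfolding P(2) M_def by (rule Greatest_le_nat[of _ _ n]) (use that bound in blast)+
  have "set P = {..<n}"
  proof (rule ccontr)
    assume ne: "set P \<noteq> {..<n}"
    have "card (set P) = length P" using P(1) distinct_card by blast
    then have "\<not> card (set P) \<le> 1" using P(1) by simp
    then obtain z a where z: "z \<in> {..<n} - set P" "cut c a z (set P)"
      using prime P(1) ne unfolding prime_set_def by blast
    have "?ok (P @ [z])"
    proof (intro conjI allI impI)
      fix j assume j: "2 \<le> j" "j < length (P @ [z])"
      show "\<exists>a. cut c a ((P @ [z]) ! j) (set (take j (P @ [z])))"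
      proof (cases "j < length P")
        case True
        then show ?thesis using P(1) j by (simp add: nth_append)
      next
        case False
        then have "j = length P" using j by simp
        then show ?thesis using z by auto
      qed
    qed (use P(1) z in \<open>auto simp: nth_append\<close>)
    then have "length (P @ [z]) \<le> length P" by (rule max)
    then show False by simp
  qed
  then show ?thesis using P(1) by blast
qed

text \<open>In the order of \<open>cut_order\<close>, let \<open>i\<close> be least such that entry
  \<open>k\<close> cuts the first \<open>i + 1\<close> entries. Then it separates entry
  \<open>i\<close> from all before, so it extends a pin sequence that ends in entry \<open>i\<close>
  and otherwise uses only entries before it.\<close>

lemma reach:
  assumes "u < n" "v < n" "u \<noteq> v" "x < n" "x \<noteq> u"
  shows "\<exists>q. pinseq c q \<and> set q \<subseteq> {..<n} \<and> q ! 0 = u \<and> q ! 1 = v \<and> last q = x"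
proof -
  obtain P where P: "distinct P" "set P = {..<n}" "2 \<le> length P" "P ! 0 = u" "P ! 1 = v"
    "\<And>j. 2 \<le> j \<Longrightarrow> j < length P \<Longrightarrow> \<exists>a. cut c a (P ! j) (set (take j P))"
    using cut_order[OF assms(1-3)] by blast
  have main: "\<exists>q. pinseq c q \<and> q ! 0 = u \<and> q ! 1 = v \<and> last q = P ! k \<and> set (butlast q) \<subseteq> set (take k P)"
    if "1 \<le> k" "k < length P" for k
    using that
  proof (induction k rule: less_induct)
    case (less k)
    show ?case
    proof (cases "k = 1")
      case True
      have "set (take 1 P) = {u}" using P by (cases P) auto
      then show ?thesis using True assms P
        by (intro exI[of _ "[u, v]"]) (auto simp: pinseq_def)
    next
      case False
      then have k: "2 \<le> k" "k < length P" using less.prems by auto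
      let ?Q = "\<lambda>i. \<exists>a. cut c a (P ! k) (set (take (Suc i) P))"
      have Qk: "?Q (k - 1)" using P(6)[OF k] k by simp
      define i where "i = (LEAST i. ?Q i)"
      have Qi: "?Q i" unfolding i_def using Qk by (rule LeastI)
      have ik: "i \<le> k - 1" unfolding i_def using Qk by (rule Least_le)
      have nQ: "\<not> ?Q j" if "j < i" for j using that unfolding i_def by (rule not_less_Least)
      have "i \<noteq> 0"
      proof
        assume "i = 0"
        then have "set (take (Suc i) P) = {u}" using P by (cases P) auto
        then show False using Qi by (auto simp: cut_def)
      qed
      then have i: "1 \<le> i" "i < k" using ik k by auto
      then obtain q where q: "pinseq c q" "q ! 0 = u" "q ! 1 = v" "last q = P ! i"
          "set (butlast q) \<subseteq> set (take i P)"
        using less.IH[of i] less.prems by auto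
      have len: "2 \<le> length q" "distinct q" using q(1) by (auto simp: pinseq_def)
      then have qne: "q \<noteq> []" by auto
      have setq: "set q = insert (P ! i) (set (butlast q))"
        using qne q(4) by (metis append_butlast_last_id list.set(1) list.set(2) set_append Un_insert_right sup_bot.right_neutral)
      have nmem: "P ! k \<notin> set (take (Suc i) P)"
      proof
        assume "P ! k \<in> set (take (Suc i) P)"
        then obtain j where "j < Suc i" "j < length P" "P ! j = P ! k" by (auto simp: in_set_conv_nth)
        then show False using P(1) i k nth_eq_iff_index_eq[of P j k] by simp
      qed
      have takeS: "set (take (Suc i) P) = insert (P ! i) (set (take i P))"
        using i k by (simp add: take_Suc_conv_app_nth)
      obtain a where a: "cut c a (P ! k) (insert (P ! i) (set (take i P)))" using Qi takeS by auto
      have ncut: "\<not> cut c a (P ! k) (set (take i P))" for a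
        using nQ[of "i - 1"] i by simp
      have sub: "set (take i P) \<subseteq> {..<n}" using P(2) set_take_subset by metis
      have Pk: "P ! k < n" using P(2) k nth_mem by blast
      obtain s where s: "splits c a s (P ! k) (P ! i) (set (take i P))"
        using cut_insert_splits[OF a ncut] distinct_coord[OF sub Pk] nmem takeS by auto
      have pos: "0 < length (butlast q)" using len(1) by simp
      have "u \<in> set (butlast q)" using nth_mem[OF pos] nth_butlast[OF pos] q(2) by simp
      then have "set (butlast q) \<noteq> {}" by (metis empty_iff)
      then have cut: "cut c a (P ! k) (set q)"
        unfolding setq by (rule splits_imp_cut[OF splits_mono[OF s q(5)]])
      have ncut': "\<not> cut c b (P ! k) (set (butlast q))" for b
        using ncut cut_mono[OF _ q(5)] by blast
      have "pinseq c (q @ [P ! k])"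
        unfolding pinseq_def
      proof (intro conjI allI impI)
        have "P ! k \<notin> set q" using nmem q(5) unfolding setq takeS by blast
        then show "distinct (q @ [P ! k])" using len by simp
        fix j assume j: "2 \<le> j" "j < length (q @ [P ! k])"
        have *: "(\<exists>a. cut c a ((q @ [P ! k]) ! j) (set (take j (q @ [P ! k])))) \<and>
          (\<forall>a. \<not> cut c a ((q @ [P ! k]) ! j) (set (take (j - 1) (q @ [P ! k]))))"
        proof (cases "j < length q")
          case True
          then have "(q @ [P ! k]) ! j = q ! j" "take j (q @ [P ! k]) = take j q"
            "take (j - 1) (q @ [P ! k]) = take (j - 1) q" by (simp_all add: nth_append)
          then show ?thesis using q(1) True j unfolding pinseq_def by simp
        next
          case False
          then have jl: "j = length q" using j by simp
          then have "take (j - 1) (q @ [P ! k]) = butlast q"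
            by (simp add: butlast_conv_take)
          then show ?thesis using cut ncut' jl by auto
        qed
        show "\<exists>a. cut c a ((q @ [P ! k]) ! j) (set (take j (q @ [P ! k])))" using * by blast
        show "\<not> cut c a ((q @ [P ! k]) ! j) (set (take (j - 1) (q @ [P ! k])))" for a using * by blast
      qed (use len in simp)
      moreover have "set q \<subseteq> set (take k P)"
      proof -
        have "set (take (Suc i) P) \<subseteq> set (take k P)" using i by (intro set_take_subset_set_take) simp
        then show ?thesis using q(5) unfolding setq takeS by blast
      qed
      ultimately show ?thesis using q(2,3) len
        by (intro exI[of _ "q @ [P ! k]"]) (auto simp: nth_append)
    qed
  qed
  obtain k where k: "k < length P" "P ! k = x" using P(2) assms(4) by (metis in_set_conv_nth lessThan_iff)
  have "k \<noteq> 0" using k P(4) assms(5) by metis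
  then obtain q where q: "pinseq c q" "q ! 0 = u" "q ! 1 = v" "last q = P ! k"
      "set (butlast q) \<subseteq> set (take k P)"
    using main[of k] k by auto
  have "q \<noteq> []" using q(1) by (auto simp: pinseq_def)
  have "set q \<subseteq> {..<n}"
  proof
    fix y assume "y \<in> set q"
    then have "y \<in> set (butlast q) \<or> y = last q"
      using \<open>q \<noteq> []\<close> by (metis append_butlast_last_id insert_iff list.set(2) rotate1.simps(2) set_rotate1)
    then show "y \<in> {..<n}" using q(4,5) k assms(4) P(2) set_take_subset[of k P] by auto
  qed
  then show ?thesis using q k by blast
qed

lemma pinseq_splits:
  assumes q: "pinseq c q" "set q \<subseteq> {..<n}" and j: "2 \<le> j" "j < length q"
  shows "\<exists>a s. splits c a s (q ! j) (q ! (j - 1)) (set (take (j - 1) q))"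
proof -
  obtain a where a: "cut c a (q ! j) (set (take j q))"
    and ncut: "\<not> cut c a (q ! j) (set (take (j - 1) q))"
    using q(1) j unfolding pinseq_def by blast
  have take: "set (take j q) = insert (q ! (j - 1)) (set (take (j - 1) q))"
    using take_Suc_conv_app_nth[of "j - 1" q] j by simp
  have "q ! j \<notin> set (take (j - 1) q)"
    using q(1) j unfolding pinseq_def by (auto simp: in_set_conv_nth nth_eq_iff_index_eq)
  moreover have "set (take (j - 1) q) \<subseteq> {..<n}" using q(2) set_take_subset by fast
  moreover have "q ! j < n" using q(2) j nth_mem by blast
  ultimately show ?thesis
    using cut_insert_splits[OF a[unfolded take] ncut] distinct_coord by blast
qed

end

section \<open>From short pin sequences to an alternation\<close>

definition alternation :: "(bool \<Rightarrow> nat \<Rightarrow> int) \<Rightarrow> nat \<Rightarrow> nat \<Rightarrow> bool" where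
  "alternation c n m \<longleftrightarrow> (\<exists>a s r l e f.
     (\<forall>i<m. e i < n \<and> f i < n \<and> sg s * c a (e i) \<le> l \<and> l < sg s * c a (f i) \<and>
        sg r * c (\<not> a) (e i) < sg r * c (\<not> a) (f i)) \<and>
     (\<forall>i. Suc i < m \<longrightarrow> sg r * c (\<not> a) (f i) < sg r * c (\<not> a) (e (Suc i))))"

lemma pigeonhole_card:
  assumes "finite F" "f ` I \<subseteq> F" "card F * M < card I"
  shows "\<exists>y\<in>F. M < card {i \<in> I. f i = y}"
proof (rule ccontr)
  assume *: "\<not> ?thesis"
  have fin: "finite I" using assms(3) card.infinite by fastforce
  have "I = (\<Union>y\<in>F. {i \<in> I. f i = y})" using assms(2) by blast
  then have "card I \<le> (\<Sum>y\<in>F. card {i \<in> I. f i = y})" using card_UN_le[OF assms(1)] by metis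
  also have "\<dots> \<le> card F * M" using * sum_bounded_above[of F "\<lambda>y. card {i \<in> I. f i = y}" M] by (simp add: not_less)
  finally show False using assms(3) by simp
qed

text \<open>
  Remove the intervals through the last point of the one ending first, and repeat: either one
  removal is large, or the first intervals of many rounds are disjoint.
\<close>

lemma common_point_or_disjoint:
  fixes x h :: "'i \<Rightarrow> int"
  assumes "finite I" "\<And>i. i \<in> I \<Longrightarrow> x i < h i" "m * k < card I"
  shows "(\<exists>l. k < card {i \<in> I. x i \<le> l \<and> l < h i}) \<or>
    (\<exists>g. (\<forall>j<Suc m. g j \<in> I) \<and> (\<forall>j. Suc j < Suc m \<longrightarrow> h (g j) \<le> x (g (Suc j))))"
  using assms
proof (induction m arbitrary: I)
  case 0
  then have "I \<noteq> {}" by auto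
  then obtain i where "i \<in> I" by blast
  then show ?case by (intro disjI2 exI[of _ "\<lambda>_. i"]) simp
next
  case (Suc m)
  have "I \<noteq> {}" using Suc.prems by auto
  then obtain i where i: "i \<in> I" "\<And>j. j \<in> I \<Longrightarrow> h i \<le> h j"
    using ex_min_if_finite[of "h ` I"] Suc.prems(1) by (auto simp: not_less)
  let ?J = "{j \<in> I. x j \<le> h i - 1 \<and> h i - 1 < h j}"
  show ?case
  proof (cases "k < card ?J")
    case True
    then show ?thesis by (intro disjI1 exI[of _ "h i - 1"])
  next
    case False
    have "card I - card ?J \<le> card (I - ?J)" by (rule diff_card_le_card_Diff) (use Suc.prems(1) in simp)
    then have card: "m * k < card (I - ?J)" using False Suc.prems(3) by simp
    have "(\<exists>l. k < card {i \<in> I - ?J. x i \<le> l \<and> l < h i}) \<or>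
      (\<exists>g. (\<forall>j<Suc m. g j \<in> I - ?J) \<and> (\<forall>j. Suc j < Suc m \<longrightarrow> h (g j) \<le> x (g (Suc j))))"
      using Suc.prems card by (intro Suc.IH) auto
    then show ?thesis
    proof
      assume "\<exists>l. k < card {i \<in> I - ?J. x i \<le> l \<and> l < h i}"
      then obtain l where l: "k < card {i \<in> I - ?J. x i \<le> l \<and> l < h i}" by blast
      have "card {i \<in> I - ?J. x i \<le> l \<and> l < h i} \<le> card {i \<in> I. x i \<le> l \<and> l < h i}"
        using Suc.prems(1) by (intro card_mono) auto
      then show ?thesis using l by (intro disjI1 exI[of _ l]) simp
    next
      assume "\<exists>g. (\<forall>j<Suc m. g j \<in> I - ?J) \<and> (\<forall>j. Suc j < Suc m \<longrightarrow> h (g j) \<le> x (g (Suc j)))"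
      then obtain g where g: "\<forall>j<Suc m. g j \<in> I - ?J" "\<forall>j. Suc j < Suc m \<longrightarrow> h (g j) \<le> x (g (Suc j))"
        by blast
      let ?g = "case_nat i g"
      have "g 0 \<in> I - ?J" using g(1) by blast
      then have "h i \<le> x (g 0)" using i(2)[of "g 0"] by auto
      then have "\<forall>j. Suc j < Suc (Suc m) \<longrightarrow> h (?g j) \<le> x (?g (Suc j))"
        using g(2) by (auto split: nat.split)
      moreover have "\<forall>j<Suc (Suc m). ?g j \<in> I" using g(1) i(1) by (auto split: nat.split)
      ultimately show ?thesis by blast
    qed
  qed
qed

text \<open>Adjacent starting positions make the starting pairs disjoint and leave no position
  inside a pair.\<close>

definition pin_family :: "(bool \<Rightarrow> nat \<Rightarrow> int) \<Rightarrow> nat \<Rightarrow> nat set \<Rightarrow> (nat \<Rightarrow> nat list) \<Rightarrow> nat \<Rightarrow> bool" where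
  "pin_family c n I q t \<longleftrightarrow> finite I \<and> (\<forall>i\<in>I. pinseq c (q i) \<and> set (q i) \<subseteq> {..<n} \<and>
     t < length (q i) \<and> q i ! 0 = 2 * i \<and> q i ! 1 = Suc (2 * i))"

text \<open>With integer coordinates the line sits at \<open>l + 1/2\<close>, so that points at the
  value \<open>l\<close> count as lying before it.\<close>

definition on_sides :: "(bool \<Rightarrow> nat \<Rightarrow> int) \<Rightarrow> bool \<Rightarrow> bool \<Rightarrow> int \<Rightarrow> nat \<Rightarrow> nat list \<Rightarrow> bool" where
  "on_sides c a s l t q \<longleftrightarrow> (\<forall>j<t. sg s * c a (q ! j) \<le> l) \<and> l < sg s * c a (q ! t)"

context prime_points
begin

text \<open>A vertical line separates at most one of the disjoint starting pairs. A line common to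
  several pairs is therefore horizontal, and the pairs read from left to right already
  alternate.\<close>

lemma first_pair_alternation:
  assumes fam: "pin_family c n I q 1" and card: "Suc m < card I"
    and sides: "\<And>i. i \<in> I \<Longrightarrow> on_sides c a s l 1 (q i)"
  shows "alternation c n m"
proof (cases a)
  case False
  have "card I \<le> Suc 0"
  proof -
    have "i = nat l div 2" if "i \<in> I" for i
    proof -
      have "q i ! 0 = 2 * i" "q i ! 1 = Suc (2 * i)" using fam that unfolding pin_family_def by auto
      then have "sg s * int (2 * i) \<le> l" "l < sg s * int (Suc (2 * i))"
        using sides[OF that] False unfolding on_sides_def by (auto simp: position)
      then show ?thesis by (cases s) (auto simp: sg_def)
    qed
    then have "I \<subseteq> {nat l div 2}" by auto
    then have "card I \<le> card {nat l div 2}" by (intro card_mono) auto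
    then show ?thesis by simp
  qed
  then show ?thesis using card by simp
next
  case True
  define L where "L = sorted_list_of_set I"
  have fin: "finite I" using fam by (simp add: pin_family_def)
  have L: "length L = card I" "set L = I" "sorted_wrt (<) L"
    unfolding L_def using fin by (simp_all add: strict_sorted_list_of_set)
  have mem: "L ! i \<in> I" if "i < m" for i using that card L by (metis Suc_lessD less_trans nth_mem)
  have el: "q (L ! i) ! 0 = 2 * (L ! i)" "q (L ! i) ! 1 = Suc (2 * (L ! i))"
    "set (q (L ! i)) \<subseteq> {..<n}" "1 < length (q (L ! i))" if "i < m" for i
    using fam mem[OF that] unfolding pin_family_def by blast+
  show ?thesis unfolding alternation_def
  proof (rule exI[of _ a],
      rule exI[of _ s],
      rule exI[of _ True],
      rule exI[of _ l],
      rule exI[of _ "\<lambda>i. 2 * (L ! i)"],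
      rule exI[of _ "\<lambda>i. Suc (2 * (L ! i))"], intro conjI allI impI)
    fix i assume i: "i < m"
    have memn: "q (L ! i) ! j < n" if "j < length (q (L ! i))" for j
      using subsetD[OF el(3)[OF i] nth_mem[OF that]] by simp
    have "0 < length (q (L ! i))" using el(4)[OF i] by linarith
    then have "q (L ! i) ! 0 < n" "q (L ! i) ! 1 < n" using memn el(4)[OF i] by blast+
    then show "2 * L ! i < n" "Suc (2 * L ! i) < n" using el(1,2)[OF i] by simp_all
    show "sg s * c a (2 * L ! i) \<le> l" "l < sg s * c a (Suc (2 * L ! i))"
      using sides[OF mem[OF i]] el(1,2)[OF i] unfolding on_sides_def by auto
    show "sg True * c (\<not> a) (2 * L ! i) < sg True * c (\<not> a) (Suc (2 * L ! i))"
      using True by (simp add: position sg_def)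
  next
    fix i assume i: "Suc i < m"
    then have "L ! i < L ! Suc i" using L card by (intro sorted_wrt_nth_less[of "(<)"]) auto
    then show "sg True * c (\<not> a) (Suc (2 * L ! i)) < sg True * c (\<not> a) (2 * L ! Suc i)"
      using True by (simp add: position sg_def)
  qed
qed

end

lemma pin_family_subset: "pin_family c n I q t \<Longrightarrow> J \<subseteq> I \<Longrightarrow> t' \<le> t \<Longrightarrow> pin_family c n J q t'"
  unfolding pin_family_def using finite_subset[of J I] by (meson le_less_trans subsetD)

text \<open>Going one pin back costs a factor 2 for the direction in which the pin splits and a
  factor \<open>m\<close> for the choice between a common point and \<open>m + 1\<close> disjoint
  intervals; the base case is the demand of \<open>first_pair_alternation\<close>.\<close>

fun family_bound :: "nat \<Rightarrow> nat \<Rightarrow> nat" where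
  "family_bound m 0 = Suc m"
| "family_bound m (Suc t) = 2 * (m * family_bound m t)"

text \<open>
  All pins with index \<open>Suc t\<close> lie on one side of a common line and the earlier pins on the other,
  so pin \<open>Suc t\<close> must separate pin \<open>t\<close> from its predecessors along the other axis.
\<close>

lemma (in prime_points) family_alternation:
  assumes "pin_family c n I q (Suc t)" "family_bound m t < card I"
    and "\<And>i. i \<in> I \<Longrightarrow> on_sides c a s l (Suc t) (q i)"
  shows "alternation c n m"
  using assms
proof (induction t arbitrary: I a s l)
  case 0
  then show ?case using first_pair_alternation[of I q m a s l] by simp
next
  case (Suc t)
  have fin: "finite I" using Suc.prems(1) by (simp add: pin_family_def)
  have q: "pinseq c (q i)" "set (q i) \<subseteq> {..<n}" "Suc (Suc t) < length (q i)" if "i \<in> I" for i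
    using Suc.prems(1) that unfolding pin_family_def by auto
  have side: "sg s * c a (q i ! j) \<le> l" "l < sg s * c a (q i ! Suc (Suc t))"
    if "i \<in> I" "j < Suc (Suc t)" for i j
    using Suc.prems(3)[OF that(1)] that(2) unfolding on_sides_def by auto
  have split: "\<exists>r. splits c (\<not> a) r (q i ! Suc (Suc t)) (q i ! Suc t) (set (take (Suc t) (q i)))"
    if i: "i \<in> I" for i
  proof -
    obtain b r where br: "splits c b r (q i ! Suc (Suc t)) (q i ! Suc t) (set (take (Suc t) (q i)))"
      using pinseq_splits[OF q(1,2)[OF i], of "Suc (Suc t)"] q(3)[OF i] by auto
    have "q i ! 0 \<in> set (take (Suc t) (q i))" using q(3)[OF i] by (auto simp: in_set_conv_nth)
    then have "sg r * c b (q i ! 0) < sg r * c b (q i ! Suc (Suc t))"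
      "sg r * c b (q i ! Suc (Suc t)) < sg r * c b (q i ! Suc t)"
      using br unfolding splits_def by auto
    moreover have "sg s * c a (q i ! 0) < sg s * c a (q i ! Suc (Suc t))"
      "sg s * c a (q i ! Suc t) < sg s * c a (q i ! Suc (Suc t))"
      using side[OF i, of 0] side[OF i, of "Suc t"] by auto
    ultimately have "b \<noteq> a" by (cases s; cases r; cases b; cases a) (simp_all add: sg_def)
    then have "b = (\<not> a)" by auto
    then show ?thesis using br by blast
  qed
  define r where "r i = (SOME r. splits c (\<not> a) r (q i ! Suc (Suc t)) (q i ! Suc t) (set (take (Suc t) (q i))))" for i
  have r: "splits c (\<not> a) (r i) (q i ! Suc (Suc t)) (q i ! Suc t) (set (take (Suc t) (q i)))"
    if "i \<in> I" for i unfolding r_def using split[OF that] by (rule someI_ex)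
  have "\<exists>y\<in>(UNIV :: bool set). m * family_bound m t < card {i \<in> I. r i = y}"
    by (rule pigeonhole_card) (use Suc.prems(2) in simp_all)
  then obtain r0 where r0: "m * family_bound m t < card {i \<in> I. r i = r0}" by blast
  let ?J = "{i \<in> I. r i = r0}"
  let ?x = "\<lambda>i. sg r0 * c (\<not> a) (q i ! Suc (Suc t))" and ?h = "\<lambda>i. sg r0 * c (\<not> a) (q i ! Suc t)"
  have xh: "?x i < ?h i" and low: "sg r0 * c (\<not> a) (q i ! j) < ?x i" if "i \<in> ?J" "j < Suc t" for i j
  proof -
    have s: "splits c (\<not> a) r0 (q i ! Suc (Suc t)) (q i ! Suc t) (set (take (Suc t) (q i)))"
      using r[of i] that by auto
    then show "?x i < ?h i" unfolding splits_def by blast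
    have "q i ! j \<in> set (take (Suc t) (q i))" using q(3)[of i] that by (auto simp: in_set_conv_nth)
    then show "sg r0 * c (\<not> a) (q i ! j) < ?x i" using s unfolding splits_def by blast
  qed
  have finJ: "finite ?J" using fin by simp
  have "(\<exists>l. family_bound m t < card {i \<in> ?J. ?x i \<le> l \<and> l < ?h i}) \<or>
    (\<exists>g. (\<forall>j<Suc m. g j \<in> ?J) \<and> (\<forall>j. Suc j < Suc m \<longrightarrow> ?h (g j) \<le> ?x (g (Suc j))))"
    by (rule common_point_or_disjoint[OF finJ xh r0]) auto
  then show ?case
  proof
    assume "\<exists>l. family_bound m t < card {i \<in> ?J. ?x i \<le> l \<and> l < ?h i}"
    then obtain l' where l': "family_bound m t < card {i \<in> ?J. ?x i \<le> l' \<and> l' < ?h i}" by blast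
    let ?K = "{i \<in> ?J. ?x i \<le> l' \<and> l' < ?h i}"
    show ?thesis
    proof (rule Suc.IH[of ?K "\<not> a" r0 l'])
      show "pin_family c n ?K q (Suc t)" by (rule pin_family_subset[OF Suc.prems(1)]) auto
      show "family_bound m t < card ?K" by (rule l')
      show "on_sides c (\<not> a) r0 l' (Suc t) (q i)" if "i \<in> ?K" for i
        unfolding on_sides_def
      proof (intro conjI allI impI)
        fix j assume "j < Suc t"
        then show "sg r0 * c (\<not> a) (q i ! j) \<le> l'" using low[of i j] that by fastforce
      qed (use that in blast)
    qed
  next
    assume "\<exists>g. (\<forall>j<Suc m. g j \<in> ?J) \<and> (\<forall>j. Suc j < Suc m \<longrightarrow> ?h (g j) \<le> ?x (g (Suc j)))"
    then obtain g where g: "\<And>j. j < Suc m \<Longrightarrow> g j \<in> ?J" "\<And>j. Suc j < Suc m \<Longrightarrow> ?h (g j) \<le> ?x (g (Suc j))"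
      by blast
    have gI: "g i \<in> I" if "i < Suc m" for i using g(1)[OF that] by simp
    have lt: "q (g i) ! j < n" if "i < Suc m" "j < Suc (Suc (Suc t))" for i j
      using subsetD[OF q(2)[OF gI[OF that(1)]] nth_mem[of j "q (g i)"]] q(3)[OF gI[OF that(1)]] that(2)
      by simp
    \<comment> \<open>The later pin, beyond the line, comes first along the other axis and plays
      \<open>e\<close>, so the sides are exchanged: negation turns \<open>l < x\<close> into
      \<open>- x \<le> - l - 1\<close>.\<close>
    show ?thesis unfolding alternation_def
    proof (rule exI[of _ a],
      rule exI[of _ "\<not> s"],
      rule exI[of _ r0],
      rule exI[of _ "- l - 1"],
      rule exI[of _ "\<lambda>i. q (g i) ! Suc (Suc t)"],
      rule exI[of _ "\<lambda>i. q (g i) ! Suc t"], intro conjI allI impI)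
      fix i assume i: "i < m"
      show "q (g i) ! Suc (Suc t) < n" "q (g i) ! Suc t < n" using lt i by auto
      have neg: "sg (\<not> s) * z = - (sg s * z)" for z by (simp add: sg_def)
      show "sg (\<not> s) * c a (q (g i) ! Suc (Suc t)) \<le> - l - 1"
        "- l - 1 < sg (\<not> s) * c a (q (g i) ! Suc t)"
        using side[OF gI[of i], of "Suc t"] i unfolding neg by auto
      show "?x (g i) < ?h (g i)" using xh[OF g(1)[of i], of 0] i by simp
    next
      fix i assume i: "Suc i < m"
      have "?h (g i) \<noteq> ?x (g (Suc i))"
      proof
        assume "?h (g i) = ?x (g (Suc i))"
        then have "c (\<not> a) (q (g i) ! Suc t) = c (\<not> a) (q (g (Suc i)) ! Suc (Suc t))"
          by (cases r0) (auto simp: sg_def)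
        then have "q (g i) ! Suc t = q (g (Suc i)) ! Suc (Suc t)"
          using inj lt[of i "Suc t"] lt[of "Suc i" "Suc (Suc t)"] i by simp
        then show False using side(1)[OF gI[of i], of "Suc t"] side(2)[OF gI[of "Suc i"], of 0] i by simp
      qed
      moreover have "?h (g i) \<le> ?x (g (Suc i))" by (rule g(2)) (use i in simp)
      ultimately show "?h (g i) < ?x (g (Suc i))" by (rule order.not_eq_order_implies_strict)
    qed
  qed
qed

lemma (in prime_points) long_pinseq_or_alternation:
  assumes big: "\<And>t. t < k \<Longrightarrow> family_bound m t \<le> M" and n: "2 * (4 * k * M) + 6 \<le> n"
  shows "(\<exists>q. pinseq c q \<and> set q \<subseteq> {..<n} \<and> k \<le> length q) \<or> alternation c n m"
proof (rule disjCI)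
  assume "\<not> alternation c n m"
  show "\<exists>q. pinseq c q \<and> set q \<subseteq> {..<n} \<and> k \<le> length q"
  proof (rule ccontr)
    assume short: "\<not> ?thesis"
    \<comment> \<open>Pigeonhole over \<open>k\<close> lengths and four pairs of axis and direction;
      all starting pairs end before the target \<open>n - 1\<close>, so each sequence has at least
      three entries.\<close>
    let ?I = "{..<4 * k * M + 1}"
    have "\<exists>q. pinseq c q \<and> set q \<subseteq> {..<n} \<and> q ! 0 = 2 * i \<and> q ! 1 = Suc (2 * i) \<and> last q = n - 1"
      if "i \<in> ?I" for i
      using that n by (intro reach) auto
    then have "\<forall>i\<in>?I. \<exists>q. pinseq c q \<and> set q \<subseteq> {..<n} \<and> q ! 0 = 2 * i \<and> q ! 1 = Suc (2 * i) \<and> last q = n - 1"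
      by blast
    then obtain q where q: "\<forall>i\<in>?I. pinseq c (q i) \<and> set (q i) \<subseteq> {..<n} \<and> q i ! 0 = 2 * i \<and>
        q i ! 1 = Suc (2 * i) \<and> last (q i) = n - 1"
      by (rule bchoice[THEN exE])
    have len: "length (q i) < k" "3 \<le> length (q i)" "q i ! (length (q i) - 1) = n - 1" if i: "i \<in> ?I" for i
    proof -
      show "length (q i) < k" using short q i by (meson not_le)
      have l2: "2 \<le> length (q i)" using q i by (simp add: pinseq_def)
      then show last: "q i ! (length (q i) - 1) = n - 1" using q i by (metis last_conv_nth list.size(3) not_numeral_le_zero)
      have "length (q i) \<noteq> 2" using last q i n by auto
      then show "3 \<le> length (q i)" using l2 by simp
    qed
    have sp: "\<exists>b r. splits c b r (n - 1) (q i ! (length (q i) - 2)) (set (take (length (q i) - 2) (q i)))"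
      if i: "i \<in> ?I" for i
      using pinseq_splits[of "q i" "length (q i) - 1"] q i len[OF i] by (simp add: numeral_2_eq_2)
    then have "\<forall>i\<in>?I. \<exists>br. splits c (fst br) (snd br) (n - 1) (q i ! (length (q i) - 2)) (set (take (length (q i) - 2) (q i)))"
      by (metis fst_conv snd_conv)
    then obtain br where br: "\<forall>i\<in>?I. splits c (fst (br i)) (snd (br i)) (n - 1) (q i ! (length (q i) - 2)) (set (take (length (q i) - 2) (q i)))"
      by (rule bchoice[THEN exE])
    let ?F = "{..<k} \<times> (UNIV :: (bool \<times> bool) set)"
    let ?f = "\<lambda>i. (length (q i), br i)"
    have "\<exists>y\<in>?F. M < card {i \<in> ?I. ?f i = y}"
    proof (rule pigeonhole_card)
      show "?f ` ?I \<subseteq> ?F" using len by auto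
      show "card ?F * M < card ?I" by (simp add: card_cartesian_product)
    qed simp
    then obtain L b r where L: "L < k" "M < card {i \<in> ?I. ?f i = (L, b, r)}" by auto
    let ?J = "{i \<in> ?I. ?f i = (L, b, r)}"
    have "?J \<noteq> {}" using L(2) by (metis card.empty not_less0)
    then obtain i0 where "i0 \<in> ?J" by blast
    then have L3: "3 \<le> L" using len(2)[of i0] by auto
    define t where "t = L - 3"
    have Lt: "L - 2 = Suc t" using L3 t_def by simp
    \<comment> \<open>The target point supplies the common line: in every sequence of the chosen
      class it separates the entry before it from the rest along the same axis and in the same
      direction.\<close>
    have "alternation c n m"
    proof (rule family_alternation[of ?J q t m b r "sg r * c b (n - 1)"])
      show "pin_family c n ?J q (Suc t)" unfolding pin_family_def using q Lt L3 by auto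
      show "family_bound m t < card ?J"
        by (rule le_less_trans[OF big L(2)]) (use L(1) t_def in simp)
      show "on_sides c b r (sg r * c b (n - 1)) (Suc t) (q i)" if i: "i \<in> ?J" for i
      proof -
        have ii: "i \<in> ?I" "br i = (b, r)" "length (q i) = L" using i by auto
        have s: "splits c b r (n - 1) (q i ! Suc t) (set (take (Suc t) (q i)))"
          using br[rule_format, OF ii(1)] unfolding ii Lt fst_conv snd_conv .
        have "q i ! j \<in> set (take (Suc t) (q i))" if "j < Suc t" for j
          using that ii(3) Lt L3 nth_mem[of j "take (Suc t) (q i)"] by simp
        then have "\<forall>j<Suc t. sg r * c b (q i ! j) \<le> sg r * c b (n - 1)"
          using s unfolding splits_def by (meson less_imp_le)
        then show ?thesis using s unfolding on_sides_def splits_def by blast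
      qed
    qed
    then show False using \<open>\<not> alternation c n m\<close> by simp
  qed
qed

section \<open>Finding words in simple point sets\<close>

definition view :: "(bool \<Rightarrow> nat \<Rightarrow> int) \<Rightarrow> bool \<Rightarrow> bool \<Rightarrow> bool \<Rightarrow> bool \<Rightarrow> nat \<Rightarrow> int" where
  "view c sw px py e z = sg (if e then py else px) * c (e \<noteq> sw) z"

text \<open>The hosted points need not form a simple set; only the shape of the word matters, since
  valid words are realised by simple sets elsewhere.\<close>

definition hosts :: "(bool \<Rightarrow> nat \<Rightarrow> int) \<Rightarrow> nat \<Rightarrow> nat \<Rightarrow> bool" where
  "hosts c n K \<longleftrightarrow> (\<exists>w Z. valid_word letter_init letter_next w \<and> length w = K \<and>
     realizes letter_rule c Z w \<and> (\<forall>i<K. Z i < n))"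

lemma sg_less_iff: "sg s * x < sg s * y \<longleftrightarrow> (if s then x < y else y < x)"
  by (simp add: sg_def)

lemma sg_eq_iff: "sg s * x = sg s * y \<longleftrightarrow> x = y"
  by (simp add: sg_def)

text \<open>\<open>view\<close> applies the symmetry named by the three flags, and attaching these
  flags to every letter undoes it.\<close>

lemma hosts_base:
  assumes w: "valid_word base_init base_next w" "K \<le> length w"
    and real: "realizes base_rule (view c sw px py) Z w" and Z: "\<And>i. i < length w \<Longrightarrow> Z i < n"
  shows "hosts c n K"
proof -
  let ?g = "(sw, px, py)"
  let ?w = "map (Pair ?g) (take K w)"
  have "valid_word letter_init letter_next ?w"
    using w unfolding valid_word_nth by auto
  moreover have "length ?w = K" using w by simp
  moreover have "realizes letter_rule c Z ?w"
    unfolding realizes_def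
  proof (intro allI impI)
    fix i j a assume ij: "i < j" "j < length ?w"
    have *: "view c sw px py (a \<noteq> sw) (Z i) \<noteq> view c sw px py (a \<noteq> sw) (Z j) \<and>
        (view c sw px py (a \<noteq> sw) (Z i) < view c sw px py (a \<noteq> sw) (Z j) \<longleftrightarrow>
         base_rule (w ! i) (w ! j) (j = Suc i) (a \<noteq> sw))"
      using real[unfolded realizes_def, rule_format, of i j "a \<noteq> sw"] ij by simp
    have a: "((a \<noteq> sw) \<noteq> sw) = a" by auto
    have v: "view c sw px py (a \<noteq> sw) z = sg (if a \<noteq> sw then py else px) * c a z" for z
      unfolding view_def a ..
    have lr: "letter_rule (?w ! i) (?w ! j) (j = Suc i) a =
        (base_rule (w ! i) (w ! j) (j = Suc i) (a \<noteq> sw) \<longleftrightarrow> (if a \<noteq> sw then py else px))"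
      using ij by simp
    show "c a (Z i) \<noteq> c a (Z j) \<and> (c a (Z i) < c a (Z j)) = letter_rule (?w ! i) (?w ! j) (j = Suc i) a"
      using * unfolding lr v sg_less_iff sg_eq_iff by (auto split: if_splits)
  qed
  ultimately show ?thesis unfolding hosts_def using Z w(2) by (intro exI[of _ ?w] exI[of _ Z]) auto
qed

section \<open>Monotone subsequences, alternations and wedges\<close>

text \<open>The Erdos-Szekeres principle, from Ramsey's theorem for the graph whose edges are the
  ascending pairs.\<close>

lemma monotone_subset:
  "\<exists>r. \<forall>V (g :: nat \<Rightarrow> int). finite V \<longrightarrow> r \<le> card V \<longrightarrow> inj_on g V \<longrightarrow>
    (\<exists>R\<subseteq>V. card R = m \<and> ((\<forall>i\<in>R. \<forall>j\<in>R. i < j \<longrightarrow> g i < g j) \<or> (\<forall>i\<in>R. \<forall>j\<in>R. i < j \<longrightarrow> g j < g i)))"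
proof -
  obtain r where r: "\<And>(V :: nat set) E. finite V \<Longrightarrow> r \<le> card V \<Longrightarrow>
      \<exists>R\<subseteq>V. card R = m \<and> clique R E \<or> card R = m \<and> indep R E"
    using ramsey2[of m m] by metis
  show ?thesis
  proof (intro exI[of _ r] allI impI)
    fix V :: "nat set" and g :: "nat \<Rightarrow> int"
    assume V: "finite V" "r \<le> card V" "inj_on g V"
    define E where "E = {{i, j} | i j. i < j \<and> g i < g j}"
    have E: "{i, j} \<in> E \<longleftrightarrow> g i < g j" if "i < j" for i j
      using that unfolding E_def by (auto simp: doubleton_eq_iff)
    obtain R where R: "R \<subseteq> V" "card R = m" "clique R E \<or> indep R E"
      using r[OF V(1,2), of E] by blast
    have ne: "g i \<noteq> g j" if "i \<in> R" "j \<in> R" "i < j" for i j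
    proof
      assume "g i = g j"
      moreover have "i \<in> V" "j \<in> V" using R(1) that by blast+
      ultimately have "i = j" by (rule inj_onD[OF V(3)])
      then show False using that(3) by simp
    qed
    have mem: "{i, j} \<in> E" if "clique R E" "i \<in> R" "j \<in> R" "i < j" for i j
      using that(1)[unfolded clique_def, rule_format, OF that(2,3) less_imp_neq[OF that(4)]] .
    have nmem: "{i, j} \<notin> E" if "indep R E" "i \<in> R" "j \<in> R" "i < j" for i j
      using that(1)[unfolded indep_def, rule_format, OF that(2,3) less_imp_neq[OF that(4)]] .
    have "(\<forall>i\<in>R. \<forall>j\<in>R. i < j \<longrightarrow> g i < g j) \<or> (\<forall>i\<in>R. \<forall>j\<in>R. i < j \<longrightarrow> g j < g i)"
      using R(3)
    proof
      assume "clique R E"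
      then show ?thesis using mem E by meson
    next
      assume "indep R E"
      then have "\<not> g i < g j" if "i \<in> R" "j \<in> R" "i < j" for i j using nmem[OF \<open>indep R E\<close> that] E[OF that(3)] by simp
      then have "g j < g i" if "i \<in> R" "j \<in> R" "i < j" for i j
        using ne[OF that] that by (meson linorder_neqE)
      then show ?thesis by blast
    qed
    then show "\<exists>R\<subseteq>V. card R = m \<and> ((\<forall>i\<in>R. \<forall>j\<in>R. i < j \<longrightarrow> g i < g j) \<or> (\<forall>i\<in>R. \<forall>j\<in>R. i < j \<longrightarrow> g j < g i))"
      using R by blast
  qed
qed

lemma valid_par_word: "valid_word base_init base_next (map (\<lambda>i. Par (even i)) [0..<m])"
  unfolding valid_word_nth by auto

lemma realizes_par:
  assumes x: "\<And>i. i < m \<Longrightarrow> d False (h i) < d False (l i)"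
      "\<And>i j. i < j \<Longrightarrow> j < m \<Longrightarrow> d False (l i) < d False (h j)"
    and y: "\<And>i j. i < m \<Longrightarrow> j < m \<Longrightarrow> d True (l i) < d True (h j)"
      "\<And>i j. i < j \<Longrightarrow> j < m \<Longrightarrow> d True (h i) < d True (h j)"
      "\<And>i j. i < j \<Longrightarrow> j < m \<Longrightarrow> d True (l i) < d True (l j)"
  shows "realizes base_rule d (\<lambda>i. if even i then h (i div 2) else l (i div 2))
    (map (\<lambda>i. Par (even i)) [0..<2 * m])"
proof -
  have xh: "d False (h i) < d False (h j)" "d False (l i) < d False (l j)" if "i < j" "j < m" for i j
    using x(1)[of i] x(1)[of j] x(2)[OF that] that by auto
  show ?thesis
    unfolding realizes_def
  proof (intro allI impI)
    fix i j a assume "i < j" "j < length (map (\<lambda>i. Par (even i)) [0..<2 * m])"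
    then have ij: "i < j" "j < 2 * m" by auto
    define i' j' where ij': "i' = i div 2" "j' = j div 2"
    have j'm: "j' < m" using ij ij' by auto
    have le: "i' \<le> j'" using ij ij' by (simp add: div_le_mono)
    have same: "even i" "odd j" if "i' = j'"
      using that ij(1) unfolding ij' by presburger+
    let ?Z = "\<lambda>i. if even i then h (i div 2) else l (i div 2)"
    have "(if a then if even j \<or> odd i then d a (?Z i) < d a (?Z j) else d a (?Z j) < d a (?Z i)
        else d a (?Z i) < d a (?Z j))"
    proof (cases "i' = j'")
      case True
      then show ?thesis using same[OF True] x(1)[OF j'm] y(1)[OF j'm j'm] ij' by (cases a) auto
    next
      case False
      then have lt: "i' < j'" using le by simp
      then have i'm: "i' < m" using j'm by simp
      show ?thesis
        using xh[OF lt j'm] x(2)[OF lt j'm] x(1)[OF i'm] x(1)[OF j'm] y(1)[OF i'm j'm] y(1)[OF j'm i'm]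
          y(2,3)[OF lt j'm] unfolding ij' by (cases a; cases "even i"; cases "even j") auto
    qed
    moreover have "base_rule (map (\<lambda>i. Par (even i)) [0..<2 * m] ! i) (map (\<lambda>i. Par (even i)) [0..<2 * m] ! j)
        (j = Suc i) a \<longleftrightarrow> (a \<longrightarrow> even j \<or> odd i)"
      using ij by auto
    ultimately show "d a (?Z i) \<noteq> d a (?Z j) \<and> (d a (?Z i) < d a (?Z j)) =
        base_rule (map (\<lambda>i. Par (even i)) [0..<2 * m] ! i) (map (\<lambda>i. Par (even i)) [0..<2 * m] ! j) (j = Suc i) a"
      by (auto split: if_splits)
  qed
qed

text \<open>The points are listed from the apex outwards with odd indices on the upper arm, so each
  is extreme in height among those so far.\<close>

definition wedge :: "(bool \<Rightarrow> nat \<Rightarrow> int) \<Rightarrow> nat \<Rightarrow> (nat \<Rightarrow> nat) \<Rightarrow> nat \<Rightarrow> bool" where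
  "wedge d n w M \<longleftrightarrow> (\<forall>i<M. w i < n) \<and> (\<forall>i j. i < j \<longrightarrow> j < M \<longrightarrow> d False (w i) < d False (w j) \<and>
     (if odd j then d True (w i) < d True (w j) else d True (w j) < d True (w i)))"

lemma wedgeI:
  assumes n: "\<And>i. i < m \<Longrightarrow> l i < n \<and> h i < n"
    and x: "\<And>i. i < m \<Longrightarrow> d False (l i) < d False (h i)"
      "\<And>i j. i < j \<Longrightarrow> j < m \<Longrightarrow> d False (h i) < d False (l j)"
    and y: "\<And>i j. i < m \<Longrightarrow> j < m \<Longrightarrow> d True (l i) < d True (h j)"
      "\<And>i j. i < j \<Longrightarrow> j < m \<Longrightarrow> d True (h i) < d True (h j)"
      "\<And>i j. i < j \<Longrightarrow> j < m \<Longrightarrow> d True (l j) < d True (l i)"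
  shows "wedge d n (\<lambda>i. if even i then l (i div 2) else h (i div 2)) (2 * m)"
proof -
  have xh: "d False (h i) < d False (h j)" "d False (l i) < d False (l j)" if "i < j" "j < m" for i j
    using x(1)[of i] x(1)[of j] x(2)[OF that] that by auto
  show ?thesis
    unfolding wedge_def
  proof (intro conjI allI impI)
    fix i assume "i < 2 * m"
    then have "i div 2 < m" by auto
    then show "(if even i then l (i div 2) else h (i div 2)) < n" using n by auto
  next
    fix i j assume ij: "i < j" "j < 2 * m"
    define i' j' where ij': "i' = i div 2" "j' = j div 2"
    have j'm: "j' < m" using ij ij' by auto
    have le: "i' \<le> j'" using ij ij' by (simp add: div_le_mono)
    have same: "even i" "odd j" if "i' = j'"
      using that ij(1) unfolding ij' by presburger+
    let ?w = "\<lambda>i. if even i then l (i div 2) else h (i div 2)"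
    have "d False (?w i) < d False (?w j) \<and>
      (if odd j then d True (?w i) < d True (?w j) else d True (?w j) < d True (?w i))"
    proof (cases "i' = j'")
      case True
      then show ?thesis using same[OF True] x(1)[OF j'm] y(1)[OF j'm j'm] ij' by auto
    next
      case False
      then have lt: "i' < j'" using le by simp
      then have i'm: "i' < m" using j'm by simp
      show ?thesis
        using xh[OF lt j'm] x(2)[OF lt j'm] x(1)[OF i'm] x(1)[OF j'm] y(1)[OF i'm j'm] y(1)[OF j'm i'm]
          y(2,3)[OF lt j'm] unfolding ij' by (cases "even i"; cases "even j") auto
    qed
    then show "d False (?w i) < d False (?w j)"
      "if odd j then d True (?w i) < d True (?w j) else d True (?w j) < d True (?w i)" by blast+
  qed
qed

definition wedge_word :: "bool \<Rightarrow> bool \<Rightarrow> nat \<Rightarrow> base list" where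
  "wedge_word k Q m = WP k # map (\<lambda>i. W k (i = 0) (odd i = Q)) [0..<m]"

lemma valid_wedge_word: "valid_word base_init base_next (wedge_word k Q m)"
  unfolding valid_word_nth
proof (intro conjI allI impI)
  show "base_init (wedge_word k Q m ! 0)" by (simp add: wedge_word_def)
  fix i assume "i < length (wedge_word k Q m)" "Suc i < length (wedge_word k Q m)"
  then show "base_next (wedge_word k Q m ! i) (wedge_word k Q m ! Suc i)"
    by (cases i) (auto simp: wedge_word_def)
qed

lemma realizes_wedge_word:
  assumes x: "\<And>i j. i < j \<Longrightarrow> j < m \<Longrightarrow> d False (V i) < d False (V j)"
    and y: "\<And>i j. i < j \<Longrightarrow> j < m \<Longrightarrow>
      if odd j = Q then d True (V i) < d True (V j) else d True (V j) < d True (V i)"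
    and middle: "\<And>i. \<not> k \<Longrightarrow> i < m \<Longrightarrow> d False (V i) < d False z \<and>
      (if odd i = Q then d True z < d True (V i) else d True (V i) < d True z)"
    and corner: "\<And>i. k \<Longrightarrow> i < m \<Longrightarrow> d True (V i) < d True z \<and>
      (if i = 0 then d False (V i) < d False z else d False z < d False (V i))"
  shows "realizes base_rule d (case_nat z V) (wedge_word k Q m)"
  unfolding realizes_def
proof (intro allI impI)
  fix i j' a assume ij: "i < j'" "j' < length (wedge_word k Q m)"
  then obtain j where j: "j' = Suc j" "j < m" by (cases j') (auto simp: wedge_word_def)
  have wj: "wedge_word k Q m ! j' = W k (j = 0) (odd j = Q)" using j by (simp add: wedge_word_def)
  show "d a (case_nat z V i) \<noteq> d a (case_nat z V j') \<and>
    (d a (case_nat z V i) < d a (case_nat z V j')) =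
      base_rule (wedge_word k Q m ! i) (wedge_word k Q m ! j') (j' = Suc i) a"
  proof (cases i)
    case 0
    then have wi: "wedge_word k Q m ! i = WP k" by (simp add: wedge_word_def)
    show ?thesis using middle[of j] corner[of j] j 0 unfolding wj wi
      by (cases k; cases a) (auto split: if_splits)
  next
    case (Suc i')
    then have i': "i' < j" using ij j by simp
    have wi: "wedge_word k Q m ! i = W k (i' = 0) (odd i' = Q)"
      using i' j Suc by (simp add: wedge_word_def)
    show ?thesis using x[OF i' j(2)] y[OF i' j(2)] j Suc unfolding wj wi
      by (cases a) (auto split: if_splits)
  qed
qed

section \<open>Pin sequences leaving a wedge\<close>

text \<open>For even \<open>m\<close> the points \<open>w m\<close> and \<open>w (Suc m)\<close> lie
  on the lower and the upper arm. A confined point is left of all wedge points from \<open>m\<close>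
  on and between their arms, and raising \<open>m\<close> only relaxes the condition.\<close>

definition confined :: "(bool \<Rightarrow> nat \<Rightarrow> int) \<Rightarrow> (nat \<Rightarrow> nat) \<Rightarrow> nat \<Rightarrow> nat \<Rightarrow> bool" where
  "confined d w m z \<longleftrightarrow> d False z < d False (w m) \<and> d True (w m) < d True z \<and> d True z < d True (w (Suc m))"

lemma wedge_less:
  assumes "wedge d n w M" "i < j" "j < M"
  shows "d False (w i) < d False (w j)" "odd j \<Longrightarrow> d True (w i) < d True (w j)"
    "even j \<Longrightarrow> d True (w j) < d True (w i)"
  using assms unfolding wedge_def by presburger+

lemma confined_mono:
  assumes w: "wedge d n w M" and m: "even m" "even m'" "m \<le> m'" "Suc m' < M" and z: "confined d w m z"
  shows "confined d w m' z"
proof (cases "m = m'")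
  case False
  then have lt: "m < m'" using m by simp
  then show ?thesis
    using z wedge_less[OF w lt] wedge_less[OF w, of "Suc m" "Suc m'"] m unfolding confined_def by auto
qed (use z in simp)

text \<open>If \<open>z\<close> cuts \<open>P\<close> vertically, its height is between the arms, so
  it can escape only to the right of the \<open>2 * L\<close> wedge points passed over: the word
  with \<open>WP False\<close>. If it cuts \<open>P\<close> horizontally, it stays left of
  \<open>w m\<close> and can escape only above or below those points: the word with
  \<open>WP True\<close>.\<close>

lemma wedge_jump:
  fixes c sw px py
  defines "d \<equiv> view c sw px py"
  assumes w: "wedge d n w M" and m: "even m" "Suc (m + 2 * L) < M"
    and P: "P \<subseteq> {..<n}" "\<And>x. x \<in> P \<Longrightarrow> confined d w m x" and z: "z < n" "cut d e z P"
  shows "confined d w (m + 2 * L) z \<or> hosts c n (2 * L)"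
proof (rule disjCI)
  assume nhosts: "\<not> hosts c n (2 * L)"
  let ?m = "m + 2 * L"
  obtain p q where pq: "p \<in> P" "q \<in> P" "d e p < d e z" "d e z < d e q"
    using z(2) unfolding cut_def by blast
  have conf: "confined d w m p" "confined d w m q" using P(2) pq by auto
  note less = wedge_less[OF w]
  have mono_x: "d False (w m) \<le> d False (w j)" if "m \<le> j" "j < M" for j
    using less(1)[of m j] that by (cases "m = j") auto
  have down: "d True (w (m + i)) \<le> d True (w m)" if "even i" "m + i < M" for i
    using less(3)[of m "m + i"] that m by (cases "i = 0") auto
  have up: "d True (w (Suc m)) \<le> d True (w (m + i))" if "odd i" "m + i < M" for i
  proof -
    have "i = 1 \<or> Suc m < m + i" using that(1) by (cases i) auto
    then show ?thesis using less(2)[of "Suc m" "m + i"] that m by auto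
  qed
  have wn: "w i < n" if "i < M" for i using w that unfolding wedge_def by blast
  have yz: "d True (w ?m) < d True z" "d True z < d True (w (Suc ?m))"
    if e using that conf pq down[of "2 * L"] up[of "Suc (2 * L)"] m unfolding confined_def
    by (cases e; simp)+
  show "confined d w ?m z"
  proof (cases e)
    case True
    have "d False z < d False (w ?m)"
    proof (rule ccontr)
      assume nz: "\<not> ?thesis"
      have "realizes base_rule d (case_nat z (\<lambda>i. w (m + i))) (wedge_word False True (2 * L))"
      proof (rule realizes_wedge_word)
        show "d False (w (m + i)) < d False (w (m + j))" if "i < j" "j < 2 * L" for i j
          using less(1)[of "m + i" "m + j"] that m by simp
        show "if odd j = True then d True (w (m + i)) < d True (w (m + j))
            else d True (w (m + j)) < d True (w (m + i))" if "i < j" "j < 2 * L" for i j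
          using less(2,3)[of "m + i" "m + j"] that m by simp
        show "d False (w (m + i)) < d False z \<and>
          (if odd i = True then d True z < d True (w (m + i)) else d True (w (m + i)) < d True z)"
          if "i < 2 * L" for i
          using less(1)[of "m + i" ?m] nz up[of i] down[of i] that m conf pq True
          unfolding confined_def by auto
      qed simp
      then have "hosts c n (2 * L)"
        unfolding d_def by (rule hosts_base[rotated 2, OF _ _ valid_wedge_word])
          (use wn m z in \<open>auto simp: wedge_word_def split: nat.split\<close>)
      then show False using nhosts by simp
    qed
    then show ?thesis using yz True unfolding confined_def by simp
  next
    case False
    have xz: "d False p < d False z" "d False z < d False (w m)"
      using pq conf False unfolding confined_def by auto
    \<comment> \<open>The member of \<open>P\<close> to the left of \<open>z\<close> serves as the
      apex, since \<open>z\<close> is right of it and left of all the wedge points used.\<close>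
    define V where "V = case_nat p (\<lambda>i. w (m + i))"
    have V: "V 0 = p" "\<And>i. V (Suc i) = w (m + i)" by (simp_all add: V_def)
    have Vx: "d False (V i) < d False (V j)" if "i < j" "j < 2 * L" for i j
    proof -
      obtain j' where j': "j = Suc j'" using \<open>i < j\<close> by (cases j) auto
      show ?thesis
      proof (cases i)
        case 0
        then show ?thesis using xz mono_x[of "m + j'"] that m j' by (simp add: V)
      next
        case (Suc i')
        then show ?thesis using less(1)[of "m + i'" "m + j'"] that m j' by (simp add: V)
      qed
    qed
    have Vy: "if odd j then d True (V j) < d True (V i) else d True (V i) < d True (V j)"
      if "i < j" "j < 2 * L" for i j
    proof -
      obtain j' where j': "j = Suc j'" using \<open>i < j\<close> by (cases j) auto
      show ?thesis
      proof (cases i)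
        case 0
        then show ?thesis using conf(1) up[of j'] down[of j'] that m j' unfolding confined_def
          by (auto simp: V)
      next
        case (Suc i')
        then show ?thesis using less(2,3)[of "m + i'" "m + j'"] that m j' by (simp add: V)
      qed
    qed
    have Vz: "if i = 0 then d False (V i) < d False z else d False z < d False (V i)" if "i < 2 * L" for i
      using xz mono_x[of "m + (i - 1)"] that m by (cases i) (auto simp: V)
    have Vn: "case_nat z V i < n" if "i < length (wedge_word True Q (2 * L))" for i Q
      using that z(1) pq(1) P(1) wn m by (auto simp: wedge_word_def V_def split: nat.split)
    have "d True (w ?m) < d True z"
    proof (rule ccontr)
      assume nz: "\<not> ?thesis"
      have low: "d True z < d True (V i)" if i: "i < 2 * L" for i
      proof (cases i)
        case 0
        then show ?thesis using nz down[of "2 * L"] conf(1) m unfolding confined_def by (simp add: V)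
      next
        case (Suc i')
        then show ?thesis using nz less(3)[of "m + i'" ?m] i m by (simp add: V)
      qed
      \<comment> \<open>A point escaping below is brought above by a reflection. Prepending
        \<open>p\<close> has put the odd indices of \<open>V\<close> on the lower arm; the
        reflection makes that arm upper, hence \<open>Q\<close> is \<open>True\<close> here and
        \<open>False\<close> for a point escaping above.\<close>
      have flip: "view c sw px (\<not> py) False z = d False z" "view c sw px (\<not> py) True z = - d True z" for z
        unfolding d_def view_def by (simp_all add: sg_def)
      have "realizes base_rule (view c sw px (\<not> py)) (case_nat z V) (wedge_word True True (2 * L))"
        using Vx Vy Vz low by (intro realizes_wedge_word) (auto simp: flip)
      then have "hosts c n (2 * L)"
        by (rule hosts_base[rotated 2, OF _ _ valid_wedge_word]) (use Vn in \<open>auto simp: wedge_word_def\<close>)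
      then show False using nhosts by simp
    qed
    moreover have "d True z < d True (w (Suc ?m))"
    proof (rule ccontr)
      assume nz: "\<not> ?thesis"
      have high: "d True (V i) < d True z" if i: "i < 2 * L" for i
      proof (cases i)
        case 0
        then show ?thesis using nz up[of "Suc (2 * L)"] conf(1) m unfolding confined_def by (simp add: V)
      next
        case (Suc i')
        then show ?thesis using nz less(2)[of "m + i'" "Suc ?m"] i m by (simp add: V)
      qed
      have "realizes base_rule d (case_nat z V) (wedge_word True False (2 * L))"
        using Vx Vy Vz high by (intro realizes_wedge_word) auto
      then have "hosts c n (2 * L)"
        unfolding d_def by (rule hosts_base[rotated 2, OF _ _ valid_wedge_word])
          (use Vn in \<open>auto simp: wedge_word_def\<close>)
      then show False using nhosts by simp
    qed
    moreover have "d False z < d False (w ?m)" using xz mono_x[of ?m] m by simp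
    ultimately show ?thesis unfolding confined_def by simp
  qed
qed

context prime_points
begin

text \<open>The confinement index is 2 for the first two wedge points and grows by
  \<open>2 * L\<close> with every pin, whereas the target \<open>w ?T\<close> is confined at no
  index up to \<open>?T\<close>. Fewer than \<open>k\<close> entries cannot bridge this
  distance.\<close>

lemma wedge_long_pinseq_or_hosts:
  assumes w: "wedge (view c sw px py) n w M" and M: "2 + k * (2 * L) + 2 < M"
  shows "(\<exists>q. pinseq c q \<and> set q \<subseteq> {..<n} \<and> k \<le> length q) \<or> hosts c n (2 * L)"
proof (rule ccontr)
  assume no: "\<not> ?thesis"
  let ?d = "view c sw px py"
  let ?T = "2 + k * (2 * L)"
  note less = wedge_less[OF w]
  have wn: "w i < n" if "i < M" for i using w that unfolding wedge_def by blast
  have ne: "w i \<noteq> w j" if "i < j" "j < M" for i j using less(1)[OF that] by auto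
  obtain q where q: "pinseq c q" "set q \<subseteq> {..<n}" "q ! 0 = w 0" "q ! 1 = w 1" "last q = w ?T"
    using reach[of "w 0" "w 1" "w ?T"] wn ne[of 0 1] ne[of 0 ?T] M by fastforce
  have len: "2 \<le> length q" using q(1) by (simp add: pinseq_def)
  have short: "length q < k" using q(1,2) no by (meson not_le)
  note len = len short
  have cut_view: "cut c a z P = cut ?d (a \<noteq> sw) z P" for a z P
  proof -
    have "((a \<noteq> sw) \<noteq> sw) = a" by auto
    then show ?thesis unfolding cut_def view_def by (auto simp: sg_def)
  qed
  have bound: "j * (2 * L) \<le> k * (2 * L)" if "j \<le> k" for j using that by simp
  have "\<forall>z\<in>set (take (2 + j) q). confined ?d w (2 + j * (2 * L)) z" if "2 + j \<le> length q" for j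
    using that
  proof (induction j)
    case 0
    have "take 2 q = [w 0, w 1]" using q(3,4) len(1) by (cases q; cases "tl q") auto
    moreover have "confined ?d w 2 (w 0)" "confined ?d w 2 (w 1)"
      unfolding confined_def using less(1)[of 0 2] less(1)[of 1 2] less(3)[of 0 2] less(3)[of 1 2]
        less(2)[of 0 "Suc 2"] less(2)[of 1 "Suc 2"] M by simp_all
    ultimately show ?case by simp
  next
    case (Suc j)
    let ?P = "set (take (2 + j) q)"
    have conf: "\<And>z. z \<in> ?P \<Longrightarrow> confined ?d w (2 + j * (2 * L)) z" using Suc by simp
    have idx: "Suc (2 + j * (2 * L) + 2 * L) < M" using bound[of "Suc j"] Suc.prems len M by simp
    have take: "set (take (2 + Suc j) q) = insert (q ! (2 + j)) ?P"
      using take_Suc_conv_app_nth[of "2 + j" q] Suc.prems by simp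
    obtain a where "cut c a (q ! (2 + j)) ?P"
      using q(1) Suc.prems unfolding pinseq_def by (metis Suc_le_eq add_Suc_right le_add1)
    then have cut: "cut ?d (a \<noteq> sw) (q ! (2 + j)) ?P" using cut_view by simp
    have "q ! (2 + j) < n" using subsetD[OF q(2) nth_mem[of "2 + j"]] Suc.prems by simp
    moreover have "?P \<subseteq> {..<n}" using q(2) set_take_subset by fast
    ultimately have "confined ?d w (2 + j * (2 * L) + 2 * L) (q ! (2 + j)) \<or> hosts c n (2 * L)"
      using wedge_jump[OF w _ idx _ conf _ cut] by simp
    then have c1: "confined ?d w (2 + j * (2 * L) + 2 * L) (q ! (2 + j))" using no by simp
    have c2: "confined ?d w (2 + j * (2 * L) + 2 * L) z" if "z \<in> ?P" for z
      using confined_mono[OF w _ _ _ idx conf[OF that]] by simp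
    have eq: "2 + Suc j * (2 * L) = 2 + j * (2 * L) + 2 * L" by simp
    show ?case unfolding take eq using c1 c2 by blast
  qed
  from this[of "length q - 2"] have all: "\<forall>z\<in>set q. confined ?d w (2 + (length q - 2) * (2 * L)) z"
    using len(1) by simp
  have "q \<noteq> []" using len(1) by auto
  then have "last q \<in> set q" by (rule last_in_set)
  define T where "T = 2 + (length q - 2) * (2 * L)"
  have "confined ?d w T (w ?T)" using all \<open>last q \<in> set q\<close> q(5) unfolding T_def by metis
  then have "?d False (w ?T) < ?d False (w T)" unfolding confined_def by blast
  moreover have "length q - 2 \<le> k" using len by arith
  then have "T \<le> ?T" unfolding T_def by (rule add_left_mono[OF bound])
  then have "T = ?T \<or> T < ?T" by (rule order.order_iff_strict[THEN iffD1, THEN disj_commute[THEN iffD1]])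
  moreover have "?T < M" using M by linarith
  ultimately show False using less(1)[of T ?T] by (metis less_asym less_irrefl)
qed

section \<open>Words of pins inside pin sequences\<close>

text \<open>Entry 0 plays the origin and entries 1 and 2 are dropped. From entry 3 on a pin has a
  well-defined direction, and since the predecessor of entry 3 is dropped, the first listed pin
  separates nothing, in accordance with \<open>Org\<close>.\<close>

lemma pinseq_hosts:
  assumes q: "pinseq c q" "set q \<subseteq> {..<n}" and len: "K + 3 \<le> length q"
  shows "hosts c n K"
proof -
  have qn: "q ! j < n" if "j < length q" for j using subsetD[OF q(2) nth_mem[OF that]] by simp
  have takeI: "q ! i \<in> set (take j q)" if "i < j" "j \<le> length q" for i j
    using that nth_mem[of i "take j q"] by simp
  have "\<exists>as. splits c (fst as) (snd as) (q ! j) (q ! (j - 1)) (set (take (j - 1) q))"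
    if "2 \<le> j" "j < length q" for j
    using pinseq_splits[OF q that] by auto
  then obtain as where as: "\<And>j. 2 \<le> j \<Longrightarrow> j < length q \<Longrightarrow>
      splits c (fst (as j)) (snd (as j)) (q ! j) (q ! (j - 1)) (set (take (j - 1) q))"
    by metis
  define b where "b j = fst (as j)" for j
  define r where "r j = snd (as j)" for j
  have cross: "sg (r j) * c (b j) (q ! i) < sg (r j) * c (b j) (q ! j)"
    "sg (r j) * c (b j) (q ! j) < sg (r j) * c (b j) (q ! (j - 1))"
    if "2 \<le> j" "j < length q" "i < j - 1" for i j
    using as[OF that(1,2)] takeI[of i "j - 1"] that unfolding splits_def b_def r_def by auto
  \<comment> \<open>A pin cutting along both axes would leave its predecessor extreme along both.
    The predecessor, having index at least 2, itself cuts the entries before it.\<close>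
  have not_cut: "\<not> cut c (\<not> b j) (q ! j) (set (take j q))" if j: "3 \<le> j" "j < length q" for j
  proof
    assume cut: "cut c (\<not> b j) (q ! j) (set (take j q))"
    have take: "set (take j q) = insert (q ! (j - 1)) (set (take (j - 1) q))"
      using take_Suc_conv_app_nth[of "j - 1" q] j by simp
    have ncut: "\<not> cut c a (q ! j) (set (take (j - 1) q))" for a
      using q(1) j unfolding pinseq_def by auto
    have nmem: "q ! j \<notin> set (take (j - 1) q)"
      using q(1) j unfolding pinseq_def by (auto simp: in_set_conv_nth nth_eq_iff_index_eq)
    have sub: "set (take (j - 1) q) \<subseteq> {..<n}" using q(2) set_take_subset by fast
    obtain s where s: "splits c (\<not> b j) s (q ! j) (q ! (j - 1)) (set (take (j - 1) q))"
      using cut_insert_splits[OF cut[unfolded take] ncut] distinct_coord[OF sub qn[OF j(2)] nmem] by blast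
    have extreme: "\<exists>s. \<forall>x\<in>set (take (j - 1) q). sg s * c a x < sg s * c a (q ! (j - 1))" for a
    proof (cases "a = b j")
      case True
      have "splits c a (r j) (q ! j) (q ! (j - 1)) (set (take (j - 1) q))"
        using as[of j] j True unfolding b_def r_def by simp
      then show ?thesis unfolding splits_def by (meson order.strict_trans)
    next
      case False
      then have "a = (\<not> b j)" by auto
      then show ?thesis using s unfolding splits_def by (meson order.strict_trans)
    qed
    obtain a where "cut c a (q ! (j - 1)) (set (take (j - 1) q))"
      using q(1) less_imp_diff_less[OF j(2), of 1] j(1) unfolding pinseq_def by force
    moreover obtain s where "\<forall>x\<in>set (take (j - 1) q). sg s * c a x < sg s * c a (q ! (j - 1))"
      using extreme by blast
    ultimately show False unfolding cut_def by (cases s) (auto simp: sg_def)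
  qed
  have side: "\<exists>s. \<forall>x\<in>set (take j q). sg s * c (\<not> b j) x < sg s * c (\<not> b j) (q ! j)"
    if j: "3 \<le> j" "j < length q" for j
  proof (rule not_cut_side[OF not_cut[OF j]])
    have "q ! j \<notin> set (take j q)"
      using q(1) j unfolding pinseq_def by (auto simp: in_set_conv_nth nth_eq_iff_index_eq)
    then show "c (\<not> b j) x \<noteq> c (\<not> b j) (q ! j)" if "x \<in> set (take j q)" for x
      using distinct_coord[OF _ qn[OF j(2)] _ that] q(2) set_take_subset by fast
  qed
  define t where "t j = (SOME s. \<forall>x\<in>set (take j q). sg s * c (\<not> b j) x < sg s * c (\<not> b j) (q ! j))" for j
  have main: "sg (t j) * c (\<not> b j) (q ! i) < sg (t j) * c (\<not> b j) (q ! j)"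
    if "3 \<le> j" "j < length q" "i < j" for i j
    using someI_ex[OF side[OF that(1,2)]] takeI[of i j] that unfolding t_def by simp
  \<comment> \<open>The next pin needs its predecessor \<open>j\<close> to be extreme along its
    splitting axis. Along \<open>b j\<close> pin \<open>j\<close> lies strictly between earlier
    entries, so the axes alternate and the side is the direction of pin \<open>j\<close>.\<close>
  have next_pin: "b (Suc j) = (\<not> b j)" "r (Suc j) = t j" if j: "3 \<le> j" "Suc j < length q" for j
  proof -
    have "sg (r (Suc j)) * c (b (Suc j)) (q ! i) < sg (r (Suc j)) * c (b (Suc j)) (q ! j)" if "i < j" for i
      using cross[of "Suc j" i] j that by auto
    note beyond = this[of 0] this[of "j - 1"]
    show eq: "b (Suc j) = (\<not> b j)"
    proof (rule ccontr)
      assume "b (Suc j) \<noteq> (\<not> b j)"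
      then have "b (Suc j) = b j" by auto
      then show False using beyond cross[of j 0] j
        by (cases "r j"; cases "r (Suc j)") (auto simp: sg_def)
    qed
    show "r (Suc j) = t j"
      using beyond(1) main[of j 0] j unfolding eq by (cases "r (Suc j)"; cases "t j") (auto simp: sg_def)
  qed
  let ?w = "Org # map (\<lambda>i. Pin (\<not> b (i + 3)) (r (i + 3)) (t (i + 3))) [0..<K]"
  let ?Z = "case_nat (q ! 0) (\<lambda>i. q ! (i + 3))"
  have view: "view c False True True = c" by (simp add: view_def fun_eq_iff sg_def)
  have "valid_word base_init base_next ?w"
    unfolding valid_word_nth
  proof (intro conjI allI impI)
    fix i assume "i < length ?w" "Suc i < length ?w"
    then show "base_next (?w ! i) (?w ! Suc i)"
      using next_pin[of "i - 1 + 3"] len by (cases i) auto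
  qed simp
  moreover have "realizes base_rule (view c False True True) ?Z ?w"
    unfolding realizes_def view
  proof (intro allI impI)
    fix i j' a assume ij: "i < j'" "j' < length ?w"
    then obtain j where j: "j' = Suc j" "j < K" by (cases j') auto
    have wj: "?w ! j' = Pin (\<not> b (j + 3)) (r (j + 3)) (t (j + 3))" using j by simp
    have Zj: "?Z j' = q ! (j + 3)" using j by simp
    have jq: "3 \<le> j + 3" "2 \<le> j + 3" "j + 3 < length q" using j len by auto
    define i' where "i' = (case i of 0 \<Rightarrow> 0 | Suc i \<Rightarrow> i + 3)"
    have Zi: "?Z i = q ! i'" unfolding i'_def by (cases i) auto
    have i'j: "i' < j + 3" using ij j unfolding i'_def by (cases i) auto
    have adj: "i' = j + 3 - 1 \<longleftrightarrow> j' = Suc i \<and> i \<noteq> 0" using ij j unfolding i'_def by (cases i) auto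
    have org: "?w ! i = Org \<longleftrightarrow> i = 0" using ij j by (cases i) auto
    show "c a (?Z i) \<noteq> c a (?Z j') \<and> (c a (?Z i) < c a (?Z j')) = base_rule (?w ! i) (?w ! j') (j' = Suc i) a"
    proof (cases "a = (\<not> b (j + 3))")
      case True
      then show ?thesis using main[OF jq(1,3) i'j] unfolding Zi Zj wj
        by (cases "t (j + 3)") (auto simp: sg_def)
    next
      case False
      then have a: "a = b (j + 3)" by auto
      show ?thesis
      proof (cases "i' = j + 3 - 1")
        case True
        then show ?thesis using cross(2)[OF jq(2,3), of 0] adj org a unfolding Zi Zj wj
          by (cases "r (j + 3)") (auto simp: sg_def)
      next
        case False
        then show ?thesis using cross(1)[OF jq(2,3), of i'] i'j adj org a unfolding Zi Zj wj
          by (cases "r (j + 3)") (auto simp: sg_def)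
      qed
    qed
  qed
  moreover have "q ! 0 < n" by (rule qn) (use len in linarith)
  then have "?Z i < n" if "i < length ?w" for i
    using that qn[of "i - 1 + 3"] len by (cases i) auto
  ultimately show ?thesis by (intro hosts_base[of ?w]) simp_all
qed

end

lemma hosts_mono:
  assumes "hosts c n K" "K' \<le> K" shows "hosts c n K'"
proof -
  obtain w Z where w: "valid_word letter_init letter_next w" "length w = K" "realizes letter_rule c Z w"
      "\<forall>i<K. Z i < n"
    using assms(1) unfolding hosts_def by blast
  have "valid_word letter_init letter_next (take K' w)"
    using w(1,2) assms(2) unfolding valid_word_nth by auto
  moreover have "realizes letter_rule c Z (take K' w)"
    using w(2,3) assms(2) unfolding realizes_def by auto
  ultimately show ?thesis
    unfolding hosts_def using w(2,4) assms(2) by (intro exI[of _ "take K' w"] exI[of _ Z]) auto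
qed

section \<open>Words in every large simple point set\<close>

definition monotone_upto :: "nat \<Rightarrow> (nat \<Rightarrow> int) \<Rightarrow> bool \<Rightarrow> bool" where
  "monotone_upto m g up \<longleftrightarrow> (\<forall>i j. i < j \<longrightarrow> j < m \<longrightarrow> (if up then g i < g j else g j < g i))"

definition monotone_alternation ::
  "(bool \<Rightarrow> nat \<Rightarrow> int) \<Rightarrow> nat \<Rightarrow> nat \<Rightarrow> (nat \<Rightarrow> nat) \<Rightarrow> (nat \<Rightarrow> nat) \<Rightarrow> bool \<Rightarrow> bool \<Rightarrow> bool" where
  "monotone_alternation d n m e f u v \<longleftrightarrow>
     (\<forall>i<m. e i < n \<and> f i < n) \<and>
     (\<forall>i<m. d False (e i) < d False (f i)) \<and>
     (\<forall>i j. i < j \<longrightarrow> j < m \<longrightarrow> d False (f i) < d False (e j)) \<and>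
     (\<forall>i<m. \<forall>j<m. d True (e i) < d True (f j)) \<and>
     monotone_upto m (\<lambda>i. d True (e i)) u \<and> monotone_upto m (\<lambda>i. d True (f i)) v"

text \<open>Two rounds of thinning: first the heights of \<open>e\<close>, then, among the surviving
  indices, those of \<open>f\<close>.\<close>

lemma ex_monotone_alternation:
  "\<exists>M. \<forall>c n. prime_points c n \<longrightarrow> alternation c n M \<longrightarrow> (\<exists>sw px py e f u v.
     monotone_alternation (view c sw px py) n m e f u v)"
proof -
  obtain r1 where r1: "\<And>V (g :: nat \<Rightarrow> int). finite V \<Longrightarrow> r1 \<le> card V \<Longrightarrow> inj_on g V \<Longrightarrow>
    \<exists>R\<subseteq>V. card R = m \<and> ((\<forall>i\<in>R. \<forall>j\<in>R. i < j \<longrightarrow> g i < g j) \<or> (\<forall>i\<in>R. \<forall>j\<in>R. i < j \<longrightarrow> g j < g i))"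
    using monotone_subset[of m] by metis
  obtain r2 where r2: "\<And>V (g :: nat \<Rightarrow> int). finite V \<Longrightarrow> r2 \<le> card V \<Longrightarrow> inj_on g V \<Longrightarrow>
    \<exists>R\<subseteq>V. card R = r1 \<and> ((\<forall>i\<in>R. \<forall>j\<in>R. i < j \<longrightarrow> g i < g j) \<or> (\<forall>i\<in>R. \<forall>j\<in>R. i < j \<longrightarrow> g j < g i))"
    using monotone_subset[of r1] by metis
  show ?thesis
  proof (intro exI[of _ r2] allI impI)
    fix c n assume "prime_points c n" and alt: "alternation c n r2"
    then interpret prime_points c n by simp
    obtain a s r l e f where ef: "\<And>i. i < r2 \<Longrightarrow> e i < n \<and> f i < n \<and> sg s * c a (e i) \<le> l \<and>
        l < sg s * c a (f i) \<and> sg r * c (\<not> a) (e i) < sg r * c (\<not> a) (f i)"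
      "\<And>i. Suc i < r2 \<Longrightarrow> sg r * c (\<not> a) (f i) < sg r * c (\<not> a) (e (Suc i))"
      using alt unfolding alternation_def by metis
    \<comment> \<open>This view makes the dividing line horizontal, with \<open>e\<close> below it
      and the indices increasing to the right.\<close>
    define d where "d = view c (\<not> a) r s"
    have axes: "(False \<noteq> (\<not> a)) = (\<not> a)" "(True \<noteq> (\<not> a)) = a" by auto
    have d: "d False z = sg r * c (\<not> a) z" "d True z = sg s * c a z" for z
      unfolding d_def view_def axes by simp_all
    have x1: "d False (e i) < d False (f i)" if "i < r2" for i using ef(1)[OF that] by (simp add: d)
    have x2: "d False (f i) < d False (e j)" if "i < j" "j < r2" for i j
      using that
    proof (induction j)
      case (Suc j)
      show ?case
      proof (cases "i = j")
        case True
        then show ?thesis using ef(2)[of j] Suc.prems by (simp add: d)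
      next
        case False
        then have "d False (f i) < d False (e j)" using Suc by simp
        also have "\<dots> < d False (f j)" using x1 Suc.prems by simp
        also have "\<dots> < d False (e (Suc j))" using ef(2)[of j] Suc.prems by (simp add: d)
        finally show ?thesis .
      qed
    qed simp
    have inj_d: "p = q" if "p < n" "q < n" "d True p = d True q" for p q
      using inj[of p q a] that unfolding d sg_eq_iff by simp
    have ne: "e i \<noteq> e j" "f i \<noteq> f j" if "i < j" "j < r2" for i j
      using x1[of i] x1[of j] x2[OF that] that by auto
    have inj_e: "inj_on (\<lambda>i. d True (e i)) {..<r2}"
    proof (rule inj_onI)
      fix i j assume "i \<in> {..<r2}" "j \<in> {..<r2}" "d True (e i) = d True (e j)"
      then show "i = j" using inj_d[of "e i" "e j"] ef(1)[of i] ef(1)[of j] ne(1)[of i j] ne(1)[of j i]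
        by (cases i j rule: linorder_cases) auto
    qed
    have inj_f: "inj_on (\<lambda>i. d True (f i)) {..<r2}"
    proof (rule inj_onI)
      fix i j assume "i \<in> {..<r2}" "j \<in> {..<r2}" "d True (f i) = d True (f j)"
      then show "i = j" using inj_d[of "f i" "f j"] ef(1)[of i] ef(1)[of j] ne(2)[of i j] ne(2)[of j i]
        by (cases i j rule: linorder_cases) auto
    qed
    obtain R1 where R1: "R1 \<subseteq> {..<r2}" "card R1 = r1"
        "(\<forall>i\<in>R1. \<forall>j\<in>R1. i < j \<longrightarrow> d True (e i) < d True (e j)) \<or>
         (\<forall>i\<in>R1. \<forall>j\<in>R1. i < j \<longrightarrow> d True (e j) < d True (e i))"
      using r2[OF _ _ inj_e] by auto
    have fin1: "finite R1" using R1(1) finite_subset by blast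
    obtain R where R: "R \<subseteq> R1" "card R = m"
        "(\<forall>i\<in>R. \<forall>j\<in>R. i < j \<longrightarrow> d True (f i) < d True (f j)) \<or>
         (\<forall>i\<in>R. \<forall>j\<in>R. i < j \<longrightarrow> d True (f j) < d True (f i))"
      using r1[OF fin1 _ inj_on_subset[OF inj_f R1(1)]] R1(2) by auto
    define L where "L = sorted_list_of_set R"
    have "finite R" using R(1) fin1 finite_subset by blast
    then have L: "length L = m" "set L = R" "sorted_wrt (<) L"
      unfolding L_def using R(2) by (simp_all add: strict_sorted_list_of_set)
    have LR: "L ! i \<in> R" if "i < m" for i using nth_mem[of i L] L that by simp
    have LR1: "L ! i \<in> R1" if "i < m" for i using LR[OF that] R(1) by blast
    have Lr: "L ! i < r2" if "i < m" for i using LR1[OF that] R1(1) by blast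
    have Ll: "L ! i < L ! j" if "i < j" "j < m" for i j
      using sorted_wrt_nth_less[OF L(3) that(1)] that L(1) by simp
    have "\<exists>u. monotone_upto m (\<lambda>i. d True (e (L ! i))) u"
      using R1(3)
    proof
      assume "\<forall>i\<in>R1. \<forall>j\<in>R1. i < j \<longrightarrow> d True (e i) < d True (e j)"
      then show ?thesis using LR1 Ll unfolding monotone_upto_def by (intro exI[of _ True]) simp
    next
      assume "\<forall>i\<in>R1. \<forall>j\<in>R1. i < j \<longrightarrow> d True (e j) < d True (e i)"
      then show ?thesis using LR1 Ll unfolding monotone_upto_def by (intro exI[of _ False]) simp
    qed
    then obtain u where u: "monotone_upto m (\<lambda>i. d True (e (L ! i))) u" by blast
    have "\<exists>v. monotone_upto m (\<lambda>i. d True (f (L ! i))) v"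
      using R(3)
    proof
      assume "\<forall>i\<in>R. \<forall>j\<in>R. i < j \<longrightarrow> d True (f i) < d True (f j)"
      then show ?thesis using LR Ll unfolding monotone_upto_def by (intro exI[of _ True]) simp
    next
      assume "\<forall>i\<in>R. \<forall>j\<in>R. i < j \<longrightarrow> d True (f j) < d True (f i)"
      then show ?thesis using LR Ll unfolding monotone_upto_def by (intro exI[of _ False]) simp
    qed
    then obtain v where v: "monotone_upto m (\<lambda>i. d True (f (L ! i))) v" by blast
    have 1: "\<forall>i<m. e (L ! i) < n \<and> f (L ! i) < n" using ef(1)[OF Lr] by blast
    have 2: "\<forall>i<m. d False (e (L ! i)) < d False (f (L ! i))" using x1[OF Lr] by blast
    have 3: "\<forall>i j. i < j \<longrightarrow> j < m \<longrightarrow> d False (f (L ! i)) < d False (e (L ! j))"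
      using x2[OF Ll Lr] by blast
    have 4: "\<forall>i<m. \<forall>j<m. d True (e (L ! i)) < d True (f (L ! j))"
      using ef(1)[OF Lr] unfolding d by (meson le_less_trans)
    show "\<exists>sw px py e f u v. monotone_alternation (view c sw px py) n m e f u v"
    proof (intro exI)
      show "monotone_alternation (view c (\<not> a) r s) n m (\<lambda>i. e (L ! i)) (\<lambda>i. f (L ! i)) u v"
        unfolding monotone_alternation_def d_def[symmetric] using 1 2 3 4 u v by (intro conjI)
    qed
  qed
qed

lemma view_flip:
  "view c sw (\<not> px) py False z = - view c sw px py False z"
  "view c sw px (\<not> py) True z = - view c sw px py True z"
  "view c sw (\<not> px) py True z = view c sw px py True z"
  "view c sw px (\<not> py) False z = view c sw px py False z"
  by (simp_all add: view_def sg_def)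

lemma hosts_par:
  assumes n: "\<And>i. i < m \<Longrightarrow> h i < n \<and> l i < n"
    and real: "realizes base_rule (view c sw px py) (\<lambda>i. if even i then h (i div 2) else l (i div 2))
      (map (\<lambda>i. Par (even i)) [0..<2 * m])"
  shows "hosts c n (2 * m)"
proof (rule hosts_base[OF valid_par_word _ real])
  fix i assume "i < length (map (\<lambda>i. Par (even i)) [0..<2 * m])"
  then have "i div 2 < m" by auto
  then show "(if even i then h (i div 2) else l (i div 2)) < n" using n by auto
qed simp

theorem large_prime_hosts:
  "\<exists>N. \<forall>c n. prime_points c n \<longrightarrow> N \<le> n \<longrightarrow> hosts c n K"
proof -
  let ?k = "K + 3"
  \<comment> \<open>Long enough for \<open>2 * m\<close> wedge points to satisfy
    \<open>wedge_long_pinseq_or_hosts\<close> with \<open>L = K\<close>, and for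
    \<open>2 * (m - 1)\<close> points of a parallel alternation to give \<open>K\<close>
    letters.\<close>
  define m where "m = K + 3 + ?k * (2 * K)"
  obtain M where M: "\<And>c n. prime_points c n \<Longrightarrow> alternation c n M \<Longrightarrow> (\<exists>sw px py e f u v.
     monotone_alternation (view c sw px py) n m e f u v)"
    using ex_monotone_alternation[of m] by metis
  define B where "B = (\<Sum>t<?k. family_bound M t)"
  have B: "family_bound M t \<le> B" if "t < ?k" for t
    unfolding B_def using that by (intro member_le_sum) auto
  show ?thesis
  proof (intro exI[of _ "2 * (4 * ?k * B) + 6"] allI impI)
    fix c n assume pp: "prime_points c n" and n: "2 * (4 * ?k * B) + 6 \<le> n"
    interpret prime_points c n by (rule pp)
    have pin: "hosts c n K" if "\<exists>q. pinseq c q \<and> set q \<subseteq> {..<n} \<and> ?k \<le> length q"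
      using that pinseq_hosts by blast
    have wedge: "hosts c n K" if "wedge (view c sw px py) n w (2 * m)" for sw px py w
      using wedge_long_pinseq_or_hosts[OF that, of ?k K] pin hosts_mono[of c n "2 * K" K]
      by (auto simp: m_def)
    have "(\<exists>q. pinseq c q \<and> set q \<subseteq> {..<n} \<and> ?k \<le> length q) \<or> alternation c n M"
      by (rule long_pinseq_or_alternation[OF B n])
    then show "hosts c n K"
    proof
      assume "alternation c n M"
      then obtain sw px py e f u v where "monotone_alternation (view c sw px py) n m e f u v"
        using M[OF pp] by blast
      then have ef: "\<And>i. i < m \<Longrightarrow> e i < n \<and> f i < n"
        "\<And>i. i < m \<Longrightarrow> view c sw px py False (e i) < view c sw px py False (f i)"
        "\<And>i j. i < j \<Longrightarrow> j < m \<Longrightarrow> view c sw px py False (f i) < view c sw px py False (e j)"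
        "\<And>i j. i < m \<Longrightarrow> j < m \<Longrightarrow> view c sw px py True (e i) < view c sw px py True (f j)"
        and mono: "monotone_upto m (\<lambda>i. view c sw px py True (e i)) u"
        "monotone_upto m (\<lambda>i. view c sw px py True (f i)) v"
        unfolding monotone_alternation_def by blast+
      have par: "hosts c n K" if "hosts c n (2 * m')" "m - 1 \<le> m'" for m'
        by (rule hosts_mono[OF that(1)]) (use that(2) m_def in simp)
      consider "u" "v" | "\<not> u" "\<not> v" | "\<not> u" "v" | "u" "\<not> v" by blast
      then show ?thesis
      proof cases
        case 1
        note e = mono(1)[unfolded monotone_upto_def, rule_format, unfolded if_P[OF 1(1)]]
        note f = mono(2)[unfolded monotone_upto_def, rule_format, unfolded if_P[OF 1(2)]]
        \<comment> \<open>Words of parallel type start in the upper half, so the first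
          \<open>e\<close> is skipped and \<open>f i\<close> is followed by
          \<open>e (Suc i)\<close>.\<close>
        have "hosts c n (2 * (m - 1))"
        proof (rule hosts_par[of _ f _ "\<lambda>i. e (Suc i)", OF _ realizes_par])
          show "view c sw px py False (e (Suc i)) < view c sw px py False (f j)" if "i < j" "j < m - 1" for i j
          proof -
            have jm: "j < m" "Suc i < m" "Suc i = j \<or> Suc i < j" using that by auto
            show ?thesis
              using ef(2)[OF jm(1)] ef(2)[OF jm(2)] ef(3)[of "Suc i" j] jm by auto
          qed
        qed (use ef e f in auto)
        then show ?thesis using par by simp
      next
        case 2
        note e = mono(1)[unfolded monotone_upto_def, rule_format, unfolded if_not_P[OF 2(1)]]
        note f = mono(2)[unfolded monotone_upto_def, rule_format, unfolded if_not_P[OF 2(2)]]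
        \<comment> \<open>Turned upside down, both halves increase and \<open>e\<close> becomes the
          upper one, already in first place.\<close>
        have "hosts c n (2 * m)"
          by (rule hosts_par[of _ e _ f c sw px "\<not> py", OF _ realizes_par]) (use ef e f in \<open>auto simp: view_flip\<close>)
        then show ?thesis using par by simp
      next
        case 3
        note e = mono(1)[unfolded monotone_upto_def, rule_format, unfolded if_not_P[OF 3(1)]]
        note f = mono(2)[unfolded monotone_upto_def, rule_format, unfolded if_P[OF 3(2)]]
        show ?thesis
          by (rule wedge[OF wedgeI[of m e n f]]) (use ef e f in auto)
      next
        case 4
        note e = mono(1)[unfolded monotone_upto_def, rule_format, unfolded if_P[OF 4(1)]]
        note f = mono(2)[unfolded monotone_upto_def, rule_format, unfolded if_not_P[OF 4(2)]]
        \<comment> \<open>A wedge opening to the left is given a half turn: the horizontal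
          reflection puts \<open>f\<close> before \<open>e\<close>, and the vertical one makes
          \<open>f\<close> the lower arm, which has to come first in \<open>wedgeI\<close>.\<close>
        have rev: "m - Suc j < m - Suc i" "m - Suc i < m" if "i < j" "j < m" for i j using that by auto
        have rev': "m - Suc i < m" if "i < m" for i using that by auto
        show ?thesis
        proof (rule wedge[of sw "\<not> px" "\<not> py", OF wedgeI[of m "\<lambda>i. f (m - Suc i)" n "\<lambda>i. e (m - Suc i)"]])
          fix i j assume ij: "i < j" "j < m"
          show "view c sw (\<not> px) (\<not> py) False (e (m - Suc i)) < view c sw (\<not> px) (\<not> py) False (f (m - Suc j))"
            using ef(3)[OF rev[OF ij]] by (simp add: view_flip)
          show "view c sw (\<not> px) (\<not> py) True (e (m - Suc i)) < view c sw (\<not> px) (\<not> py) True (e (m - Suc j))"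
            using e[OF rev[OF ij]] by (simp add: view_flip)
          show "view c sw (\<not> px) (\<not> py) True (f (m - Suc j)) < view c sw (\<not> px) (\<not> py) True (f (m - Suc i))"
            using f[OF rev[OF ij]] by (simp add: view_flip)
        qed (use ef rev' in \<open>auto simp: view_flip\<close>)
      qed
    qed (rule pin)
  qed
qed

section \<open>Permutations as point sets\<close>

text \<open>\<open>agrees\<close> controls a pair only in its order of placement; distinctness of
  coordinates and of the entries of \<open>b\<close> carries the comparison over to the reverse
  order.\<close>

lemma embedding_orders:
  assumes real: "realizes R c Z w" and emb: "embedding R b w {..<length b} f" and b: "distinct b"
    and ij: "i < length b" "j < length b"
  shows "c False (Z (f i)) < c False (Z (f j)) \<longleftrightarrow> i < j"
    "c True (Z (f i)) < c True (Z (f j)) \<longleftrightarrow> b ! i < b ! j"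
proof -
  have len: "f i < length w" "f j < length w" using emb ij unfolding embedding_def by auto
  have *: "c a (Z (f i)) \<noteq> c a (Z (f j))" "c False (Z (f i)) < c False (Z (f j)) \<longleftrightarrow> i < j"
    "c True (Z (f i)) < c True (Z (f j)) \<longleftrightarrow> b ! i < b ! j"
    if "i < length b" "j < length b" "f i < f j" for i j a
  proof -
    have "f j < length w" "agrees R b i j (w ! f i) (w ! f j) (f j = Suc (f i))"
      using emb that unfolding embedding_def by auto
    moreover have "c a (Z (f i)) \<noteq> c a (Z (f j)) \<and> (c a (Z (f i)) < c a (Z (f j)) \<longleftrightarrow>
        R (w ! f i) (w ! f j) (f j = Suc (f i)) a)" for a
      using real that(3) \<open>f j < length w\<close> unfolding realizes_def by blast
    ultimately show "c a (Z (f i)) \<noteq> c a (Z (f j))" "c False (Z (f i)) < c False (Z (f j)) \<longleftrightarrow> i < j"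
      "c True (Z (f i)) < c True (Z (f j)) \<longleftrightarrow> b ! i < b ! j"
      unfolding agrees_def by simp_all
  qed
  consider "i = j" | "i \<noteq> j" "f i < f j" | "i \<noteq> j" "f j < f i" | "i \<noteq> j" "f i = f j" by linarith
  then have "(c False (Z (f i)) < c False (Z (f j)) \<longleftrightarrow> i < j) \<and>
      (c True (Z (f i)) < c True (Z (f j)) \<longleftrightarrow> b ! i < b ! j)"
  proof cases
    case 1
    then show ?thesis by simp
  next
    case 2
    then show ?thesis using *[OF ij] by blast
  next
    case 3
    have "b ! i \<noteq> b ! j" using b ij 3(1) by (simp add: nth_eq_iff_index_eq)
    then show ?thesis
      using *(1)[OF ij(2,1) 3(2), of False] *(1)[OF ij(2,1) 3(2), of True] *(2,3)[OF ij(2,1) 3(2)] 3(1)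
      by linarith
  next
    case 4
    then show ?thesis using emb ij unfolding embedding_def inj_on_def by blast
  qed
  then show "c False (Z (f i)) < c False (Z (f j)) \<longleftrightarrow> i < j"
    "c True (Z (f i)) < c True (Z (f j)) \<longleftrightarrow> b ! i < b ! j" by blast+
qed

lemma orders_embeds:
  assumes real: "realizes R c Z w" and f: "\<And>i. i < length b \<Longrightarrow> f i < length w"
    and x: "\<And>i j. i < length b \<Longrightarrow> j < length b \<Longrightarrow> c False (Z (f i)) < c False (Z (f j)) \<longleftrightarrow> i < j"
    and y: "\<And>i j. i < length b \<Longrightarrow> j < length b \<Longrightarrow> c True (Z (f i)) < c True (Z (f j)) \<longleftrightarrow> b ! i < b ! j"
  shows "embeds R b w"
  unfolding embeds_def embedding_def
proof (intro exI[of _ f] conjI ballI impI)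
  show "inj_on f {..<length b}"
  proof (rule inj_onI)
    fix i j assume "i \<in> {..<length b}" "j \<in> {..<length b}" "f i = f j"
    then show "i = j" using x[of i j] x[of j i] by (simp add: linorder_neq_iff)
  qed
  fix i j assume ij: "i \<in> {..<length b}" "j \<in> {..<length b}" "f i < f j"
  have "(c a (Z (f i)) < c a (Z (f j)) \<longleftrightarrow> R (w ! f i) (w ! f j) (f j = Suc (f i)) a)" for a
    using real ij f[of j] unfolding realizes_def by simp
  then show "agrees R b i j (w ! f i) (w ! f j) (f j = Suc (f i))"
    using x[of i j] y[of i j] ij unfolding agrees_def by simp
qed (use f in simp)

definition perm_coord :: "nat list \<Rightarrow> bool \<Rightarrow> nat \<Rightarrow> int" where
  "perm_coord p a i = (if a then int (p ! i) else int i)"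

text \<open>A set that no outside point cuts is everything between its extremes along both axes,
  hence a range of positions with a contiguous range of values.\<close>

lemma simple_prime_points:
  assumes p: "simple p" shows "prime_points (perm_coord p) (length p)"
proof
  let ?c = "perm_coord p" and ?n = "length p"
  have perm: "distinct p" "set p = {0..<?n}" using p by (auto simp: simple_def is_perm_def)
  show "?c False i = int i" for i by (simp add: perm_coord_def)
  show "i = j" if "i < ?n" "j < ?n" "?c a i = ?c a j" for i j a
    using that perm(1) by (cases a) (auto simp: perm_coord_def nth_eq_iff_index_eq)
  show "prime_set ?c {..<?n}"
    unfolding prime_set_def
  proof (intro allI impI)
    fix I assume I: "I \<subseteq> {..<?n}" "\<forall>z\<in>{..<?n} - I. \<forall>a. \<not> cut ?c a z I"
    have closed: "z \<in> I" if "x \<in> I" "y \<in> I" "z < ?n" "?c a x < ?c a z" "?c a z < ?c a y" for a x y z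
      using I(2) that unfolding cut_def by blast
    show "card I \<le> 1 \<or> I = {..<?n}"
    proof (cases "I = {}")
      case False
      have fin: "finite I" using I(1) finite_subset by blast
      define i where "i = Min I"
      define j where "j = Suc (Max I)"
      have iI: "i \<in> I" unfolding i_def using fin False by (rule Min_in)
      have jI: "Max I \<in> I" using fin False by (rule Max_in)
      have "i \<le> Max I" using fin iI by (rule Max_ge)
      moreover have "Max I < ?n" using jI I(1) by blast
      ultimately have ij: "i \<in> I" "j - 1 \<in> I" "i < j" "j \<le> ?n"
        using iI jI by (simp_all add: j_def)
      have I_eq: "I = {i..<j}"
      proof
        show "I \<subseteq> {i..<j}" unfolding i_def j_def using fin by (auto simp: less_Suc_eq_le)
        show "{i..<j} \<subseteq> I"
        proof
          fix z assume z: "z \<in> {i..<j}"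
          show "z \<in> I"
          proof (cases "z = i \<or> z = j - 1")
            case False
            then show ?thesis
              using closed[OF ij(1,2), of z False] z ij(4) by (auto simp: perm_coord_def)
          qed (use ij in auto)
        qed
      qed
      let ?A = "(\<lambda>k. p ! k) ` I"
      have finA: "finite ?A" and neA: "?A \<noteq> {}" using fin False by auto
      define a where "a = Min ?A"
      define b where "b = Max ?A"
      have ab: "a \<in> ?A" "b \<in> ?A" unfolding a_def b_def by (rule Min_in[OF finA neA], rule Max_in[OF finA neA])
      have A_eq: "?A = {a..b}"
      proof
        show "?A \<subseteq> {a..b}" unfolding a_def b_def using finA by auto
        show "{a..b} \<subseteq> ?A"
        proof
          fix y assume y: "y \<in> {a..b}"
          obtain u v where uv: "u \<in> I" "a = p ! u" "v \<in> I" "b = p ! v" using ab by blast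
          have "b \<in> set p" using uv I(1) nth_mem by auto
          then have "y \<in> set p" using y perm(2) by auto
          then obtain z where z: "z < ?n" "p ! z = y" by (auto simp: in_set_conv_nth)
          show "y \<in> ?A"
          proof (cases "y = a \<or> y = b")
            case False
            then have "z \<in> I" using closed[OF uv(1,3) z(1), of True] uv z y by (auto simp: perm_coord_def)
            then show ?thesis using z by blast
          qed (use ab in auto)
        qed
      qed
      have "inj_on (\<lambda>k. p ! k) I" using perm(1) I(1) by (intro inj_on_nth) auto
      then have "card ?A = card I" by (rule card_image)
      then have card: "Suc b - a = j - i" unfolding A_eq by (simp add: I_eq)
      have "is_interval p i j"
        unfolding is_interval_def
      proof (intro conjI exI[of _ a])
        have "a \<le> b" using A_eq neA by (metis atLeastatMost_empty_iff)
        then have "{a..b} = {a..<a + (j - i)}" using card ij(3) by auto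
        then show "(\<lambda>k. p ! k) ` {i..<j} = {a..<a + (j - i)}" using A_eq I_eq by simp
      qed (use ij in auto)
      then have "j - i = 0 \<or> j - i = 1 \<or> j - i = ?n" using p unfolding simple_def by blast
      then show ?thesis using ij unfolding I_eq by auto
    qed simp
  qed
qed

lemma hosts_avoids:
  assumes p: "p \<in> Av B" "simple p" and B: "\<And>b. b \<in> B \<Longrightarrow> is_perm b"
    and hosts: "hosts (perm_coord p) (length p) K"
  shows "\<exists>w. length w = K \<and> valid_word letter_init letter_next w \<and> \<not> (\<exists>b\<in>B. embeds letter_rule b w)"
proof -
  obtain w Z where w: "valid_word letter_init letter_next w" "length w = K"
      "realizes letter_rule (perm_coord p) Z w" "\<And>i. i < K \<Longrightarrow> Z i < length p"
    using hosts unfolding hosts_def by blast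
  have "\<not> embeds letter_rule b w" if b: "b \<in> B" for b
  proof
    assume "embeds letter_rule b w"
    then obtain f where f: "embedding letter_rule b w {..<length b} f" unfolding embeds_def by blast
    have "distinct b" using B[OF b] by (simp add: is_perm_def)
    note ord = embedding_orders[OF w(3) f this]
    have fw: "f i < K" if "i < length b" for i using f that w(2) unfolding embedding_def by auto
    let ?idx = "map (\<lambda>i. Z (f i)) [0..<length b]"
    have "contains p b"
      unfolding contains_def
    proof (intro exI[of _ ?idx] conjI ballI allI impI)
      show "sorted_wrt (<) ?idx"
        unfolding sorted_wrt_iff_nth_less using ord(1) by (auto simp: perm_coord_def)
      show "i < length p" if "i \<in> set ?idx" for i using that w(4) fw by auto
      fix i j assume "i < length b" "j < length b"
      then show "(p ! (?idx ! i) < p ! (?idx ! j)) = (b ! i < b ! j)"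
        using ord(2)[of i j] by (simp add: perm_coord_def)
    qed simp
    then show False using p(1) b unfolding Av_def by blast
  qed
  then show ?thesis using w by blast
qed

section \<open>From words back to simple permutations\<close>

lemma standardize:
  fixes c :: "bool \<Rightarrow> 'p \<Rightarrow> int"
  assumes T: "finite T" "prime_set c T" "\<And>a. inj_on (c a) T"
  obtains p z where "simple p" "length p = card T" "\<And>i. i < card T \<Longrightarrow> z i \<in> T"
    "\<And>i j. i < card T \<Longrightarrow> j < card T \<Longrightarrow> c False (z i) < c False (z j) \<longleftrightarrow> i < j"
    "\<And>i j. i < card T \<Longrightarrow> j < card T \<Longrightarrow> c True (z i) < c True (z j) \<longleftrightarrow> p ! i < p ! j"
proof -
  let ?m = "card T"
  define xs where "xs = sorted_list_of_set (c False ` T)"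
  have xs: "length xs = ?m" "set xs = c False ` T" "sorted_wrt (<) xs"
    unfolding xs_def using T(1) card_image[OF T(3)[of False]] by (simp_all add: strict_sorted_list_of_set)
  define z where "z k = inv_into T (c False) (xs ! k)" for k
  have xsT: "xs ! k \<in> c False ` T" if "k < ?m" for k using xs(1,2) that nth_mem by metis
  have zT: "z k \<in> T" if "k < ?m" for k unfolding z_def by (rule inv_into_into[OF xsT[OF that]])
  have cz: "c False (z k) = xs ! k" if "k < ?m" for k unfolding z_def by (rule f_inv_into_f[OF xsT[OF that]])
  have x_less: "xs ! i < xs ! j" if "i < j" "j < ?m" for i j
    using sorted_wrt_nth_less[OF xs(3) that(1)] that xs(1) by simp
  have zx: "c False (z i) < c False (z j) \<longleftrightarrow> i < j" if ij: "i < ?m" "j < ?m" for i j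
    using x_less[of i j] x_less[of j i] ij by (cases i j rule: linorder_cases) (auto simp: cz)
  define rk where "rk y = card {x \<in> T. c True x < c True y}" for y
  have rk_mono: "rk x < rk y" if "x \<in> T" "c True x < c True y" for x y
    unfolding rk_def using that T(1) by (intro psubset_card_mono) (auto intro: less_trans)
  have rk_less: "rk y < ?m" if "y \<in> T" for y
    unfolding rk_def using that T(1) by (intro psubset_card_mono) auto
  have rk: "c True x < c True y \<longleftrightarrow> rk x < rk y" if "x \<in> T" "y \<in> T" for x y
  proof (cases "c True x" "c True y" rule: linorder_cases)
    case equal
    then have "x = y" using inj_onD[OF T(3)] that by blast
    then show ?thesis by simp
  qed (use rk_mono that in \<open>auto dest: less_asym\<close>)
  define p where "p = map (\<lambda>k. rk (z k)) [0..<?m]"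
  have len: "length p = ?m" by (simp add: p_def)
  have pz: "c True (z i) < c True (z j) \<longleftrightarrow> p ! i < p ! j" if "i < ?m" "j < ?m" for i j
    using rk[OF zT[OF that(1)] zT[OF that(2)]] that by (simp add: p_def)
  have inj_z: "i = j" if "i < ?m" "j < ?m" "z i = z j" for i j
    using zx[OF that(1,2)] zx[OF that(2,1)] that(3) by auto
  have z_image: "z ` {..<?m} = T"
  proof (rule card_subset_eq[OF T(1)])
    show "z ` {..<?m} \<subseteq> T" using zT by auto
    have "inj_on z {..<?m}" using inj_z by (auto intro: inj_onI)
    then show "card (z ` {..<?m}) = card T" by (simp add: card_image)
  qed
  have dist: "distinct p"
    unfolding distinct_conv_nth len
  proof (intro allI impI)
    fix i j assume ij: "i < ?m" "j < ?m" "i \<noteq> j"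
    then have "z i \<noteq> z j" using inj_z by blast
    then have "c True (z i) \<noteq> c True (z j)" using inj_onD[OF T(3) _ zT zT] ij by blast
    then show "p ! i \<noteq> p ! j" using pz[of i j] pz[of j i] ij by auto
  qed
  have perm: "is_perm p"
  proof -
    have "set p \<subseteq> {0..<?m}" using rk_less zT by (auto simp: p_def)
    moreover have "card (set p) = card {0..<?m}" using distinct_card[OF dist] len by simp
    ultimately have "set p = {0..<?m}" by (intro card_subset_eq) auto
    then show ?thesis using dist len by (simp add: is_perm_def)
  qed
  have "simple p"
    unfolding simple_def
  proof (intro conjI allI impI perm)
    fix i j assume "is_interval p i j"
    then obtain a where ij: "i \<le> j" "j \<le> ?m" "(\<lambda>k. p ! k) ` {i..<j} = {a..<a + (j - i)}"
      unfolding is_interval_def len by blast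
    let ?I = "z ` {i..<j}"
    have sub: "?I \<subseteq> T" using zT ij(2) by auto
    have "\<not> cut c b y ?I" if y: "y \<in> T - ?I" for y b
    proof
      assume "cut c b y ?I"
      then obtain u v where uv: "u \<in> {i..<j}" "v \<in> {i..<j}" "c b (z u) < c b y" "c b y < c b (z v)"
        unfolding cut_def by blast
      obtain k where k: "k < ?m" "y = z k" using y z_image by blast
      have uvm: "u < ?m" "v < ?m" using uv(1,2) ij(2) by auto
      have nk: "k \<notin> {i..<j}" using y k by blast
      show False
      proof (cases b)
        case False
        then have "u < k" "k < v" using uv(3,4) zx[OF uvm(1) k(1)] zx[OF k(1) uvm(2)] k(2) by auto
        then show False using nk uv(1,2) by auto
      next
        case True
        then have "p ! u < p ! k" "p ! k < p ! v"
          using uv(3,4) pz[OF uvm(1) k(1)] pz[OF k(1) uvm(2)] k(2) by auto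
        moreover have "p ! u \<in> {a..<a + (j - i)}" "p ! v \<in> {a..<a + (j - i)}"
          using uv(1,2) unfolding ij(3)[symmetric] by blast+
        ultimately have "p ! k \<in> {a..<a + (j - i)}" by auto
        then obtain k' where k': "k' \<in> {i..<j}" "p ! k = p ! k'" unfolding ij(3)[symmetric] by blast
        have "k' < ?m" using k'(1) ij(2) by auto
        then have "k = k'" using dist k' k(1) len by (simp add: nth_eq_iff_index_eq)
        then show False using nk k'(1) by simp
      qed
    qed
    then have "\<forall>y\<in>T - ?I. \<forall>b. \<not> cut c b y ?I" by (intro ballI allI)
    then have "card ?I \<le> 1 \<or> ?I = T"
      by (rule T(2)[unfolded prime_set_def, THEN spec, THEN mp, THEN mp, OF sub])
    moreover have "card ?I = j - i"
    proof -
      have "inj_on z {i..<j}" using inj_z ij(2) by (auto intro!: inj_onI)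
      then show ?thesis by (simp add: card_image)
    qed
    ultimately show "j - i = 0 \<or> j - i = 1 \<or> j - i = length p" using len by auto
  qed
  then show ?thesis using len zT zx pz by (rule that)
qed

lemma avoiding_word_simple:
  assumes w: "valid_word letter_init letter_next w" "10 \<le> length w"
    and avoid: "\<not> (\<exists>b\<in>B. embeds letter_rule b w)"
  shows "\<exists>p\<in>Av B. simple p \<and> length w \<le> length p + 4"
proof -
  obtain c T where T: "realizes letter_rule c id w" "T \<subseteq> {..<length w}" "prime_set c T"
      "length w \<le> card T + 4"
    using valid_letters_prime[OF w] by blast
  have fin: "finite T" using T(2) finite_subset by blast
  have inj: "inj_on (c a) T" for a
  proof (rule inj_onI)
    fix i j assume "i \<in> T" "j \<in> T" "c a i = c a j"
    moreover have "c a i \<noteq> c a j" if "i < j" "j < length w" for i j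
      using T(1) that unfolding realizes_def by simp
    ultimately show "i = j" using T(2) by (metis lessThan_iff linorder_neqE_nat subsetD)
  qed
  obtain p z where p: "simple p" "length p = card T" "\<And>i. i < card T \<Longrightarrow> z i \<in> T"
    "\<And>i j. i < card T \<Longrightarrow> j < card T \<Longrightarrow> c False (z i) < c False (z j) \<longleftrightarrow> i < j"
    "\<And>i j. i < card T \<Longrightarrow> j < card T \<Longrightarrow> c True (z i) < c True (z j) \<longleftrightarrow> p ! i < p ! j"
    using standardize[OF fin T(3) inj] by blast
  have "\<not> contains p b" if b: "b \<in> B" for b
  proof
    assume "contains p b"
    then obtain idx where idx: "length idx = length b" "sorted_wrt (<) idx" "\<forall>i\<in>set idx. i < length p"
      "\<forall>i<length b. \<forall>j<length b. (p ! (idx ! i) < p ! (idx ! j)) = (b ! i < b ! j)"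
      unfolding contains_def by blast
    have im: "idx ! i < card T" if "i < length b" for i using idx(1,3) that p(2) nth_mem[of i idx] by auto
    have less: "idx ! i < idx ! j" if "i < j" "j < length b" for i j
      using sorted_wrt_nth_less[OF idx(2) that(1)] that(2) idx(1) by simp
    have "embeds letter_rule b w"
    proof (rule orders_embeds[OF T(1), of b "\<lambda>i. z (idx ! i)"])
      show "z (idx ! i) < length w" if "i < length b" for i using p(3)[OF im[OF that]] T(2) by auto
      fix i j assume ij: "i < length b" "j < length b"
      have "idx ! i < idx ! j \<longleftrightarrow> i < j"
        using less[of i j] less[of j i] ij by (cases i j rule: linorder_cases) auto
      then show "c False (id (z (idx ! i))) < c False (id (z (idx ! j))) \<longleftrightarrow> i < j"
        using p(4)[OF im im] ij by simp
      show "c True (id (z (idx ! i))) < c True (id (z (idx ! j))) \<longleftrightarrow> b ! i < b ! j"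
        using p(5)[OF im im] ij idx(4) by simp
    qed
    then show False using avoid b by blast
  qed
  moreover have "is_perm p" using p(1) by (simp add: simple_def)
  ultimately have "p \<in> Av B" unfolding Av_def by blast
  then show ?thesis using p(1,2) T(4) by auto
qed

lemma infinite_simples_iff:
  fixes bs :: "nat list list"
  assumes bs: "\<forall>b\<in>set bs. is_perm b"
  shows "infinite {p \<in> Av (set bs). simple p} \<longleftrightarrow>
    (\<exists>w. length w = pumping_length CARD(letter) (code_perms bs) \<and>
       valid_word letter_init letter_next w \<and> \<not> (\<exists>b\<in>set bs. embeds letter_rule b w))"
proof
  let ?K = "pumping_length CARD(letter) (code_perms bs)"
  assume inf: "infinite {p \<in> Av (set bs). simple p}"
  obtain N where N: "\<And>c n. prime_points c n \<Longrightarrow> N \<le> n \<Longrightarrow> hosts c n ?K"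
    using large_prime_hosts by blast
  have "\<exists>p\<in>Av (set bs). simple p \<and> N \<le> length p"
  proof (rule ccontr)
    assume no: "\<not> ?thesis"
    have "{p \<in> Av (set bs). simple p} \<subseteq> {p. set p \<subseteq> {0..<N} \<and> length p \<le> N}"
    proof
      fix p assume p: "p \<in> {p \<in> Av (set bs). simple p}"
      then have "p \<in> Av (set bs)" "simple p" by simp_all
      then have "\<not> N \<le> length p" using no by blast
      then have "length p < N" by simp
      moreover have "set p = {0..<length p}" using p by (auto simp: simple_def is_perm_def)
      ultimately show "p \<in> {p. set p \<subseteq> {0..<N} \<and> length p \<le> N}" by auto
    qed
    then show False using inf finite_lists_length_le[of "{0..<N}" N] finite_subset by blast
  qed
  then obtain p where p: "p \<in> Av (set bs)" "simple p" "N \<le> length p" by blast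
  have "hosts (perm_coord p) (length p) ?K" by (rule N[OF simple_prime_points[OF p(2)] p(3)])
  then show "\<exists>w. length w = ?K \<and> valid_word letter_init letter_next w \<and>
      \<not> (\<exists>b\<in>set bs. embeds letter_rule b w)"
    using hosts_avoids[OF p(1,2)] bs by blast
next
  let ?K = "pumping_length CARD(letter) (code_perms bs)"
  assume "\<exists>w. length w = ?K \<and> valid_word letter_init letter_next w \<and>
      \<not> (\<exists>b\<in>set bs. embeds letter_rule b w)"
  then obtain w where w: "length w = ?K" "valid_word letter_init letter_next w"
      "\<not> (\<exists>b\<in>set bs. embeds letter_rule b w)" by blast
  have long: "\<exists>p\<in>Av (set bs). simple p \<and> n \<le> length p" for n
  proof -
    \<comment> \<open>The surplus of 10 meets the length hypothesis of
      \<open>avoiding_word_simple\<close> and absorbs its loss of 4.\<close>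
    obtain w' where w': "n + 10 \<le> length w'" "valid_word letter_init letter_next w'"
        "\<not> (\<exists>b\<in>set bs. embeds letter_rule b w')"
      using pump_unbounded[OF w(2,3) eq_refl[OF w(1)[symmetric]], of "n + 10"] by blast
    have "10 \<le> length w'" using w'(1) by simp
    then obtain p where "p \<in> Av (set bs)" "simple p" "length w' \<le> length p + 4"
      using avoiding_word_simple[OF w'(2) _ w'(3)] by blast
    then show ?thesis using w'(1) by (intro bexI[of _ p]) auto
  qed
  show "infinite {p \<in> Av (set bs). simple p}"
  proof
    assume fin: "finite {p \<in> Av (set bs). simple p}"
    obtain p where p: "p \<in> Av (set bs)" "simple p"
        "Suc (Max (length ` {p \<in> Av (set bs). simple p})) \<le> length p" using long by blast
    then have "length p \<le> Max (length ` {p \<in> Av (set bs). simple p})" using fin by (intro Max_ge) auto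
    then show False using p(3) by simp
  qed
qed

theorem mainTheorem10:
  shows "\<exists>f :: recf. \<forall>bs :: nat list list. (\<forall>b\<in>set bs. is_perm b) \<longrightarrow>
           eval f [code_perms bs]
             (if infinite {p \<in> Av (set bs). simple p} then 1 else 0)"
proof -
  let ?g = "CARD(letter)"
  \<comment> \<open>Any enumeration of the letters will do, since it enters the program only through
    finite tables.\<close>
  obtain dl :: "nat \<Rightarrow> letter" where "bij_betw dl {0..<?g} UNIV"
    using ex_bij_betw_nat_finite[OF finite] by blast
  then have dl: "dl ` {..<?g} = UNIV" by (simp add: bij_betw_def atLeast0LessThan)
  have g: "0 < ?g" by simp
  let ?K = "pumping_length ?g"
  let ?P = "\<lambda>c. \<exists>u<?g ^ ?K c. word_avoids_code letter_init letter_next letter_rule dl ?g (?K c) c u"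
  obtain f where f: "\<And>c. eval f [c] (of_bool (?P c))"
    using decides_from_decidable[of ?P, OF decidable_avoiding_word] by blast
  have "?P (code_perms bs) \<longleftrightarrow> infinite {p \<in> Av (set bs). simple p}" if "\<forall>b\<in>set bs. is_perm b" for bs
  proof -
    have K: "0 < ?K (code_perms bs)" by (simp add: pumping_length_def)
    show ?thesis
      unfolding infinite_simples_iff[OF that] ex_word_digits[OF dl] word_avoids_code_iff[OF g K] ..
  qed
  then have answer: "of_bool (?P (code_perms bs)) = (if infinite {p \<in> Av (set bs). simple p} then 1 else 0 :: nat)"
    if "\<forall>b\<in>set bs. is_perm b" for bs
    using that by simp
  show ?thesis
  proof (intro exI[of _ f] allI impI)
    fix bs :: "nat list list"
    assume bs: "\<forall>b\<in>set bs. is_perm b"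
    show "eval f [code_perms bs] (if infinite {p \<in> Av (set bs). simple p} then 1 else 0)"
      using f[of "code_perms bs"] unfolding answer[OF bs] .
  qed
qed

end
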